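(* Let $\alpha>1$, let $(M^m,g)$ be a compact, orientable Riemannian manifold without boundary, let $(N^n,h)$ be a Riemannian manifold isometrically embedded as a submanifold of a Euclidean space $\mathbb R^{n+p}$ (with arbitrary codimension $p$), and let $\psi:(M^m,g)\to(N^n,h)$ be a non-constant $\alpha$-harmonic map. Suppose that $$2(\alpha-1)f(x)+\theta(\upsilon)<\mathrm{Ric}(\upsilon,\upsilon)$$ at each $x\in N$ and for any unit vector $\upsilon\in T_xN$, where $\mathrm{Ric}$ is the Ricci curvature of $N$ and $f,\theta$ are the functions, built from the second fundamental form of $N$ in $\mathbb R^{n+p}$, given in the context. Then $\psi$ is ($\alpha$-)unstable.
   Context: Let $\nabla^{\mathbb R}$ be the Levi-Civita connection of $\mathbb R^{n+p}$. The second fundamental form of $N$ in $\mathbb R^{n+p}$ is $B(X,Y)=(\nabla^{\mathbb R}_XY)^\perp$ for $X,Y$ tangent to $N$, where $\perp$ denotes the component normal to $N$. For $x\in N$, $$f(x)=\max\{|B(\upsilon,\upsilon)|^2:\upsilon\in T_xN,\ |\upsilon|=1\},$$ and for $\upsilon\in T_xN$, $\theta(\upsilon)=\sum_{a=1}^n|B(\upsilon,\upsilon_a)|^2$, where $\{\upsilon_a\}_{a=1}^n$ is any orthonormal basis of $T_xN$. For a smooth map $\psi:(M,g)\to(N,h)$, $|d\psi|^2$ is the squared Hilbert-Schmidt norm of $d\psi$ and $\tau(\psi)=\mathrm{Tr}_g\nabla d\psi$ is the tension field. The $\alpha$-energy is $E_\alpha(\psi)=\int_M(1+|d\psi|^2)^\alpha\,dV_g$;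 $\psi$ is $\alpha$-harmonic if it is a critical point of $E_\alpha$, equivalently $2\alpha(1+|d\psi|^2)^{\alpha-1}\tau(\psi)+d\psi(\mathrm{grad}(2\alpha(1+|d\psi|^2)^{\alpha-1}))=0$. For an $\alpha$-harmonic $\psi$ and vector fields $\upsilon,\omega\in\Gamma(\psi^{-1}TN)$ along $\psi$, let $I_{\alpha,\psi}(\upsilon,\omega)=\frac{\partial^2}{\partial t\,\partial s}E_\alpha(\psi_{t,s})\big|_{s=t=0}$, where $\psi_{t,s}$ is a smooth 2-parameter variation of $\psi=\psi_{0,0}$ with $\frac{\partial\psi_{t,s}}{\partial t}|_{0,0}=\upsilon$, $\frac{\partial\psi_{t,s}}{\partial s}|_{0,0}=\omega$. The map $\psi$ is $\alpha$-stable (stable) if $I_{\alpha,\psi}(\omega,\omega)\ge0$ for every vector field $\omega$ along $\psi$, and $\alpha$-unstable (unstable) otherwise.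
   Formalization: M is additionally assumed connected (a common convention): on a disconnected M a map that is constant on each component with different values is non-constant, α-harmonic and stable; if ψ is non-constant on some component, the result applies to that component. *)

theory Defs
  imports "HOL-Analysis.Analysis"
begin

section \<open>Smooth maps between Euclidean spaces\<close>

text \<open>Only used on open sets.\<close>

primrec Ck_on :: "nat \<Rightarrow> ('a::real_normed_vector \<Rightarrow> 'b::real_normed_vector) \<Rightarrow> 'a set \<Rightarrow> bool" where
  "Ck_on 0 f S \<longleftrightarrow> continuous_on S f"
| "Ck_on (Suc k) f S \<longleftrightarrow>
     (\<forall>x\<in>S. f differentiable (at x)) \<and> (\<forall>v. Ck_on k (\<lambda>x. frechet_derivative f (at x) v) S)"

definition smooth_on :: "'a::real_normed_vector set \<Rightarrow> ('a \<Rightarrow> 'b::real_normed_vector) \<Rightarrow> bool" where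
  "smooth_on S f \<longleftrightarrow> (\<forall>k. Ck_on k f S)"


section \<open>The target: submanifolds of a Euclidean space with the induced metric\<close>

definition embedded_submanifold :: "nat \<Rightarrow> 'e::euclidean_space set \<Rightarrow> bool" where
  "embedded_submanifold n N \<longleftrightarrow>
     (\<forall>x\<in>N. \<exists>U \<Phi> \<Phi>' S. open U \<and> x \<in> U \<and> open (\<Phi> ` U) \<and> smooth_on U \<Phi> \<and> smooth_on (\<Phi> ` U) \<Phi>' \<and>
        (\<forall>y\<in>U. \<Phi>' (\<Phi> y) = y) \<and>
        subspace (S :: 'e set) \<and> dim S = n \<and> \<Phi> ` (U \<inter> N) = \<Phi> ` U \<inter> S)"

definition tangent_space :: "'e::euclidean_space set \<Rightarrow> 'e \<Rightarrow> 'e set" where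
  "tangent_space N x =
     {v. \<exists>\<gamma> \<epsilon>. \<epsilon> > 0 \<and> smooth_on {-\<epsilon><..<\<epsilon>} \<gamma> \<and> (\<forall>t\<in>{-\<epsilon><..<\<epsilon>}. \<gamma> t \<in> N) \<and>
             \<gamma> 0 = x \<and> (\<gamma> has_vector_derivative v) (at 0)}"

definition normal_part :: "'e::euclidean_space set \<Rightarrow> 'e \<Rightarrow> 'e \<Rightarrow> 'e" where
  "normal_part N x w =
     (THE z. z \<in> orthogonal_comp (tangent_space N x) \<and> w - z \<in> tangent_space N x)"

definition smooth_along :: "'e::euclidean_space set \<Rightarrow> ('e \<Rightarrow> 'b::real_normed_vector) \<Rightarrow> bool" where
  "smooth_along N F \<longleftrightarrow>
     (\<forall>x\<in>N. \<exists>U G. open U \<and> x \<in> U \<and> smooth_on U G \<and> (\<forall>y\<in>U \<inter> N. G y = F y))"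

definition vector_fields :: "'e::euclidean_space set \<Rightarrow> ('e \<Rightarrow> 'e) set" where
  "vector_fields N = {X. smooth_along N X \<and> (\<forall>x\<in>N. X x \<in> tangent_space N x)}"

text \<open>
  The derivative of \<open>F\<close>, a function on \<open>N\<close>, in direction \<open>u\<close>.  A derivative of \<open>F\<close> within \<open>N\<close> is not
  unique as a linear map on the ambient space, but its restriction to the tangent space is, so
  this is well defined for tangent \<open>u\<close>.  For vector-valued \<open>F\<close> it is the Levi-Civita connection of
  the ambient Euclidean space.
\<close>

definition dir_deriv ::
  "'e::euclidean_space set \<Rightarrow> ('e \<Rightarrow> 'b::real_normed_vector) \<Rightarrow> 'e \<Rightarrow> 'e \<Rightarrow> 'b" where
  "dir_deriv N F x u = frechet_derivative F (at x within N) u"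

definition field_through :: "'e::euclidean_space set \<Rightarrow> 'e \<Rightarrow> 'e \<Rightarrow> 'e \<Rightarrow> 'e" where
  "field_through N x v = (SOME X. X \<in> vector_fields N \<and> X x = v)"

text \<open>Second fundamental form; it is tensorial, so the choice of the extension of \<open>v\<close> is immaterial.\<close>

definition second_ff :: "'e::euclidean_space set \<Rightarrow> 'e \<Rightarrow> 'e \<Rightarrow> 'e \<Rightarrow> 'e" where
  "second_ff N x u v = normal_part N x (dir_deriv N (field_through N x v) x u)"

definition orthonormal_basis :: "'e::euclidean_space set \<Rightarrow> 'e set \<Rightarrow> bool" where
  "orthonormal_basis T E \<longleftrightarrow>
     E \<subseteq> T \<and> pairwise orthogonal E \<and> (\<forall>e\<in>E. norm e = 1) \<and> span E = T"

definition some_onb :: "'e::euclidean_space set \<Rightarrow> 'e set" where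
  "some_onb T = (SOME E. orthonormal_basis T E)"

text \<open>The supremum is attained: a continuous function on the unit sphere of the tangent space.\<close>

definition ff_max :: "'e::euclidean_space set \<Rightarrow> 'e \<Rightarrow> real" where
  "ff_max N x = (SUP v \<in> {v \<in> tangent_space N x. norm v = 1}. (norm (second_ff N x v v))\<^sup>2)"

definition ff_theta :: "'e::euclidean_space set \<Rightarrow> 'e \<Rightarrow> 'e \<Rightarrow> real" where
  "ff_theta N x v = (\<Sum>e\<in>some_onb (tangent_space N x). (norm (second_ff N x v e))\<^sup>2)"

text \<open>Differentiating the inclusion map in the commutator \<open>X(Yf) - Y(Xf)\<close> gives this formula.\<close>

definition lie_bracket :: "'e::euclidean_space set \<Rightarrow> ('e \<Rightarrow> 'e) \<Rightarrow> ('e \<Rightarrow> 'e) \<Rightarrow> 'e \<Rightarrow> 'e" where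
  "lie_bracket N X Y x = dir_deriv N Y x (X x) - dir_deriv N X x (Y x)"

definition is_levi_civita ::
  "'e::euclidean_space set \<Rightarrow> (('e \<Rightarrow> 'e) \<Rightarrow> ('e \<Rightarrow> 'e) \<Rightarrow> 'e \<Rightarrow> 'e) \<Rightarrow> bool" where
  "is_levi_civita N nab \<longleftrightarrow>
     (\<forall>X\<in>vector_fields N. \<forall>Y\<in>vector_fields N. nab X Y \<in> vector_fields N) \<and>
     (\<forall>X\<in>vector_fields N. \<forall>Y\<in>vector_fields N. \<forall>Z\<in>vector_fields N. \<forall>x\<in>N.
        nab (\<lambda>y. X y + Y y) Z x = nab X Z x + nab Y Z x \<and>
        nab X (\<lambda>y. Y y + Z y) x = nab X Y x + nab X Z x) \<and>
     (\<forall>\<phi>::'e \<Rightarrow> real. smooth_along N \<phi> \<longrightarrow>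
        (\<forall>X\<in>vector_fields N. \<forall>Y\<in>vector_fields N. \<forall>x\<in>N.
           nab (\<lambda>y. \<phi> y *\<^sub>R X y) Y x = \<phi> x *\<^sub>R nab X Y x \<and>
           nab X (\<lambda>y. \<phi> y *\<^sub>R Y y) x = dir_deriv N \<phi> x (X x) *\<^sub>R Y x + \<phi> x *\<^sub>R nab X Y x)) \<and>
     (\<forall>X\<in>vector_fields N. \<forall>Y\<in>vector_fields N. \<forall>x\<in>N.
        nab X Y x - nab Y X x = lie_bracket N X Y x) \<and>
     (\<forall>X\<in>vector_fields N. \<forall>Y\<in>vector_fields N. \<forall>Z\<in>vector_fields N. \<forall>x\<in>N.
        dir_deriv N (\<lambda>y. Y y \<bullet> Z y) x (X x) = nab X Y x \<bullet> Z x + Y x \<bullet> nab X Z x)"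

text \<open>The values on \<open>N\<close> are determined by the Koszul formula.\<close>

definition levi_civita ::
  "'e::euclidean_space set \<Rightarrow> ('e \<Rightarrow> 'e) \<Rightarrow> ('e \<Rightarrow> 'e) \<Rightarrow> 'e \<Rightarrow> 'e" where
  "levi_civita N = (SOME nab. is_levi_civita N nab)"

definition riemann ::
  "'e::euclidean_space set \<Rightarrow> ('e \<Rightarrow> 'e) \<Rightarrow> ('e \<Rightarrow> 'e) \<Rightarrow> ('e \<Rightarrow> 'e) \<Rightarrow> 'e \<Rightarrow> 'e" where
  "riemann N X Y Z x =
     levi_civita N X (levi_civita N Y Z) x - levi_civita N Y (levi_civita N X Z) x
     - levi_civita N (lie_bracket N X Y) Z x"

text \<open>With this sign convention the Ricci curvature of round spheres is positive.\<close>

definition ricci :: "'e::euclidean_space set \<Rightarrow> 'e \<Rightarrow> 'e \<Rightarrow> 'e \<Rightarrow> real" where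
  "ricci N x u v =
     (\<Sum>e\<in>some_onb (tangent_space N x).
        riemann N (field_through N x e) (field_through N x u) (field_through N x v) x \<bullet> e)"


section \<open>The domain: abstract Riemannian manifolds\<close>

text \<open>
  A chart is a pair of its domain and its coordinate map; the dimension is \<open>CARD('m)\<close>.
\<close>

type_synonym ('a, 'm) coord_chart = "'a set \<times> ('a \<Rightarrow> real ^ 'm)"

abbreviation chart_dom :: "('a, 'm) coord_chart \<Rightarrow> 'a set" where
  "chart_dom c \<equiv> fst c"

abbreviation chart_map :: "('a, 'm) coord_chart \<Rightarrow> 'a \<Rightarrow> real ^ 'm" where
  "chart_map c \<equiv> snd c"

definition chart_inv :: "('a, 'm) coord_chart \<Rightarrow> real ^ 'm \<Rightarrow> 'a" where
  "chart_inv c = inv_into (chart_dom c) (chart_map c)"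

definition transition ::
  "('a, 'm) coord_chart \<Rightarrow> ('a, 'm) coord_chart \<Rightarrow> real ^ 'm \<Rightarrow> real ^ 'm" where
  "transition c d = chart_map d \<circ> chart_inv c"

definition smooth_atlas ::
  "'a::{t2_space, second_countable_topology} set \<Rightarrow> ('a, 'm::finite) coord_chart set \<Rightarrow> bool" where
  "smooth_atlas M A \<longleftrightarrow>
     M = (\<Union>c\<in>A. chart_dom c) \<and>
     (\<forall>c\<in>A. openin (top_of_set M) (chart_dom c) \<and> open (chart_map c ` chart_dom c) \<and>
        homeomorphism (chart_dom c) (chart_map c ` chart_dom c) (chart_map c) (chart_inv c)) \<and>
     (\<forall>c\<in>A. \<forall>d\<in>A. smooth_on (chart_map c ` (chart_dom c \<inter> chart_dom d)) (transition c d))"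

definition jacobian ::
  "('a, 'm::finite) coord_chart \<Rightarrow> ('a, 'm) coord_chart \<Rightarrow> 'a \<Rightarrow> real ^ 'm ^ 'm" where
  "jacobian c d x = matrix (frechet_derivative (transition c d) (at (chart_map c x)))"

definition orientable_manifold ::
  "'a::{t2_space, second_countable_topology} set \<Rightarrow> ('a, 'm::finite) coord_chart set \<Rightarrow> bool" where
  "orientable_manifold M A \<longleftrightarrow>
     (\<exists>B. smooth_atlas M B \<and> smooth_atlas M (A \<union> B) \<and>
        (\<forall>c\<in>B. \<forall>d\<in>B. \<forall>x\<in>chart_dom c \<inter> chart_dom d. det (jacobian c d x) > 0))"

text \<open>
  A Riemannian metric is given by its matrix \<open>G c x\<close> of components with respect to the coordinate
  frame of the chart \<open>c\<close> at \<open>x\<close>, subject to the transformation rule of a covariant 2-tensor.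
\<close>

definition riemannian_metric ::
  "('a, 'm::finite) coord_chart set \<Rightarrow> (('a, 'm) coord_chart \<Rightarrow> 'a \<Rightarrow> real ^ 'm ^ 'm) \<Rightarrow> bool" where
  "riemannian_metric A G \<longleftrightarrow>
     (\<forall>c\<in>A. smooth_on (chart_map c ` chart_dom c) (\<lambda>y. G c (chart_inv c y))) \<and>
     (\<forall>c\<in>A. \<forall>x\<in>chart_dom c. transpose (G c x) = G c x \<and> (\<forall>v. v \<noteq> 0 \<longrightarrow> v \<bullet> (G c x *v v) > 0)) \<and>
     (\<forall>c\<in>A. \<forall>d\<in>A. \<forall>x\<in>chart_dom c \<inter> chart_dom d.
        G c x = transpose (jacobian c d x) ** G d x ** jacobian c d x)"

text \<open>
  The Riemannian measure on a compact manifold: cut \<open>M\<close> into finitely many Borel pieces, each inside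
  a compact part of a chart domain, and integrate the density \<open>sqrt (det g)\<close> over each piece in
  coordinates.  By the change of variables formula the result does not depend on the cutting.
\<close>

definition chart_partition ::
  "'a::{t2_space, second_countable_topology} set \<Rightarrow> ('a, 'm::finite) coord_chart set \<Rightarrow>
   nat \<times> (nat \<Rightarrow> ('a, 'm) coord_chart) \<times> (nat \<Rightarrow> 'a set) \<Rightarrow> bool" where
  "chart_partition M A = (\<lambda>(k, C, D).
     (\<forall>i<k. C i \<in> A \<and> D i \<in> sets (restrict_space borel M) \<and>
        (\<exists>K. compact K \<and> D i \<subseteq> K \<and> K \<subseteq> chart_dom (C i))) \<and>
     disjoint_family_on D {..<k} \<and> (\<Union>i<k. D i) = M)"

definition riemannian_measure ::
  "'a::{t2_space, second_countable_topology} set \<Rightarrow> ('a, 'm::finite) coord_chart set \<Rightarrow>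
   (('a, 'm) coord_chart \<Rightarrow> 'a \<Rightarrow> real ^ 'm ^ 'm) \<Rightarrow> 'a measure" where
  "riemannian_measure M A G =
     (let (k, C, D) = SOME P. chart_partition M A P in
      measure_of M (sets (restrict_space borel M))
        (\<lambda>S. \<Sum>i<k. \<integral>\<^sup>+ y \<in> chart_map (C i) ` (S \<inter> D i).
               ennreal (sqrt (det (G (C i) (chart_inv (C i) y)))) \<partial>lborel))"


section \<open>Maps into a submanifold and the alpha-energy\<close>

definition smooth_from ::
  "('a, 'm::finite) coord_chart set \<Rightarrow> ('a \<Rightarrow> 'b::real_normed_vector) \<Rightarrow> bool" where
  "smooth_from A F \<longleftrightarrow> (\<forall>c\<in>A. smooth_on (chart_map c ` chart_dom c) (F \<circ> chart_inv c))"

text \<open>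
  Smoothness into the embedded submanifold \<open>N\<close> is smoothness into the ambient space.
\<close>

definition smooth_map_into ::
  "'a set \<Rightarrow> ('a, 'm::finite) coord_chart set \<Rightarrow> 'e::euclidean_space set \<Rightarrow> ('a \<Rightarrow> 'e) \<Rightarrow> bool" where
  "smooth_map_into M A N \<psi> \<longleftrightarrow> smooth_from A \<psi> \<and> (\<forall>x\<in>M. \<psi> x \<in> N)"

text \<open>
  The squared Hilbert-Schmidt norm of the differential, computed in a chart around \<open>x\<close> with a frame
  \<open>e\<close> that is orthonormal for the metric \<open>G c x\<close>; it depends neither on the chart nor on the frame.
\<close>

definition hs_norm_sq ::
  "('a, 'm::finite) coord_chart set \<Rightarrow> (('a, 'm) coord_chart \<Rightarrow> 'a \<Rightarrow> real ^ 'm ^ 'm) \<Rightarrow>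
   ('a \<Rightarrow> 'e::euclidean_space) \<Rightarrow> 'a \<Rightarrow> real" where
  "hs_norm_sq A G \<psi> x =
     (let c = (SOME c. c \<in> A \<and> x \<in> chart_dom c);
          e = (SOME e :: 'm \<Rightarrow> real ^ 'm. \<forall>i j. e i \<bullet> (G c x *v e j) = (if i = j then 1 else 0))
      in \<Sum>i\<in>UNIV. (norm (frechet_derivative (\<psi> \<circ> chart_inv c) (at (chart_map c x)) (e i)))\<^sup>2)"

definition alpha_energy ::
  "real \<Rightarrow> 'a::{t2_space, second_countable_topology} set \<Rightarrow> ('a, 'm::finite) coord_chart set \<Rightarrow>
   (('a, 'm) coord_chart \<Rightarrow> 'a \<Rightarrow> real ^ 'm ^ 'm) \<Rightarrow> ('a \<Rightarrow> 'e::euclidean_space) \<Rightarrow> real" where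
  "alpha_energy \<alpha> M A G \<psi> = (\<integral>x. (1 + hs_norm_sq A G \<psi> x) powr \<alpha> \<partial>riemannian_measure M A G)"

text \<open>Smooth variations of \<open>\<psi>\<close> through maps into \<open>N\<close>, with parameters near \<open>0\<close> in \<open>'p\<close>.\<close>

definition smooth_variation ::
  "'a set \<Rightarrow> ('a, 'm::finite) coord_chart set \<Rightarrow> 'e::euclidean_space set \<Rightarrow> ('a \<Rightarrow> 'e) \<Rightarrow>
   ('p::euclidean_space \<Rightarrow> 'a \<Rightarrow> 'e) \<Rightarrow> bool" where
  "smooth_variation M A N \<psi> \<Psi> \<longleftrightarrow>
     (\<exists>\<epsilon>>0.
        (\<forall>c\<in>A. smooth_on (ball 0 \<epsilon> \<times> chart_map c ` chart_dom c) (\<lambda>(p, y). \<Psi> p (chart_inv c y))) \<and>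
        (\<forall>p\<in>ball 0 \<epsilon>. \<forall>x\<in>M. \<Psi> p x \<in> N)) \<and>
     (\<forall>x\<in>M. \<Psi> 0 x = \<psi> x)"

definition alpha_harmonic ::
  "real \<Rightarrow> 'a::{t2_space, second_countable_topology} set \<Rightarrow> ('a, 'm::finite) coord_chart set \<Rightarrow>
   (('a, 'm) coord_chart \<Rightarrow> 'a \<Rightarrow> real ^ 'm ^ 'm) \<Rightarrow> 'e::euclidean_space set \<Rightarrow> ('a \<Rightarrow> 'e) \<Rightarrow> bool" where
  "alpha_harmonic \<alpha> M A G N \<psi> \<longleftrightarrow>
     smooth_map_into M A N \<psi> \<and>
     (\<forall>\<Psi> :: real \<Rightarrow> 'a \<Rightarrow> 'e. smooth_variation M A N \<psi> \<Psi> \<longrightarrow>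
        ((\<lambda>t. alpha_energy \<alpha> M A G (\<Psi> t)) has_real_derivative 0) (at 0))"

definition field_along ::
  "'a set \<Rightarrow> ('a, 'm::finite) coord_chart set \<Rightarrow> 'e::euclidean_space set \<Rightarrow> ('a \<Rightarrow> 'e) \<Rightarrow>
   ('a \<Rightarrow> 'e) \<Rightarrow> bool" where
  "field_along M A N \<psi> \<omega> \<longleftrightarrow> smooth_from A \<omega> \<and> (\<forall>x\<in>M. \<omega> x \<in> tangent_space N (\<psi> x))"

text \<open>Used for alpha-harmonic \<open>\<psi>\<close> only, where the value is independent of the chosen variation.\<close>

definition index_form ::
  "real \<Rightarrow> 'a::{t2_space, second_countable_topology} set \<Rightarrow> ('a, 'm::finite) coord_chart set \<Rightarrow>
   (('a, 'm) coord_chart \<Rightarrow> 'a \<Rightarrow> real ^ 'm ^ 'm) \<Rightarrow> 'e::euclidean_space set \<Rightarrow> ('a \<Rightarrow> 'e) \<Rightarrow>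
   ('a \<Rightarrow> 'e) \<Rightarrow> ('a \<Rightarrow> 'e) \<Rightarrow> real" where
  "index_form \<alpha> M A G N \<psi> \<upsilon> \<omega> =
     (let \<Psi> = (SOME \<Psi> :: real \<times> real \<Rightarrow> 'a \<Rightarrow> 'e. smooth_variation M A N \<psi> \<Psi> \<and>
                 (\<forall>x\<in>M. ((\<lambda>t. \<Psi> (t, 0) x) has_vector_derivative \<upsilon> x) (at 0) \<and>
                        ((\<lambda>s. \<Psi> (0, s) x) has_vector_derivative \<omega> x) (at 0)))
      in deriv (\<lambda>t. deriv (\<lambda>s. alpha_energy \<alpha> M A G (\<Psi> (t, s))) 0) 0)"

definition alpha_stable ::
  "real \<Rightarrow> 'a::{t2_space, second_countable_topology} set \<Rightarrow> ('a, 'm::finite) coord_chart set \<Rightarrow>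
   (('a, 'm) coord_chart \<Rightarrow> 'a \<Rightarrow> real ^ 'm ^ 'm) \<Rightarrow> 'e::euclidean_space set \<Rightarrow> ('a \<Rightarrow> 'e) \<Rightarrow> bool" where
  "alpha_stable \<alpha> M A G N \<psi> \<longleftrightarrow>
     (\<forall>\<omega>. field_along M A N \<psi> \<omega> \<longrightarrow> index_form \<alpha> M A G N \<psi> \<omega> \<omega> \<ge> 0)"

abbreviation alpha_unstable ::
  "real \<Rightarrow> 'a::{t2_space, second_countable_topology} set \<Rightarrow> ('a, 'm::finite) coord_chart set \<Rightarrow>
   (('a, 'm) coord_chart \<Rightarrow> 'a \<Rightarrow> real ^ 'm ^ 'm) \<Rightarrow> 'e::euclidean_space set \<Rightarrow> ('a \<Rightarrow> 'e) \<Rightarrow> bool" where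
  "alpha_unstable \<alpha> M A G N \<psi> \<equiv> \<not> alpha_stable \<alpha> M A G N \<psi>"

end

theory Submission
  imports Defs
begin

text \<open>
  Write \<open>P(y)\<close> for the orthogonal projection onto the tangent space of \<open>N\<close> at \<open>y\<close>.  For a fixed vector
  \<open>a\<close> of the ambient space, \<open>\<omega>\<^sub>a = P(\<psi>) a\<close> is a field along \<open>\<psi>\<close>, and the sum of the second variations
  of the energy in the directions \<open>\<omega>\<^sub>a\<close>, with \<open>a\<close> running through an orthonormal basis of the ambient space,
  turns out to be negative.

  The second fundamental form is the derivative of the projection: \<open>B(u,v) = dP(u)v\<close> for tangent \<open>u, v\<close>.
  The mixed second derivative \<open>\<eta>\<close> of any variation with velocities \<open>\<omega>, \<omega>\<close> has normal part \<open>B(\<omega>,\<omega>)\<close>;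
  its tangential part contributes nothing to the second variation because \<open>\<psi>\<close> is critical.  With
  \<open>u\<^sub>i\<close> the images of an orthonormal frame under \<open>d\<psi>\<close> and \<open>H\<close> the trace of \<open>B\<close>, summation over \<open>a\<close> gives
  the integrand
  \<open>4\<alpha>(\<alpha>-1)(1+|d\<psi>|\<^sup>2)\<^sup>\<alpha>\<^sup>-\<^sup>2 |\<Sum>B(u\<^sub>i,u\<^sub>i)|\<^sup>2 + 2\<alpha>(1+|d\<psi>|\<^sup>2)\<^sup>\<alpha>\<^sup>-\<^sup>1 \<Sum>(2\<theta>(u\<^sub>i) - \<langle>B(u\<^sub>i,u\<^sub>i), H\<rangle>)\<close>.
  By the Gauss equation \<open>\<langle>B(u,u), H\<rangle> = Ric(u,u) + \<theta>(u)\<close>, and \<open>|\<Sum>B(u\<^sub>i,u\<^sub>i)|\<^sup>2 \<le> f |d\<psi>|\<^sup>4\<close>, so the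
  curvature condition makes the integrand negative wherever \<open>d\<psi> \<noteq> 0\<close>.

  Everything is pointwise in the domain: the measure enters only through finiteness, positivity on
  open sets and differentiation under the integral sign, and criticality is used in its weak form.
\<close>

section \<open>Smooth maps between Euclidean spaces\<close>

text \<open>The fields that are tested are projections of constant ambient vectors, as in the
  averaging method of Lawson and Simons: they are explicit, their derivatives are
  \<open>dP(u)a\<close>, and the trace over \<open>a\<close> is extrinsic. Intrinsic curvature
  enters only at the end, through the Gauss equation. Differentiating maps as maps into the
  Euclidean space avoids connections on pull-back bundles, and the weak form of criticality avoids
  integration by parts.

  The obstacle is that \<open>index_form\<close>, \<open>hs_norm_sq\<close>,
  \<open>riemannian_measure\<close>, \<open>ricci\<close> and \<open>levi_civita\<close> all rest on
  arbitrary choices. Much of the work shows that the chosen objects exist and have the required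
  properties whatever the choice. In particular, a variation with prescribed velocity must be
  constructed although \<open>N\<close> need not be closed and the retractions onto it are only
  local; compactness of \<open>M\<close> reduces this to patching finitely many of them.\<close>

lemma Ck_on_subset: "Ck_on k f S \<Longrightarrow> T \<subseteq> S \<Longrightarrow> Ck_on k f T"
  by (induction k arbitrary: f) (auto intro: continuous_on_subset)

text \<open>\<open>Ck_on\<close> refers to derivatives at points of the full space, so values on
  \<open>S\<close> determine them only because \<open>S\<close> is open. The same reason puts
  openness into most rules of this calculus.\<close>

lemma Ck_on_cong:
  assumes "open S" "\<And>x. x \<in> S \<Longrightarrow> f x = g x" "Ck_on k f S"
  shows "Ck_on k g S"
  using assms(2,3)
proof (induction k arbitrary: f g)
  case 0
  then show ?case using continuous_on_cong[of S S f g] by simp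
next
  case (Suc k)
  have D: "g differentiable (at x) \<and> frechet_derivative f (at x) = frechet_derivative g (at x)"
    if "x \<in> S" for x
  proof
    have fx: "f differentiable (at x)" using Suc.prems(2) that by simp
    show "frechet_derivative f (at x) = frechet_derivative g (at x)"
      using frechet_derivative_transform_within_open[OF fx assms(1) that] Suc.prems(1) by auto
    obtain f' where "(f has_derivative f') (at x)" using fx unfolding differentiable_def by blast
    from has_derivative_transform_within_open[OF this assms(1) that]
    show "g differentiable (at x)" using Suc.prems(1) unfolding differentiable_def by blast
  qed
  have "Ck_on k (\<lambda>x. frechet_derivative g (at x) v) S" for v
    by (rule Suc.IH[of "\<lambda>x. frechet_derivative f (at x) v"]) (use Suc.prems(2) D in simp_all)
  then show ?case using D by simp
qed

lemma Ck_on_SucD: "Ck_on (Suc k) f S \<Longrightarrow> Ck_on k f S"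
proof (induction k arbitrary: f)
  case 0
  then show ?case
    by (auto simp: continuous_on_eq_continuous_within intro!: differentiable_imp_continuous_within
        intro: differentiable_at_withinI)
next
  case (Suc k)
  then show ?case by (metis Ck_on.simps(2))
qed

text \<open>Continuity and differentiability are local, so smoothness can be checked piece by piece.
  This is what allows a variation to be glued from two formulas on overlapping open sets.\<close>

lemma Ck_on_locally:
  assumes "\<And>x. x \<in> S \<Longrightarrow> \<exists>T. open T \<and> x \<in> T \<and> Ck_on k f T"
  shows "Ck_on k f S"
  using assms
proof (induction k arbitrary: f)
  case 0
  show ?case unfolding Ck_on.simps continuous_on_eq_continuous_within
  proof
    fix x assume "x \<in> S"
    then obtain T where "open T" "x \<in> T" "continuous_on T f" using 0 by auto
    then have "isCont f x" by (simp add: continuous_on_eq_continuous_at)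
    then show "continuous (at x within S) f" by (rule continuous_at_imp_continuous_at_within)
  qed
next
  case (Suc k)
  have "Ck_on k (\<lambda>x. frechet_derivative f (at x) v) S" for v
    using Suc.prems by (intro Suc.IH) (metis Ck_on.simps(2))
  then show ?case using Suc.prems by (metis Ck_on.simps(2))
qed

lemma Ck_on_const: "Ck_on k (\<lambda>x. c) S"
  by (induction k arbitrary: c) auto

lemma Ck_on_bounded_linear: "bounded_linear f \<Longrightarrow> Ck_on k f S"
proof (cases k)
  case (Suc k')
  assume f: "bounded_linear f"
  have "frechet_derivative f (at x) = f" for x
    using frechet_derivative_at[OF bounded_linear_imp_has_derivative[OF f]] by simp
  then show ?thesis using Suc f by (simp add: Ck_on_const bounded_linear_imp_differentiable)
qed (simp add: linear_continuous_on)

lemma Ck_on_add: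
  assumes "open S" "Ck_on k f S" "Ck_on k g S"
  shows "Ck_on k (\<lambda>x. f x + g x) S"
  using assms(2,3)
proof (induction k arbitrary: f g)
  case (Suc k)
  have "Ck_on k (\<lambda>x. frechet_derivative (\<lambda>x. f x + g x) (at x) v) S" for v
  proof (rule Ck_on_cong[OF assms(1)])
    show "Ck_on k (\<lambda>x. frechet_derivative f (at x) v + frechet_derivative g (at x) v) S"
      using Suc by auto
    fix x assume "x \<in> S"
    then have "f differentiable (at x)" "g differentiable (at x)" using Suc.prems by auto
    then have "((\<lambda>x. f x + g x) has_derivative
        (\<lambda>v. frechet_derivative f (at x) v + frechet_derivative g (at x) v)) (at x)"
      by (intro has_derivative_add) (auto simp: frechet_derivative_works[symmetric])
    from frechet_derivative_at[OF this]
    show "frechet_derivative f (at x) v + frechet_derivative g (at x) v =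
        frechet_derivative (\<lambda>x. f x + g x) (at x) v" by metis
  qed
  then show ?case using Suc.prems by (auto intro: differentiable_add)
qed (auto intro: continuous_on_add)

lemma Ck_on_sum:
  assumes "open S" "\<And>i. i \<in> I \<Longrightarrow> Ck_on k (f i) S"
  shows "Ck_on k (\<lambda>x. \<Sum>i\<in>I. f i x) S"
proof (cases "finite I")
  case True
  then show ?thesis using assms(2)
    by (induction I rule: finite_induct) (auto intro!: Ck_on_add assms(1) simp: Ck_on_const)
qed (simp add: Ck_on_const)

text \<open>One Leibniz rule covers scalar multiples, products and inner products. Both terms of the
  derivative are again \<open>B\<close> applied to a function and a derivative, so the induction
  closes once the undifferentiated factor is demoted from order \<open>Suc k\<close> to
  \<open>k\<close>.\<close>

lemma Ck_on_bilinear: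
  assumes B: "bounded_bilinear B" and "open S" "Ck_on k f S" "Ck_on k g S"
  shows "Ck_on k (\<lambda>x. B (f x) (g x)) S"
  using assms(3,4)
proof (induction k arbitrary: f g)
  case 0
  then show ?case using bounded_bilinear.continuous_on[OF B] by auto
next
  case (Suc k)
  have D: "((\<lambda>x. B (f x) (g x)) has_derivative
        (\<lambda>v. B (f x) (frechet_derivative g (at x) v) + B (frechet_derivative f (at x) v) (g x))) (at x)"
    if "x \<in> S" for x
    using Suc.prems that
    by (intro bounded_bilinear.FDERIV[OF B]) (auto simp: frechet_derivative_works[symmetric])
  have "Ck_on k (\<lambda>x. frechet_derivative (\<lambda>x. B (f x) (g x)) (at x) v) S" for v
  proof (rule Ck_on_cong[OF assms(2)])
    have "Ck_on k (\<lambda>x. B (f x) (frechet_derivative g (at x) v)) S"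
      by (rule Suc.IH) (use Suc.prems Ck_on_SucD[OF Suc.prems(1)] in auto)
    moreover have "Ck_on k (\<lambda>x. B (frechet_derivative f (at x) v) (g x)) S"
      by (rule Suc.IH) (use Suc.prems Ck_on_SucD[OF Suc.prems(2)] in auto)
    ultimately show "Ck_on k (\<lambda>x. B (f x) (frechet_derivative g (at x) v) +
        B (frechet_derivative f (at x) v) (g x)) S"
      by (rule Ck_on_add[OF assms(2)])
    fix x assume "x \<in> S"
    from frechet_derivative_at[OF D[OF this]]
    show "B (f x) (frechet_derivative g (at x) v) + B (frechet_derivative f (at x) v) (g x) =
        frechet_derivative (\<lambda>x. B (f x) (g x)) (at x) v" by metis
  qed
  then show ?case using D by (auto simp: differentiable_def)
qed

lemma linear_eq_sum_Basis:
  fixes f :: "'a::euclidean_space \<Rightarrow> 'b::real_vector"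
  assumes "linear f"
  shows "f v = (\<Sum>b\<in>Basis. (v \<bullet> b) *\<^sub>R f b)"
proof -
  have "f v = f (\<Sum>b\<in>Basis. (v \<bullet> b) *\<^sub>R b)" by (simp add: euclidean_representation)
  also have "\<dots> = (\<Sum>b\<in>Basis. (v \<bullet> b) *\<^sub>R f b)"
    using assms by (simp add: linear_sum linear_scale)
  finally show ?thesis .
qed

text \<open>The chain rule evaluates the derivative of \<open>f\<close> in a direction that moves
  with \<open>x\<close>, while \<open>Ck_on\<close> controls fixed directions only. Expanding the
  direction in the basis of the middle space repairs this, which is why that space is
  Euclidean.\<close>

lemma Ck_on_compose:
  fixes g :: "'a::real_normed_vector \<Rightarrow> 'b::euclidean_space" and f :: "'b \<Rightarrow> 'c::real_normed_vector"
  assumes "open S" "Ck_on k g S" "Ck_on k f T" "g ` S \<subseteq> T"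
  shows "Ck_on k (\<lambda>x. f (g x)) S"
  using assms(2,3)
proof (induction k arbitrary: f)
  case 0
  then show ?case using assms(4) by (auto intro: continuous_on_compose2)
next
  case (Suc k)
  have D: "((\<lambda>x. f (g x)) has_derivative
        (\<lambda>v. frechet_derivative f (at (g x)) (frechet_derivative g (at x) v))) (at x)"
    if "x \<in> S" for x
    using Suc.prems assms(4) that diff_chain_at[of g "frechet_derivative g (at x)" x f]
    by (auto simp: frechet_derivative_works[symmetric] o_def)
  have "Ck_on k (\<lambda>x. frechet_derivative (\<lambda>x. f (g x)) (at x) v) S" for v
  proof (rule Ck_on_cong[OF assms(1)])
    show "Ck_on k (\<lambda>x. \<Sum>b\<in>Basis. (frechet_derivative g (at x) v \<bullet> b) *\<^sub>R
        frechet_derivative f (at (g x)) b) S"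
      using Suc.prems Suc.prems[THEN Ck_on_SucD]
      by (intro Ck_on_sum assms(1) Ck_on_bilinear[OF bounded_bilinear_scaleR] Suc.IH
          Ck_on_bilinear[OF bounded_bilinear_inner] Ck_on_const) auto
    fix x assume x: "x \<in> S"
    then have "f differentiable (at (g x))" using Suc.prems assms(4) by auto
    from linear_eq_sum_Basis[OF linear_frechet_derivative[OF this]] frechet_derivative_at[OF D[OF x]]
    show "(\<Sum>b\<in>Basis. (frechet_derivative g (at x) v \<bullet> b) *\<^sub>R frechet_derivative f (at (g x)) b) =
        frechet_derivative (\<lambda>x. f (g x)) (at x) v" by metis
  qed
  then show ?case using D by (auto simp: differentiable_def)
qed

lemma Ck_on_inverse:
  fixes g :: "'a::real_normed_vector \<Rightarrow> real"
  assumes "open S" "Ck_on k g S" "\<And>x. x \<in> S \<Longrightarrow> g x \<noteq> 0"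
  shows "Ck_on k (\<lambda>x. inverse (g x)) S"
  using assms(2)
proof (induction k)
  case 0
  then show ?case using assms(3) by (auto intro: continuous_on_inverse)
next
  case (Suc k)
  have D: "((\<lambda>x. inverse (g x)) has_derivative
        (\<lambda>v. - (inverse (g x) * frechet_derivative g (at x) v * inverse (g x)))) (at x)"
    if "x \<in> S" for x
    using Suc.prems assms(3) that
    by (intro Deriv.has_derivative_inverse) (auto simp: frechet_derivative_works[symmetric])
  have "Ck_on k (\<lambda>x. frechet_derivative (\<lambda>x. inverse (g x)) (at x) v) S" for v
  proof (rule Ck_on_cong[OF assms(1)])
    show "Ck_on k (\<lambda>x. (inverse (g x) * frechet_derivative g (at x) v) * (inverse (g x) * (-1))) S"
      using Suc.prems Suc.IH[OF Ck_on_SucD[OF Suc.prems]]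
      by (intro Ck_on_bilinear[OF bounded_bilinear_mult] assms(1) Ck_on_const) auto
    fix x assume x: "x \<in> S"
    from fun_cong[OF frechet_derivative_at[OF D[OF x]], of v]
    show "(inverse (g x) * frechet_derivative g (at x) v) * (inverse (g x) * (-1)) =
        frechet_derivative (\<lambda>x. inverse (g x)) (at x) v" by simp
  qed
  then show ?case using D by (auto simp: differentiable_def)
qed

lemma smooth_on_differentiable: "smooth_on S f \<Longrightarrow> x \<in> S \<Longrightarrow> f differentiable (at x)"
  unfolding smooth_on_def using Ck_on.simps(2) by blast

lemma smooth_on_has_derivative:
  "smooth_on S f \<Longrightarrow> x \<in> S \<Longrightarrow> (f has_derivative frechet_derivative f (at x)) (at x)"
  using smooth_on_differentiable frechet_derivative_works by blast

lemma smooth_on_continuous_on: "smooth_on S f \<Longrightarrow> continuous_on S f"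
  unfolding smooth_on_def using Ck_on.simps(1) by blast

lemma smooth_on_subset: "smooth_on S f \<Longrightarrow> T \<subseteq> S \<Longrightarrow> smooth_on T f"
  unfolding smooth_on_def using Ck_on_subset by blast

lemma smooth_on_cong: "open S \<Longrightarrow> smooth_on S f \<Longrightarrow> (\<And>x. x \<in> S \<Longrightarrow> f x = g x) \<Longrightarrow> smooth_on S g"
  unfolding smooth_on_def using Ck_on_cong by blast

lemma smooth_on_locally:
  "(\<And>x. x \<in> S \<Longrightarrow> \<exists>T. open T \<and> x \<in> T \<and> smooth_on T f) \<Longrightarrow> smooth_on S f"
  unfolding smooth_on_def using Ck_on_locally by metis

lemma smooth_on_frechet_derivative_const:
  "smooth_on S f \<Longrightarrow> smooth_on S (\<lambda>x. frechet_derivative f (at x) v)"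
  unfolding smooth_on_def using Ck_on.simps(2) by blast

named_theorems smooth_intros

lemma smooth_on_const [smooth_intros]: "smooth_on S (\<lambda>x. c)"
  unfolding smooth_on_def using Ck_on_const by blast

lemma smooth_on_bounded_linear: "bounded_linear f \<Longrightarrow> smooth_on S f"
  unfolding smooth_on_def using Ck_on_bounded_linear by blast

lemma smooth_on_id [smooth_intros]: "smooth_on S (\<lambda>x. x)"
  by (rule smooth_on_bounded_linear) (rule bounded_linear_ident)

lemma smooth_on_bilinear:
  "bounded_bilinear B \<Longrightarrow> smooth_on S f \<Longrightarrow> smooth_on S g \<Longrightarrow> open S \<Longrightarrow>
    smooth_on S (\<lambda>x. B (f x) (g x))"
  unfolding smooth_on_def using Ck_on_bilinear by blast

lemmas smooth_on_scaleR [smooth_intros] = smooth_on_bilinear[OF bounded_bilinear_scaleR]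
lemmas smooth_on_mult [smooth_intros] =
  smooth_on_bilinear[OF bounded_bilinear_mult[where 'a = "'r::real_normed_algebra"]]
lemmas smooth_on_inner [smooth_intros] = smooth_on_bilinear[OF bounded_bilinear_inner]

lemma smooth_on_add [smooth_intros]:
  "smooth_on S f \<Longrightarrow> smooth_on S g \<Longrightarrow> open S \<Longrightarrow> smooth_on S (\<lambda>x. f x + g x)"
  unfolding smooth_on_def using Ck_on_add by blast

lemma smooth_on_sum [smooth_intros]:
  "(\<And>i. i \<in> I \<Longrightarrow> smooth_on S (f i)) \<Longrightarrow> open S \<Longrightarrow> smooth_on S (\<lambda>x. \<Sum>i\<in>I. f i x)"
  unfolding smooth_on_def by (auto intro: Ck_on_sum)

lemma smooth_on_inverse [smooth_intros]:
  fixes g :: "'a::real_normed_vector \<Rightarrow> real"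
  shows "smooth_on S g \<Longrightarrow> (\<And>x. x \<in> S \<Longrightarrow> g x \<noteq> 0) \<Longrightarrow> open S \<Longrightarrow> smooth_on S (\<lambda>x. inverse (g x))"
  unfolding smooth_on_def by (auto intro: Ck_on_inverse)

lemma smooth_on_compose:
  fixes g :: "'a::real_normed_vector \<Rightarrow> 'b::euclidean_space" and f :: "'b \<Rightarrow> 'c::real_normed_vector"
  shows "smooth_on T f \<Longrightarrow> smooth_on S g \<Longrightarrow> g ` S \<subseteq> T \<Longrightarrow> open S \<Longrightarrow> smooth_on S (\<lambda>x. f (g x))"
  unfolding smooth_on_def using Ck_on_compose by blast

lemma smooth_on_linear_compose:
  fixes g :: "'a::real_normed_vector \<Rightarrow> 'b::euclidean_space" and f :: "'b \<Rightarrow> 'c::real_normed_vector"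
  assumes "bounded_linear f" "smooth_on S g" "open S"
  shows "smooth_on S (\<lambda>x. f (g x))"
  by (rule smooth_on_compose[OF smooth_on_bounded_linear[OF assms(1), of UNIV] assms(2) _ assms(3)]) simp

lemma smooth_on_uminus [smooth_intros]:
  fixes f :: "'a::real_normed_vector \<Rightarrow> 'b::real_normed_vector"
  assumes "smooth_on S f" "open S"
  shows "smooth_on S (\<lambda>x. - f x)"
  using smooth_on_scaleR[OF smooth_on_const[of S "-1"] assms] by simp

lemma smooth_on_diff [smooth_intros]:
  "smooth_on S f \<Longrightarrow> smooth_on S g \<Longrightarrow> open S \<Longrightarrow> smooth_on S (\<lambda>x. f x - g x)"
  using smooth_on_add[of S f "\<lambda>x. - g x"] smooth_on_uminus[of S g] by simp

lemma smooth_on_Pair [smooth_intros]: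
  fixes f :: "'a::real_normed_vector \<Rightarrow> 'b::euclidean_space" and g :: "'a \<Rightarrow> 'c::euclidean_space"
  assumes "smooth_on S f" "smooth_on S g" "open S"
  shows "smooth_on S (\<lambda>x. (f x, g x))"
proof -
  have 1: "bounded_linear (\<lambda>y. (y, 0) :: 'b \<times> 'c)" "bounded_linear (\<lambda>y. (0, y) :: 'b \<times> 'c)"
    by (auto intro!: bounded_linear_Pair bounded_linear_ident bounded_linear_zero)
  show ?thesis
    using smooth_on_add[OF smooth_on_linear_compose[OF 1(1) assms(1,3)]
        smooth_on_linear_compose[OF 1(2) assms(2,3)] assms(3)] by simp
qed

lemma smooth_on_frechet_derivative [smooth_intros]:
  fixes f :: "'a::euclidean_space \<Rightarrow> 'b::real_normed_vector"
  assumes "smooth_on S f" "smooth_on S w" "open S"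
  shows "smooth_on S (\<lambda>x. frechet_derivative f (at x) (w x))"
proof (rule smooth_on_cong[OF assms(3)])
  show "smooth_on S (\<lambda>x. \<Sum>b\<in>Basis. (w x \<bullet> b) *\<^sub>R frechet_derivative f (at x) b)"
    by (intro smooth_intros assms smooth_on_frechet_derivative_const)
  fix x assume "x \<in> S"
  from linear_eq_sum_Basis[OF linear_frechet_derivative[OF smooth_on_differentiable[OF assms(1) this]]]
  show "(\<Sum>b\<in>Basis. (w x \<bullet> b) *\<^sub>R frechet_derivative f (at x) b) = frechet_derivative f (at x) (w x)"
    by metis
qed

lemma smooth_on_fst [smooth_intros]:
  fixes f :: "'a::real_normed_vector \<Rightarrow> 'b::euclidean_space \<times> 'c::euclidean_space"
  shows "smooth_on S f \<Longrightarrow> open S \<Longrightarrow> smooth_on S (\<lambda>x. fst (f x))"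
  by (rule smooth_on_linear_compose[OF bounded_linear_fst])

lemma smooth_on_snd [smooth_intros]:
  fixes f :: "'a::real_normed_vector \<Rightarrow> 'b::euclidean_space \<times> 'c::euclidean_space"
  shows "smooth_on S f \<Longrightarrow> open S \<Longrightarrow> smooth_on S (\<lambda>x. snd (f x))"
  by (rule smooth_on_linear_compose[OF bounded_linear_snd])

lemma frechet_derivative_chain:
  assumes "f differentiable (at (g x))" "g differentiable (at x)"
  shows "frechet_derivative (\<lambda>x. f (g x)) (at x) v =
    frechet_derivative f (at (g x)) (frechet_derivative g (at x) v)"
  using frechet_derivative_compose[of g x f] assms by (simp add: o_def fun_eq_iff)

text \<open>The derivative of \<open>flat_exp n\<close> is a combination of \<open>flat_exp (n + 1)\<close> and \<open>flat_exp (n + 2)\<close>, whence smoothness.\<close>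

definition flat_exp :: "nat \<Rightarrow> real \<Rightarrow> real" where
  "flat_exp n s = (if s > 0 then inverse s ^ n * exp (- inverse s) else 0)"

text \<open>From the right, substituting \<open>inverse s\<close> for \<open>x\<close> reduces the
  claim to the decay of \<open>x ^ n / exp x\<close> at infinity; from the left the function
  vanishes.\<close>

lemma flat_exp_tendsto: "(flat_exp n \<longlongrightarrow> 0) (at 0)"
proof (rule filterlim_split_at)
  have "((\<lambda>x. x ^ n / exp x) \<longlongrightarrow> (0::real)) at_top" by (rule tendsto_power_div_exp_0)
  then have "((\<lambda>s. inverse s ^ n / exp (inverse s)) \<longlongrightarrow> (0::real)) (at_right 0)"
    by (rule filterlim_compose) (rule filterlim_inverse_at_top_right)
  moreover have "eventually (\<lambda>s. inverse s ^ n / exp (inverse s) = flat_exp n s) (at_right 0)"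
    by (auto simp: eventually_at_filter flat_exp_def exp_minus field_simps)
  ultimately show "(flat_exp n \<longlongrightarrow> 0) (at_right 0)" by (rule Lim_transform_eventually)
  have "eventually (\<lambda>s. 0 = flat_exp n s) (at_left 0)"
    by (auto simp: eventually_at_filter flat_exp_def)
  then show "(flat_exp n \<longlongrightarrow> 0) (at_left 0)" by (rule Lim_transform_eventually[OF tendsto_const])
qed

lemma flat_exp_deriv:
  "(flat_exp n has_real_derivative (flat_exp (n + 2) s - real n * flat_exp (n + 1) s)) (at s)"
proof -
  consider "s > 0" | "s < 0" | "s = 0" by linarith
  then show ?thesis
  proof cases
    case 1
    have "((\<lambda>s. inverse s ^ n * exp (- inverse s)) has_real_derivative
        (flat_exp (n + 2) s - real n * flat_exp (n + 1) s)) (at s)"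
      using 1 by (auto intro!: derivative_eq_intros simp: flat_exp_def algebra_simps power2_eq_square)
        (cases n; simp add: algebra_simps)
    then show ?thesis
      by (rule has_field_derivative_transform_within_open[where S = "{0<..}"]) (use 1 in \<open>auto simp: flat_exp_def\<close>)
  next
    case 2
    have "((\<lambda>s. 0) has_real_derivative (flat_exp (n + 2) s - real n * flat_exp (n + 1) s)) (at s)"
      using 2 by (auto simp: flat_exp_def)
    then show ?thesis
      by (rule has_field_derivative_transform_within_open[where S = "{..<0}"]) (use 2 in \<open>auto simp: flat_exp_def\<close>)
  next
    case 3
    \<comment> \<open>At the origin the difference quotient of \<open>flat_exp n\<close> is exactly
      \<open>flat_exp (n + 1)\<close>, so the derivative there is the limit 0 found before.\<close>
    have eq: "(flat_exp n h - flat_exp n 0) / (h - 0) = flat_exp (n + 1) h" for h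
      by (simp add: flat_exp_def field_simps)
    have "flat_exp (n + 2) 0 - real n * flat_exp (n + 1) 0 = 0" by (simp add: flat_exp_def)
    then show ?thesis using flat_exp_tendsto[of "n + 1"] 3
      unfolding has_field_derivative_iff by (simp only: eq)
  qed
qed

lemma Ck_on_flat_exp: "Ck_on k (flat_exp n) UNIV"
proof (induction k arbitrary: n)
  case 0
  have "isCont (flat_exp n) s" for s using flat_exp_deriv DERIV_isCont by blast
  then show ?case by (simp add: continuous_on_eq_continuous_at)
next
  case (Suc k)
  have D: "(flat_exp n has_derivative (*) (flat_exp (n + 2) s - real n * flat_exp (n + 1) s)) (at s)" for s
    using flat_exp_deriv by (simp add: has_field_derivative_def)
  have "Ck_on k (\<lambda>s. frechet_derivative (flat_exp n) (at s) v) UNIV" for v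
  proof (rule Ck_on_cong)
    show "Ck_on k (\<lambda>s. flat_exp (n + 2) s * v + flat_exp (n + 1) s * (- (real n * v))) UNIV"
      by (intro Ck_on_add Ck_on_bilinear[OF bounded_bilinear_mult] Suc.IH Ck_on_const) auto
    show "flat_exp (n + 2) s * v + flat_exp (n + 1) s * (- (real n * v)) =
        frechet_derivative (flat_exp n) (at s) v" for s
      using fun_cong[OF frechet_derivative_at[OF D[of s]], of v] by (simp add: algebra_simps)
  qed simp
  then show ?case using D by (auto simp: differentiable_def)
qed

text \<open>The squared distance is a polynomial, hence smooth also at the centre \<open>y\<close>,
  where the distance itself is not.\<close>

lemma smooth_bump:
  fixes y :: "'a::euclidean_space"
  assumes "r > 0"
  obtains f :: "'a \<Rightarrow> real" where "smooth_on UNIV f" "\<And>z. f z \<ge> 0" "\<And>z. f z > 0 \<longleftrightarrow> z \<in> ball y r"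
proof
  let ?f = "\<lambda>z. flat_exp 0 (r\<^sup>2 - (z - y) \<bullet> (z - y))"
  have "smooth_on UNIV (flat_exp 0)" unfolding smooth_on_def using Ck_on_flat_exp by blast
  then show "smooth_on UNIV ?f"
    by (rule smooth_on_compose) (auto intro!: smooth_intros)
  show "?f z \<ge> 0" for z by (simp add: flat_exp_def)
  have "(z - y) \<bullet> (z - y) < r\<^sup>2 \<longleftrightarrow> z \<in> ball y r" for z
    using assms by (auto simp: dot_square_norm dist_norm norm_minus_commute abs_square_less_1
        power_strict_mono intro: power_less_imp_less_base[of _ 2])
  then show "?f z > 0 \<longleftrightarrow> z \<in> ball y r" for z by (auto simp: flat_exp_def)
qed

section \<open>Symmetry of second derivatives\<close>

text \<open>The mean value theorem is applied twice: in direction \<open>a\<close> to the increment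
  of \<open>f\<close> by \<open>t *\<^sub>R b\<close>, then in direction \<open>b\<close> to the
  derivative along \<open>a\<close>. The second difference is symmetric in \<open>a\<close> and
  \<open>b\<close>, whereas the derivative it is equated with is not visibly so.\<close>

lemma second_difference_mvt:
  fixes f :: "'a::euclidean_space \<Rightarrow> real"
  assumes W: "open W" "smooth_on W f" "cball z r \<subseteq> W" and t: "t > 0" "t * (norm a + norm b) \<le> r"
  obtains \<xi> where "\<xi> \<in> cball z (t * (norm a + norm b))"
    "f (z + t *\<^sub>R a + t *\<^sub>R b) - f (z + t *\<^sub>R a) - f (z + t *\<^sub>R b) + f z =
       t * t * frechet_derivative (\<lambda>x. frechet_derivative f (at x) a) (at \<xi>) b"
proof -
  have inb: "z + (\<sigma> * t) *\<^sub>R a + (\<tau> * t) *\<^sub>R b \<in> cball z (t * (norm a + norm b))"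
    if "0 \<le> \<sigma>" "\<sigma> \<le> 1" "0 \<le> \<tau>" "\<tau> \<le> 1" for \<sigma> \<tau>
  proof -
    have "norm ((\<sigma> * t) *\<^sub>R a + (\<tau> * t) *\<^sub>R b) \<le> \<sigma> * t * norm a + \<tau> * t * norm b"
      using norm_triangle_ineq[of "(\<sigma> * t) *\<^sub>R a" "(\<tau> * t) *\<^sub>R b"] that t by simp
    also have "\<dots> \<le> 1 * t * norm a + 1 * t * norm b"
      using that t by (intro add_mono mult_right_mono) auto
    finally have "norm ((\<sigma> * t) *\<^sub>R a + (\<tau> * t) *\<^sub>R b) \<le> t * (norm a + norm b)"
      by (simp add: distrib_left)
    moreover have "z - (z + (\<sigma> * t) *\<^sub>R a + (\<tau> * t) *\<^sub>R b) = - ((\<sigma> * t) *\<^sub>R a + (\<tau> * t) *\<^sub>R b)"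
      by simp
    ultimately show ?thesis by (metis dist_norm mem_cball norm_minus_cancel)
  qed
  have inW: "z + (\<sigma> * t) *\<^sub>R a + (\<tau> * t) *\<^sub>R b \<in> W"
    if "0 \<le> \<sigma>" "\<sigma> \<le> 1" "0 \<le> \<tau>" "\<tau> \<le> 1" for \<sigma> \<tau>
    using inb[OF that] W(3) t(2) by fastforce
  have der: "((\<lambda>\<tau>. h (c + (\<tau> * t) *\<^sub>R d)) has_real_derivative (t * frechet_derivative h (at (c + (\<tau> * t) *\<^sub>R d)) d)) (at \<tau>)"
    if "h differentiable (at (c + (\<tau> * t) *\<^sub>R d))" for h :: "'a \<Rightarrow> real" and c d \<tau>
  proof -
    have 1: "(h has_derivative frechet_derivative h (at (c + (\<tau> * t) *\<^sub>R d))) (at (c + (\<tau> * t) *\<^sub>R d))"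
      using that frechet_derivative_works by blast
    have 2: "((\<lambda>\<tau>. c + (\<tau> * t) *\<^sub>R d) has_derivative (\<lambda>s. (s * t) *\<^sub>R d)) (at \<tau>)"
      by (auto intro!: derivative_eq_intros)
    have "((\<lambda>\<tau>. h (c + (\<tau> * t) *\<^sub>R d)) has_derivative
       (\<lambda>s. frechet_derivative h (at (c + (\<tau> * t) *\<^sub>R d)) ((s * t) *\<^sub>R d))) (at \<tau>)"
      using diff_chain_at[OF 2 1] by (simp add: o_def)
    moreover have "frechet_derivative h (at (c + (\<tau> * t) *\<^sub>R d)) ((s * t) *\<^sub>R d) =
       t * frechet_derivative h (at (c + (\<tau> * t) *\<^sub>R d)) d * s" for s
      using linear_scale[OF linear_frechet_derivative[OF that]] by simp
    ultimately show ?thesis by (simp add: has_field_derivative_def)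
  qed
  let ?g = "\<lambda>\<sigma>. f ((z + t *\<^sub>R b) + (\<sigma> * t) *\<^sub>R a) - f (z + (\<sigma> * t) *\<^sub>R a)"
  let ?fa = "\<lambda>x. frechet_derivative f (at x) a"
  have Dg: "(?g has_real_derivative t * ?fa ((z + t *\<^sub>R b) + (\<sigma> * t) *\<^sub>R a) - t * ?fa (z + (\<sigma> * t) *\<^sub>R a)) (at \<sigma>)"
    if "0 \<le> \<sigma>" "\<sigma> \<le> 1" for \<sigma>
    using inW[OF that, of 1] inW[OF that, of 0]
    by (intro DERIV_diff der smooth_on_differentiable[OF W(2)]) (auto simp: algebra_simps)
  obtain \<sigma> where \<sigma>: "0 < \<sigma>" "\<sigma> < 1"
    "?g 1 - ?g 0 = (1 - 0) * (t * ?fa ((z + t *\<^sub>R b) + (\<sigma> * t) *\<^sub>R a) - t * ?fa (z + (\<sigma> * t) *\<^sub>R a))"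
    using MVT2[of 0 1 ?g "\<lambda>\<sigma>. t * ?fa ((z + t *\<^sub>R b) + (\<sigma> * t) *\<^sub>R a) - t * ?fa (z + (\<sigma> * t) *\<^sub>R a)"] Dg
    by auto
  let ?c = "z + (\<sigma> * t) *\<^sub>R a"
  have Dh: "((\<lambda>\<tau>. ?fa (?c + (\<tau> * t) *\<^sub>R b)) has_real_derivative
     t * frechet_derivative ?fa (at (?c + (\<tau> * t) *\<^sub>R b)) b) (at \<tau>)" if "0 \<le> \<tau>" "\<tau> \<le> 1" for \<tau>
    using inW[of \<sigma> \<tau>] that \<sigma>
    by (intro der smooth_on_differentiable[OF smooth_on_frechet_derivative_const[OF W(2)]]) auto
  obtain \<tau> where \<tau>: "0 < \<tau>" "\<tau> < 1"
    "?fa (?c + (1 * t) *\<^sub>R b) - ?fa (?c + (0 * t) *\<^sub>R b) =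
      (1 - 0) * (t * frechet_derivative ?fa (at (?c + (\<tau> * t) *\<^sub>R b)) b)"
    using MVT2[of 0 1 "\<lambda>\<tau>. ?fa (?c + (\<tau> * t) *\<^sub>R b)"
        "\<lambda>\<tau>. t * frechet_derivative ?fa (at (?c + (\<tau> * t) *\<^sub>R b)) b"] Dh by auto
  show thesis
  proof
    show "?c + (\<tau> * t) *\<^sub>R b \<in> cball z (t * (norm a + norm b))" using inb \<sigma> \<tau> by auto
    have "f (z + t *\<^sub>R a + t *\<^sub>R b) - f (z + t *\<^sub>R a) - f (z + t *\<^sub>R b) + f z = ?g 1 - ?g 0"
      by (simp add: algebra_simps)
    also have "\<dots> = t * (?fa (?c + (1 * t) *\<^sub>R b) - ?fa (?c + (0 * t) *\<^sub>R b))"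
      using \<sigma> by (simp add: algebra_simps)
    also have "\<dots> = t * t * frechet_derivative ?fa (at (?c + (\<tau> * t) *\<^sub>R b)) b"
      unfolding \<tau>(3) by simp
    finally show "f (z + t *\<^sub>R a + t *\<^sub>R b) - f (z + t *\<^sub>R a) - f (z + t *\<^sub>R b) + f z =
       t * t * frechet_derivative ?fa (at (?c + (\<tau> * t) *\<^sub>R b)) b" .
  qed
qed

text \<open>Evaluating one second difference in both orders gives equal mixed derivatives at two
  points \<open>\<xi> k\<close> and \<open>\<eta> k\<close> that both tend to \<open>z\<close>;
  continuity of the second derivatives finishes the argument.\<close>

lemma frechet_derivative_symmetric_real:
  fixes f :: "'a::euclidean_space \<Rightarrow> real"
  assumes "open W" "smooth_on W f" "z \<in> W"
  shows "frechet_derivative (\<lambda>x. frechet_derivative f (at x) a) (at z) b =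
    frechet_derivative (\<lambda>x. frechet_derivative f (at x) b) (at z) a"
proof -
  let ?D = "\<lambda>a b x. frechet_derivative (\<lambda>x. frechet_derivative f (at x) a) (at x) b"
  obtain r where r: "r > 0" "cball z r \<subseteq> W" using assms open_contains_cball by blast
  \<comment> \<open>The summand 1 keeps the divisor positive when \<open>a\<close> and
    \<open>b\<close> both vanish; \<open>t k\<close> is then scaled so that the parallelogram stays
    inside the ball of radius \<open>r\<close>.\<close>
  define m where "m = norm a + norm b + 1"
  have m: "m > 0" by (simp add: m_def add_nonneg_pos)
  define t where "t k = r / m / real (Suc k)" for k
  have t: "t k > 0" "t k * (norm a + norm b) \<le> r" for k
  proof -
    show "t k > 0" using r m by (simp add: t_def)
    have "t k * (norm a + norm b) \<le> t k * m" using \<open>t k > 0\<close> by (simp add: m_def)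
    also have "\<dots> = r / real (Suc k)" using m by (simp add: t_def)
    also have "\<dots> \<le> r" using r by (simp add: divide_le_eq_1 field_simps)
    finally show "t k * (norm a + norm b) \<le> r" .
  qed
  have "\<exists>\<xi> \<eta>. \<xi> \<in> cball z (t k * (norm a + norm b)) \<and> \<eta> \<in> cball z (t k * (norm a + norm b)) \<and> ?D a b \<xi> = ?D b a \<eta>" for k
  proof -
    obtain \<xi> where \<xi>: "\<xi> \<in> cball z (t k * (norm a + norm b))"
      "f (z + t k *\<^sub>R a + t k *\<^sub>R b) - f (z + t k *\<^sub>R a) - f (z + t k *\<^sub>R b) + f z = t k * t k * ?D a b \<xi>"
      by (rule second_difference_mvt[OF assms(1,2) r(2) t])
    have t': "t k * (norm b + norm a) \<le> r" using t(2)[of k] by (simp add: add.commute)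
    obtain \<eta> where \<eta>: "\<eta> \<in> cball z (t k * (norm b + norm a))"
      "f (z + t k *\<^sub>R b + t k *\<^sub>R a) - f (z + t k *\<^sub>R b) - f (z + t k *\<^sub>R a) + f z = t k * t k * ?D b a \<eta>"
      by (rule second_difference_mvt[OF assms(1,2) r(2) t(1) t'])
    have "t k * t k * ?D a b \<xi> = t k * t k * ?D b a \<eta>"
      unfolding \<xi>(2)[symmetric] \<eta>(2)[symmetric] by (simp add: algebra_simps)
    then show ?thesis using \<xi> \<eta> t(1)[of k] by (intro exI[of _ \<xi>] exI[of _ \<eta>]) (auto simp: add.commute)
  qed
  then obtain \<xi> \<eta> where *: "\<And>k. \<xi> k \<in> cball z (t k * (norm a + norm b))"
    "\<And>k. \<eta> k \<in> cball z (t k * (norm a + norm b))" "\<And>k. ?D a b (\<xi> k) = ?D b a (\<eta> k)" by metis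
  have t0: "(\<lambda>k. t k * (norm a + norm b)) \<longlonglongrightarrow> 0"
  proof -
    have "(\<lambda>k. (r / m * (norm a + norm b)) * inverse (real (Suc k))) \<longlonglongrightarrow> (r / m * (norm a + norm b)) * 0"
      by (intro tendsto_mult tendsto_const LIMSEQ_inverse_real_of_nat)
    then show ?thesis by (simp add: t_def field_simps)
  qed
  have lim: "\<zeta> \<longlonglongrightarrow> z" if "\<And>k. \<zeta> k \<in> cball z (t k * (norm a + norm b))" for \<zeta>
    by (rule tendsto_dist_iff[THEN iffD2], rule tendsto_sandwich[OF _ _ tendsto_const t0])
      (use that in \<open>auto simp: dist_commute\<close>)
  have cont: "isCont (?D a b) z" for a b
    using smooth_on_continuous_on[OF smooth_on_frechet_derivative_const[OF smooth_on_frechet_derivative_const[OF assms(2)]]]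
      assms(1,3) by (simp add: continuous_on_eq_continuous_at)
  have "(\<lambda>k. ?D a b (\<xi> k)) \<longlonglongrightarrow> ?D a b z" "(\<lambda>k. ?D b a (\<eta> k)) \<longlonglongrightarrow> ?D b a z"
    using isCont_tendsto_compose[OF cont lim] *(1,2) by blast+
  then show ?thesis unfolding *(3) by (rule LIMSEQ_unique)
qed

lemma frechet_derivative_inner_left:
  assumes "f differentiable (at x)"
  shows "frechet_derivative (\<lambda>x. f x \<bullet> c) (at x) v = frechet_derivative f (at x) v \<bullet> c"
  using frechet_derivative_at[OF has_derivative_inner_left[OF assms[unfolded frechet_derivative_works]]]
  by metis

lemma frechet_derivative_symmetric:
  fixes f :: "'a::euclidean_space \<Rightarrow> 'b::euclidean_space"
  assumes W: "open W" "smooth_on W f" "z \<in> W"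
  shows "frechet_derivative (\<lambda>x. frechet_derivative f (at x) a) (at z) b =
    frechet_derivative (\<lambda>x. frechet_derivative f (at x) b) (at z) a"
proof (rule euclidean_eqI)
  fix c :: 'b
  have eq: "frechet_derivative (\<lambda>x. frechet_derivative (\<lambda>x. f x \<bullet> c) (at x) a) (at z) b =
    frechet_derivative (\<lambda>x. frechet_derivative f (at x) a) (at z) b \<bullet> c" for a b
  proof -
    have "frechet_derivative (\<lambda>x. frechet_derivative (\<lambda>x. f x \<bullet> c) (at x) a) (at z) =
       frechet_derivative (\<lambda>x. frechet_derivative f (at x) a \<bullet> c) (at z)"
      by (rule frechet_derivative_transform_within_open[OF _ W(1,3)])
        (auto simp: frechet_derivative_inner_left[OF smooth_on_differentiable[OF W(2)]]
         intro!: smooth_on_differentiable[where S = W] smooth_intros smooth_on_frechet_derivative_const W)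
    then show ?thesis
      using frechet_derivative_inner_left[OF smooth_on_differentiable[OF smooth_on_frechet_derivative_const[OF W(2)] W(3)]]
      by metis
  qed
  have "smooth_on W (\<lambda>x. f x \<bullet> c)" by (intro smooth_intros W)
  from frechet_derivative_symmetric_real[OF W(1) this W(3)]
  show "frechet_derivative (\<lambda>x. frechet_derivative f (at x) a) (at z) b \<bullet> c =
    frechet_derivative (\<lambda>x. frechet_derivative f (at x) b) (at z) a \<bullet> c" by (simp add: eq)
qed

section \<open>Submanifolds of a Euclidean space\<close>

definition oproj :: "'e::euclidean_space set \<Rightarrow> 'e \<Rightarrow> 'e" where
  "oproj T w = (THE z. z \<in> T \<and> (\<forall>t\<in>T. (w - z) \<bullet> t = 0))"

context
  fixes T :: "'e::euclidean_space set"
  assumes T: "subspace T"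
begin

lemma oproj_ex1: "\<exists>!z. z \<in> T \<and> (\<forall>t\<in>T. (w - z) \<bullet> t = 0)"
proof (rule ex_ex1I)
  obtain y z where "y \<in> span T" "\<And>t. t \<in> span T \<Longrightarrow> orthogonal z t" "w = y + z"
    by (rule orthogonal_subspace_decomp_exists[of T w]) blast
  then show "\<exists>z. z \<in> T \<and> (\<forall>t\<in>T. (w - z) \<bullet> t = 0)"
    using T by (intro exI[of _ y]) (auto simp: orthogonal_def span_eq_iff[THEN iffD2])
  fix y z assume y: "y \<in> T \<and> (\<forall>t\<in>T. (w - y) \<bullet> t = 0)" and z: "z \<in> T \<and> (\<forall>t\<in>T. (w - z) \<bullet> t = 0)"
  then have "y - z \<in> T" using T subspace_diff by blast
  then have "(w - z) \<bullet> (y - z) - (w - y) \<bullet> (y - z) = 0" using y z by simp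
  then have "(y - z) \<bullet> (y - z) = 0" by (simp add: inner_diff_left)
  then show "y = z" by simp
qed

lemma oproj_in: "oproj T w \<in> T"
  and oproj_orth: "t \<in> T \<Longrightarrow> (w - oproj T w) \<bullet> t = 0"
  using theI'[OF oproj_ex1[of w]] unfolding oproj_def by blast+

lemma oproj_unique: "z \<in> T \<Longrightarrow> (\<And>t. t \<in> T \<Longrightarrow> (w - z) \<bullet> t = 0) \<Longrightarrow> oproj T w = z"
  using oproj_ex1[of w] oproj_in[of w] oproj_orth[of _ w] by metis

lemma oproj_ident: "w \<in> T \<Longrightarrow> oproj T w = w"
  by (rule oproj_unique) auto

lemma linear_oproj: "linear (oproj T)"
proof (rule linearI)
  show "oproj T (x + y) = oproj T x + oproj T y" for x y
  proof (rule oproj_unique)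
    show "oproj T x + oproj T y \<in> T" by (intro subspace_add T oproj_in)
    fix t assume "t \<in> T"
    then have "(x - oproj T x) \<bullet> t + (y - oproj T y) \<bullet> t = 0" by (simp add: oproj_orth)
    then show "(x + y - (oproj T x + oproj T y)) \<bullet> t = 0" by (simp add: algebra_simps)
  qed
  show "oproj T (c *\<^sub>R x) = c *\<^sub>R oproj T x" for c x
  proof (rule oproj_unique)
    show "c *\<^sub>R oproj T x \<in> T" by (intro subspace_scale T oproj_in)
    fix t assume "t \<in> T"
    then show "(c *\<^sub>R x - c *\<^sub>R oproj T x) \<bullet> t = 0"
      using oproj_orth[of t x] by (simp add: inner_diff_left)
  qed
qed

lemma oproj_inner: "t \<in> T \<Longrightarrow> oproj T w \<bullet> t = w \<bullet> t"
  using oproj_orth[of t w] by (simp add: inner_diff_left)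

lemma oproj_symmetric: "oproj T v \<bullet> w = v \<bullet> oproj T w"
  using oproj_inner[OF oproj_in, of v w] oproj_inner[OF oproj_in, of w v] by (simp add: inner_commute)

end

text \<open>Gram-Schmidt carried out on projections instead of vectors: a new vector adds the
  rank-one projection onto its component \<open>z\<close> orthogonal to the previous span. Only a
  division by \<open>z y \<bullet> z y\<close> occurs, nonzero by independence, so smooth dependence
  on \<open>y\<close> is preserved without taking square roots.\<close>

lemma smooth_gram_schmidt:
  fixes b :: "'i \<Rightarrow> 'a::euclidean_space \<Rightarrow> 'e::euclidean_space"
  assumes "finite I" "open U" "\<And>i. i \<in> I \<Longrightarrow> smooth_on U (b i)"
    and "\<And>y. y \<in> U \<Longrightarrow> inj_on (\<lambda>i. b i y) I" "\<And>y. y \<in> U \<Longrightarrow> independent ((\<lambda>i. b i y) ` I)"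
  shows "\<exists>Q. (\<forall>w. smooth_on U (\<lambda>y. Q y w)) \<and> (\<forall>y\<in>U. linear (Q y) \<and>
    (\<forall>w. Q y w \<in> span ((\<lambda>i. b i y) ` I) \<and> (\<forall>i\<in>I. (w - Q y w) \<bullet> b i y = 0)))"
  using assms(1,3,4,5)
proof (induction I rule: finite_induct)
  case empty
  show ?case by (intro exI[of _ "\<lambda>y w. 0"]) (auto intro: smooth_on_const linear_zero)
next
  case (insert i I)
  have "independent ((\<lambda>i. b i y) ` I)" if "y \<in> U" for y
    using independent_mono[OF insert.prems(3)[OF that]] by auto
  then obtain Q where Q: "\<And>w. smooth_on U (\<lambda>y. Q y w)" "\<And>y. y \<in> U \<Longrightarrow> linear (Q y)"
    "\<And>y w. y \<in> U \<Longrightarrow> Q y w \<in> span ((\<lambda>i. b i y) ` I)"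
    "\<And>y w j. y \<in> U \<Longrightarrow> j \<in> I \<Longrightarrow> (w - Q y w) \<bullet> b j y = 0"
    using insert.IH insert.prems(1,2) by (metis insertCI inj_on_insert)
  define z where "z y = b i y - Q y (b i y)" for y
  have perp: "(w - Q y w) \<bullet> s = 0" if "y \<in> U" "s \<in> span ((\<lambda>i. b i y) ` I)" for y w s
    using that(2)
  proof (induction rule: span_induct_alt)
    case (step c x s)
    then show ?case using Q(4)[OF that(1)] by (auto simp: inner_add_right)
  qed simp
  have zn: "z y \<noteq> 0" if "y \<in> U" for y
  proof
    assume "z y = 0"
    then have "b i y \<in> span ((\<lambda>i. b i y) ` I)" using Q(3)[OF that, of "b i y"] by (simp add: z_def)
    moreover have "b i y \<notin> (\<lambda>i. b i y) ` I" using insert.prems(2)[OF that] insert.hyps by auto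
    ultimately show False using insert.prems(3)[OF that] by (simp add: independent_insert)
  qed
  \<comment> \<open>Smoothness of \<open>Q\<close> in \<open>y\<close> is known for a fixed second
    argument only; the moving argument \<open>b i y\<close> is therefore expanded in the
    basis.\<close>
  have sz: "smooth_on U z"
  proof (rule smooth_on_cong[OF assms(2)])
    show "smooth_on U (\<lambda>y. b i y - (\<Sum>k\<in>Basis. (b i y \<bullet> k) *\<^sub>R Q y k))"
      using insert.prems(1) by (intro smooth_intros assms(2) Q(1)) auto
    show "b i y - (\<Sum>k\<in>Basis. (b i y \<bullet> k) *\<^sub>R Q y k) = z y" if "y \<in> U" for y
      using linear_eq_sum_Basis[OF Q(2)[OF that], of "b i y"] by (simp add: z_def)
  qed
  let ?Q = "\<lambda>y w. Q y w + ((w \<bullet> z y) * inverse (z y \<bullet> z y)) *\<^sub>R z y"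
  show ?case
  proof (intro exI[of _ ?Q] conjI allI ballI)
    show "smooth_on U (\<lambda>y. ?Q y w)" for w
      by (intro smooth_intros assms(2) Q(1) sz) (use zn in auto)
    fix y assume y: "y \<in> U"
    interpret Qy: linear "Q y" by (rule Q(2)[OF y])
    show "linear (?Q y)"
      by (rule linearI) (auto simp: Qy.add Qy.scale algebra_simps)
    fix w
    have sub: "span ((\<lambda>i. b i y) ` I) \<subseteq> span ((\<lambda>i. b i y) ` insert i I)" by (intro span_mono) auto
    have "z y \<in> span ((\<lambda>i. b i y) ` insert i I)"
      unfolding z_def using Q(3)[OF y] sub by (auto intro: span_diff span_base)
    then show "?Q y w \<in> span ((\<lambda>i. b i y) ` insert i I)"
      using Q(3)[OF y, of w] sub by (auto intro: span_add span_scale)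
    fix j assume "j \<in> insert i I"
    have zs: "z y \<bullet> s = 0" if "s \<in> span ((\<lambda>i. b i y) ` I)" for s
      unfolding z_def using perp[OF y that] .
    have *: "(w - ?Q y w) \<bullet> s = 0" if "s \<in> span ((\<lambda>i. b i y) ` I)" for s
      using perp[OF y that, of w] zs[OF that] by (simp add: algebra_simps)
    have "(w - ?Q y w) \<bullet> z y = 0"
      using zs[OF Q(3)[OF y, of w]] zn[OF y] by (simp add: algebra_simps inner_commute)
    then have "(w - ?Q y w) \<bullet> b i y = 0"
      using *[OF Q(3)[OF y, of "b i y"]] by (simp add: z_def algebra_simps)
    then show "(w - ?Q y w) \<bullet> b j y = 0"
      using \<open>j \<in> insert i I\<close> * by (auto intro: span_base)
  qed
qed

section \<open>Differentiation of functions on a submanifold\<close>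

abbreviation tproj :: "'e::euclidean_space set \<Rightarrow> 'e \<Rightarrow> 'e \<Rightarrow> 'e" where
  "tproj N x \<equiv> oproj (tangent_space N x)"

text \<open>For a function on \<open>N\<close> only a derivative within \<open>N\<close> is
  available; since the curve stays in \<open>N\<close> near 0, this suffices for an ordinary chain
  rule at 0.\<close>

lemma has_vector_derivative_compose_within:
  assumes F: "(F has_derivative F') (at (\<gamma> 0) within N)"
    and \<gamma>: "(\<gamma> has_vector_derivative u) (at 0)" "\<epsilon> > 0" "\<And>t. t \<in> {-\<epsilon><..<\<epsilon>} \<Longrightarrow> \<gamma> t \<in> N"
  shows "((\<lambda>t. F (\<gamma> t)) has_vector_derivative F' u) (at (0::real))"
proof -
  let ?I = "{-\<epsilon><..<\<epsilon>}"
  have w: "at 0 within ?I = at (0::real)" using \<gamma>(2) by (intro at_within_open) auto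
  have "(\<gamma> has_derivative (\<lambda>h. h *\<^sub>R u)) (at 0 within ?I)"
    using \<gamma>(1) w unfolding has_vector_derivative_def by simp
  moreover have "(F has_derivative F') (at (\<gamma> 0) within \<gamma> ` ?I)"
    using F by (rule has_derivative_subset) (use \<gamma>(3) in auto)
  ultimately have "((\<lambda>t. F (\<gamma> t)) has_derivative (\<lambda>h. F' (h *\<^sub>R u))) (at 0 within ?I)"
    by (rule has_derivative_in_compose)
  moreover have "F' (h *\<^sub>R u) = h *\<^sub>R F' u" for h
    using has_derivative_linear[OF F] by (rule linear_scale)
  ultimately show ?thesis unfolding has_vector_derivative_def w by simp
qed

lemma tangent_spaceE:
  assumes "u \<in> tangent_space N x"
  obtains \<gamma> \<epsilon> where "\<epsilon> > 0" "smooth_on {-\<epsilon><..<\<epsilon>} \<gamma>" "\<And>t. t \<in> {-\<epsilon><..<\<epsilon>} \<Longrightarrow> \<gamma> t \<in> N" "\<gamma> 0 = x"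
    "(\<gamma> has_vector_derivative u) (at 0)"
  using assms unfolding tangent_space_def by blast

text \<open>The given derivative and the one selected by \<open>frechet_derivative\<close> both
  compute the velocity of \<open>F\<close> along one curve through \<open>x\<close> with velocity
  \<open>u\<close>, and that velocity is unique.\<close>

lemma dir_deriv_eqI:
  assumes F: "(F has_derivative F') (at x within N)" and u: "u \<in> tangent_space N x"
  shows "dir_deriv N F x u = F' u"
proof -
  obtain \<gamma> \<epsilon> where \<gamma>: "\<epsilon> > 0" "smooth_on {-\<epsilon><..<\<epsilon>} \<gamma>" "\<And>t. t \<in> {-\<epsilon><..<\<epsilon>} \<Longrightarrow> \<gamma> t \<in> N" "\<gamma> 0 = x"
    "(\<gamma> has_vector_derivative u) (at 0)" by (rule tangent_spaceE[OF u]) blast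
  have G: "(F has_derivative frechet_derivative F (at x within N)) (at x within N)"
    using F frechet_derivative_works differentiable_def by blast
  note c = has_vector_derivative_compose_within[where \<gamma> = \<gamma>, OF _ \<gamma>(5,1,3)]
  show ?thesis unfolding dir_deriv_def
    by (rule vector_derivative_unique_at[OF c c]) (use F G \<gamma>(4) in auto)
qed

lemma smooth_along_local_extension:
  assumes "smooth_along N F" "x \<in> N"
  obtains U G where "open U" "x \<in> U" "smooth_on U G" "\<And>y. y \<in> U \<Longrightarrow> y \<in> N \<Longrightarrow> G y = F y"
    "\<And>y. y \<in> U \<Longrightarrow> y \<in> N \<Longrightarrow> (F has_derivative frechet_derivative G (at y)) (at y within N)"
proof -
  have "\<exists>U G. open U \<and> x \<in> U \<and> smooth_on U G \<and> (\<forall>y\<in>U \<inter> N. G y = F y)"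
    using assms unfolding smooth_along_def by blast
  then obtain U G where U: "open U" "x \<in> U" "smooth_on U G" "\<And>y. y \<in> U \<Longrightarrow> y \<in> N \<Longrightarrow> G y = F y"
    by (metis IntI)
  have "(F has_derivative frechet_derivative G (at y)) (at y within N)" if y: "y \<in> U" "y \<in> N" for y
  proof -
    obtain d where d: "d > 0" "ball y d \<subseteq> U" using U(1) y(1) open_contains_ball by blast
    have "(G has_derivative frechet_derivative G (at y)) (at y within N)"
      using smooth_on_has_derivative[OF U(3) y(1)] by (rule has_derivative_at_withinI)
    then show ?thesis
      by (rule has_derivative_transform_within[OF _ d(1) y(2)]) (use d U(4) in \<open>auto simp: dist_commute subset_iff\<close>)
  qed
  from that[OF U this] show thesis by blast
qed

lemma smooth_along_has_derivative:
  assumes "smooth_along N F" "x \<in> N"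
  shows "(F has_derivative dir_deriv N F x) (at x within N)"
proof -
  obtain U G where "x \<in> U"
    "\<And>y. y \<in> U \<Longrightarrow> y \<in> N \<Longrightarrow> (F has_derivative frechet_derivative G (at y)) (at y within N)"
    by (rule smooth_along_local_extension[OF assms]) blast
  then have "(F has_derivative frechet_derivative G (at x)) (at x within N)" using assms(2) by blast
  then show ?thesis using frechet_derivative_works unfolding differentiable_def dir_deriv_def by blast
qed

lemma linear_dir_deriv: "smooth_along N F \<Longrightarrow> x \<in> N \<Longrightarrow> linear (dir_deriv N F x)"
  using smooth_along_has_derivative has_derivative_linear by blast

lemma smooth_alongI: "open U \<Longrightarrow> N \<subseteq> U \<Longrightarrow> smooth_on U F \<Longrightarrow> smooth_along N F"
  unfolding smooth_along_def by blast

lemma smooth_along_const: "smooth_along N (\<lambda>x. c)"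
  by (rule smooth_alongI[of UNIV]) (auto intro: smooth_on_const)

lemma smooth_along_cong: "smooth_along N F \<Longrightarrow> (\<And>x. x \<in> N \<Longrightarrow> F x = G x) \<Longrightarrow> smooth_along N G"
  unfolding smooth_along_def by (metis IntD2)

lemma smooth_along_bilinear:
  assumes "bounded_bilinear B" "smooth_along N F" "smooth_along N G"
  shows "smooth_along N (\<lambda>x. B (F x) (G x))"
  unfolding smooth_along_def
proof
  fix x assume x: "x \<in> N"
  obtain U F' where U: "open U" "x \<in> U" "smooth_on U F'" "\<forall>y\<in>U \<inter> N. F' y = F y"
    using assms(2) x unfolding smooth_along_def by blast
  obtain V G' where V: "open V" "x \<in> V" "smooth_on V G'" "\<forall>y\<in>V \<inter> N. G' y = G y"
    using assms(3) x unfolding smooth_along_def by blast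
  have "smooth_on (U \<inter> V) (\<lambda>y. B (F' y) (G' y))"
    by (rule smooth_on_bilinear[OF assms(1)]) (use U V in \<open>auto intro: smooth_on_subset\<close>)
  then show "\<exists>U H. open U \<and> x \<in> U \<and> smooth_on U H \<and> (\<forall>y\<in>U \<inter> N. H y = B (F y) (G y))"
    using U V by (intro exI[of _ "U \<inter> V"] exI[of _ "\<lambda>y. B (F' y) (G' y)"]) auto
qed

lemma smooth_along_add:
  assumes "smooth_along N F" "smooth_along N G"
  shows "smooth_along N (\<lambda>x. F x + G x)"
  unfolding smooth_along_def
proof
  fix x assume x: "x \<in> N"
  obtain U F' where U: "open U" "x \<in> U" "smooth_on U F'" "\<forall>y\<in>U \<inter> N. F' y = F y"
    using assms(1) x unfolding smooth_along_def by blast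
  obtain V G' where V: "open V" "x \<in> V" "smooth_on V G'" "\<forall>y\<in>V \<inter> N. G' y = G y"
    using assms(2) x unfolding smooth_along_def by blast
  have "smooth_on (U \<inter> V) (\<lambda>y. F' y + G' y)"
    by (intro smooth_on_add) (use U V in \<open>auto intro: smooth_on_subset\<close>)
  then show "\<exists>U H. open U \<and> x \<in> U \<and> smooth_on U H \<and> (\<forall>y\<in>U \<inter> N. H y = F y + G y)"
    using U V by (intro exI[of _ "U \<inter> V"] exI[of _ "\<lambda>y. F' y + G' y"]) auto
qed

lemma smooth_along_diff:
  assumes "smooth_along N F" "smooth_along N G"
  shows "smooth_along N (\<lambda>x. F x - G x)"
  using smooth_along_add[OF assms(1) smooth_along_bilinear[OF bounded_bilinear_scaleR
        smooth_along_const[of N "-1"] assms(2)]] by simp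

lemma smooth_along_sum:
  "(\<And>i. i \<in> I \<Longrightarrow> smooth_along N (F i)) \<Longrightarrow> smooth_along N (\<lambda>x. \<Sum>i\<in>I. F i x)"
  by (induction I rule: infinite_finite_induct) (auto intro: smooth_along_const smooth_along_add)

text \<open>Locally \<open>F\<close> and \<open>X\<close> are replaced by ambient extensions;
  tangency of \<open>X\<close> makes the derivative in its direction the same for every extension of
  \<open>F\<close>.\<close>

lemma smooth_along_dir_deriv:
  assumes F: "smooth_along N F" and X: "X \<in> vector_fields N"
  shows "smooth_along N (\<lambda>x. dir_deriv N F x (X x))"
  unfolding smooth_along_def
proof
  fix x assume x: "x \<in> N"
  obtain U F' where U: "open U" "x \<in> U" "smooth_on U F'"
    "\<And>y. y \<in> U \<Longrightarrow> y \<in> N \<Longrightarrow> (F has_derivative frechet_derivative F' (at y)) (at y within N)"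
    by (rule smooth_along_local_extension[OF F x]) blast
  obtain V X' where V: "open V" "x \<in> V" "smooth_on V X'" "\<forall>y\<in>V \<inter> N. X' y = X y"
    using X x unfolding vector_fields_def smooth_along_def by blast
  have "smooth_on (U \<inter> V) (\<lambda>y. frechet_derivative F' (at y) (X' y))"
    by (intro smooth_on_frechet_derivative) (use U V in \<open>auto intro: smooth_on_subset\<close>)
  moreover have "frechet_derivative F' (at y) (X' y) = dir_deriv N F y (X y)" if "y \<in> U \<inter> V \<inter> N" for y
    using dir_deriv_eqI[OF U(4), of y "X y"] that V(4) X by (auto simp: vector_fields_def)
  ultimately show "\<exists>U H. open U \<and> x \<in> U \<and> smooth_on U H \<and> (\<forall>y\<in>U \<inter> N. H y = dir_deriv N F y (X y))"
    using U V by (intro exI[of _ "U \<inter> V"] exI[of _ "\<lambda>y. frechet_derivative F' (at y) (X' y)"]) auto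
qed

lemma dir_deriv_cong:
  assumes "smooth_along N F" "x \<in> N" "u \<in> tangent_space N x" "\<And>y. y \<in> N \<Longrightarrow> F y = G y"
  shows "dir_deriv N G x u = dir_deriv N F x u"
  by (rule dir_deriv_eqI[OF _ assms(3)])
     (rule has_derivative_transform[OF assms(2) _ smooth_along_has_derivative[OF assms(1,2)]], use assms(4) in auto)

lemma dir_deriv_const: "u \<in> tangent_space N x \<Longrightarrow> dir_deriv N (\<lambda>y. c) x u = 0"
  using dir_deriv_eqI[OF has_derivative_const] by fastforce

lemma dir_deriv_add:
  assumes "smooth_along N F" "smooth_along N G" "x \<in> N" "u \<in> tangent_space N x"
  shows "dir_deriv N (\<lambda>y. F y + G y) x u = dir_deriv N F x u + dir_deriv N G x u"
  by (rule dir_deriv_eqI[OF has_derivative_add[OF smooth_along_has_derivative smooth_along_has_derivative]])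
     (use assms in auto)

lemma dir_deriv_bilinear:
  assumes "bounded_bilinear B" "smooth_along N F" "smooth_along N G" "x \<in> N" "u \<in> tangent_space N x"
  shows "dir_deriv N (\<lambda>y. B (F y) (G y)) x u = B (F x) (dir_deriv N G x u) + B (dir_deriv N F x u) (G x)"
  by (rule dir_deriv_eqI[OF bounded_bilinear.FDERIV[OF assms(1) smooth_along_has_derivative smooth_along_has_derivative]])
     (use assms in auto)

lemma dir_deriv_sum:
  assumes "\<And>i. i \<in> I \<Longrightarrow> smooth_along N (F i)" "x \<in> N" "u \<in> tangent_space N x"
  shows "dir_deriv N (\<lambda>y. \<Sum>i\<in>I. F i y) x u = (\<Sum>i\<in>I. dir_deriv N (F i) x u)"
  by (rule dir_deriv_eqI[OF has_derivative_sum[OF smooth_along_has_derivative]]) (use assms in auto)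

section \<open>Slice charts of a submanifold\<close>

text \<open>The witnesses in \<open>embedded_submanifold\<close>, turned into parameters: a
  diffeomorphism defined on \<open>U\<close> that flattens the part of \<open>N\<close> in
  \<open>U\<close> into the subspace \<open>S\<close>.\<close>

definition slice_chart ::
  "nat \<Rightarrow> 'e::euclidean_space set \<Rightarrow> 'e set \<Rightarrow> ('e \<Rightarrow> 'e) \<Rightarrow> ('e \<Rightarrow> 'e) \<Rightarrow> 'e set \<Rightarrow> bool" where
  "slice_chart n N U \<Phi> \<Phi>' S \<longleftrightarrow> open U \<and> open (\<Phi> ` U) \<and> smooth_on U \<Phi> \<and> smooth_on (\<Phi> ` U) \<Phi>' \<and>
        (\<forall>y\<in>U. \<Phi>' (\<Phi> y) = y) \<and> subspace S \<and> dim S = n \<and> \<Phi> ` (U \<inter> N) = \<Phi> ` U \<inter> S"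

context
  fixes n :: nat and N U :: "'e::euclidean_space set" and \<Phi> \<Phi>' :: "'e \<Rightarrow> 'e" and S :: "'e set"
  assumes sc: "slice_chart n N U \<Phi> \<Phi>' S"
begin

lemma slice_chart_props:
  "open U" "open (\<Phi> ` U)" "smooth_on U \<Phi>" "smooth_on (\<Phi> ` U) \<Phi>'" "subspace S" "dim S = n"
  "\<And>y. y \<in> U \<Longrightarrow> \<Phi>' (\<Phi> y) = y" "\<And>z. z \<in> \<Phi> ` U \<Longrightarrow> \<Phi>' z \<in> U" "\<And>z. z \<in> \<Phi> ` U \<Longrightarrow> \<Phi> (\<Phi>' z) = z"
  using sc unfolding slice_chart_def by auto

lemma slice_chart_mem: "y \<in> U \<Longrightarrow> y \<in> N \<longleftrightarrow> \<Phi> y \<in> S"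
proof
  assume y: "y \<in> U" "\<Phi> y \<in> S"
  then have "\<Phi> y \<in> \<Phi> ` (U \<inter> N)" using sc unfolding slice_chart_def by auto
  then obtain z where "z \<in> U" "z \<in> N" "\<Phi> z = \<Phi> y" by auto
  then show "y \<in> N" using slice_chart_props(7) y(1) by metis
qed (use sc in \<open>auto simp: slice_chart_def\<close>)

lemma slice_chart_deriv_inverse:
  assumes "y \<in> U"
  shows "frechet_derivative \<Phi>' (at (\<Phi> y)) (frechet_derivative \<Phi> (at y) v) = v"
    "frechet_derivative \<Phi> (at y) (frechet_derivative \<Phi>' (at (\<Phi> y)) v) = v"
proof -
  have y: "\<Phi> y \<in> \<Phi> ` U" using assms by simp
  have d: "\<Phi> differentiable (at y)" "\<Phi>' differentiable (at (\<Phi> y))"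
    using smooth_on_differentiable slice_chart_props(3,4) y assms by blast+
  have "frechet_derivative (\<lambda>y. \<Phi>' (\<Phi> y)) (at y) = frechet_derivative (\<lambda>y. y) (at y)"
    by (rule frechet_derivative_transform_within_open[symmetric, OF _ slice_chart_props(1) assms])
      (auto simp: slice_chart_props(7))
  then show "frechet_derivative \<Phi>' (at (\<Phi> y)) (frechet_derivative \<Phi> (at y) v) = v"
    using frechet_derivative_chain[OF d(2,1), of v] by simp
  have "frechet_derivative (\<lambda>z. \<Phi> (\<Phi>' z)) (at (\<Phi> y)) = frechet_derivative (\<lambda>y. y) (at (\<Phi> y))"
    by (rule frechet_derivative_transform_within_open[symmetric, OF _ slice_chart_props(2) y])
      (auto simp: slice_chart_props(9))
  then show "frechet_derivative \<Phi> (at y) (frechet_derivative \<Phi>' (at (\<Phi> y)) v) = v"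
    using frechet_derivative_chain[of \<Phi> \<Phi>' "\<Phi> y" v] d slice_chart_props(7)[OF assms] by simp
qed

lemma slice_chart_curve:
  assumes y: "y \<in> U" "y \<in> N" and a: "a \<in> S"
  obtains \<epsilon> where "\<epsilon> > 0" "smooth_on {-\<epsilon><..<\<epsilon>} (\<lambda>t. \<Phi>' (\<Phi> y + t *\<^sub>R a))"
    "\<And>t. t \<in> {-\<epsilon><..<\<epsilon>} \<Longrightarrow> \<Phi> y + t *\<^sub>R a \<in> \<Phi> ` U"
    "\<And>t. t \<in> {-\<epsilon><..<\<epsilon>} \<Longrightarrow> \<Phi>' (\<Phi> y + t *\<^sub>R a) \<in> N"
    "((\<lambda>t. \<Phi>' (\<Phi> y + t *\<^sub>R a)) has_vector_derivative frechet_derivative \<Phi>' (at (\<Phi> y)) a) (at 0)"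
proof -
  have "open ((\<lambda>t::real. \<Phi> y + t *\<^sub>R a) -` (\<Phi> ` U))"
    by (rule continuous_open_vimage[OF slice_chart_props(2)]) (auto intro!: continuous_intros)
  moreover have "0 \<in> (\<lambda>t::real. \<Phi> y + t *\<^sub>R a) -` (\<Phi> ` U)" using y by auto
  ultimately obtain \<epsilon> where \<epsilon>: "\<epsilon> > 0" "ball 0 \<epsilon> \<subseteq> (\<lambda>t::real. \<Phi> y + t *\<^sub>R a) -` (\<Phi> ` U)"
    using open_contains_ball by blast
  have im: "\<Phi> y + t *\<^sub>R a \<in> \<Phi> ` U" if "t \<in> {-\<epsilon><..<\<epsilon>}" for t :: real
    using \<epsilon>(2) that by (auto simp: subset_iff abs_less_iff)
  show thesis
  proof (rule that[OF \<epsilon>(1) _ im])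
    show "smooth_on {-\<epsilon><..<\<epsilon>} (\<lambda>t. \<Phi>' (\<Phi> y + t *\<^sub>R a))"
      by (rule smooth_on_compose[OF slice_chart_props(4)]) (use im in \<open>auto intro!: smooth_intros\<close>)
    show "\<Phi>' (\<Phi> y + t *\<^sub>R a) \<in> N" if "t \<in> {-\<epsilon><..<\<epsilon>}" for t
    proof -
      have "\<Phi> y + t *\<^sub>R a \<in> S" using y a slice_chart_mem[OF y(1)]
        by (intro subspace_add subspace_scale slice_chart_props(5)) auto
      then show ?thesis
        using slice_chart_mem[OF slice_chart_props(8)[OF im[OF that]]] slice_chart_props(9)[OF im[OF that]] by simp
    qed
    have 1: "(\<Phi>' has_derivative frechet_derivative \<Phi>' (at (\<Phi> y))) (at (\<Phi> y + 0 *\<^sub>R a) within UNIV)"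
      using smooth_on_has_derivative[OF slice_chart_props(4), of "\<Phi> y"] y by simp
    have 2: "((\<lambda>t. \<Phi> y + t *\<^sub>R a) has_vector_derivative a) (at 0)"
      by (auto intro!: derivative_eq_intros simp: has_vector_derivative_def)
    show "((\<lambda>t. \<Phi>' (\<Phi> y + t *\<^sub>R a)) has_vector_derivative frechet_derivative \<Phi>' (at (\<Phi> y)) a) (at 0)"
      by (rule has_vector_derivative_compose_within[OF 1 2 zero_less_one]) auto
  qed
qed

text \<open>The definition by velocities of curves shows no linear structure; as the image of
  \<open>S\<close> under a derivative the tangent space becomes a subspace. Straight lines in
  \<open>S\<close> give one inclusion. For the other, the flattened curve stays in \<open>S\<close>
  near 0, and so does its velocity.\<close>

lemma slice_chart_tangent_space:
  assumes y: "y \<in> U" "y \<in> N"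
  shows "tangent_space N y = frechet_derivative \<Phi>' (at (\<Phi> y)) ` S"
proof (intro equalityI subsetI)
  fix v assume "v \<in> frechet_derivative \<Phi>' (at (\<Phi> y)) ` S"
  then obtain a where a: "a \<in> S" "v = frechet_derivative \<Phi>' (at (\<Phi> y)) a" by auto
  obtain \<epsilon> where "\<epsilon> > 0" "smooth_on {-\<epsilon><..<\<epsilon>} (\<lambda>t. \<Phi>' (\<Phi> y + t *\<^sub>R a))"
    "\<And>t. t \<in> {-\<epsilon><..<\<epsilon>} \<Longrightarrow> \<Phi>' (\<Phi> y + t *\<^sub>R a) \<in> N"
    "((\<lambda>t. \<Phi>' (\<Phi> y + t *\<^sub>R a)) has_vector_derivative v) (at 0)"
    unfolding a(2) by (rule slice_chart_curve[OF y a(1)]) blast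
  moreover have "\<Phi>' (\<Phi> y + 0 *\<^sub>R a) = y" using slice_chart_props(7)[OF y(1)] by simp
  ultimately show "v \<in> tangent_space N y"
    unfolding tangent_space_def by blast
next
  fix v assume "v \<in> tangent_space N y"
  then obtain \<gamma> \<epsilon> where \<gamma>: "\<epsilon> > 0" "\<And>t. t \<in> {-\<epsilon><..<\<epsilon>} \<Longrightarrow> \<gamma> t \<in> N" "\<gamma> 0 = y"
    "(\<gamma> has_vector_derivative v) (at 0)"
    by (rule tangent_spaceE) blast
  let ?w = "frechet_derivative \<Phi> (at y) v"
  have 1: "(\<Phi> has_derivative frechet_derivative \<Phi> (at y)) (at (\<gamma> 0) within UNIV)"
    using smooth_on_has_derivative[OF slice_chart_props(3) y(1)] \<gamma>(3) by simp
  have D: "((\<lambda>t. \<Phi> (\<gamma> t)) has_vector_derivative ?w) (at 0)"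
    by (rule has_vector_derivative_compose_within[OF 1 \<gamma>(4,1)]) auto
  have "isCont \<gamma> 0" using \<gamma>(4) has_vector_derivative_continuous by blast
  then have "eventually (\<lambda>t. \<gamma> t \<in> U) (nhds 0)"
    using slice_chart_props(1) y(1) \<gamma>(3) by (intro topological_tendstoD[of \<gamma> y "nhds 0"])
      (auto simp: continuous_at tendsto_nhds_iff)
  moreover have "eventually (\<lambda>t. t \<in> {-\<epsilon><..<\<epsilon>}) (nhds 0)"
    using \<gamma>(1) by (intro eventually_nhds_in_open) auto
  ultimately have "eventually (\<lambda>t. \<Phi> (\<gamma> t) \<in> S) (nhds 0)"
    by eventually_elim (use \<gamma>(2) slice_chart_mem in auto)
  then obtain V where V: "open V" "(0::real) \<in> V" "\<And>t. t \<in> V \<Longrightarrow> \<Phi> (\<gamma> t) \<in> S"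
    unfolding eventually_nhds by blast
  \<comment> \<open>Membership in \<open>S\<close> is tested against its orthogonal complement: the
    inner product of the flattened curve with \<open>b\<close> vanishes near 0, and \<open>S\<close>
    is its own double complement.\<close>
  have "?w \<bullet> b = 0" if "b \<in> orthogonal_comp S" for b
  proof -
    have "((\<lambda>t. \<Phi> (\<gamma> t) \<bullet> b) has_vector_derivative ?w \<bullet> b) (at 0)"
      using bounded_linear.has_vector_derivative[OF bounded_linear_inner_left D] .
    moreover have "((\<lambda>t. \<Phi> (\<gamma> t) \<bullet> b) has_vector_derivative 0) (at 0)"
      by (rule has_vector_derivative_transform_within_open[OF has_vector_derivative_const V(1,2)])
        (use V(3) that in \<open>auto simp: orthogonal_comp_def orthogonal_def\<close>)
    ultimately show ?thesis by (rule vector_derivative_unique_at)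
  qed
  then have "?w \<in> orthogonal_comp (orthogonal_comp S)"
    by (auto simp: orthogonal_comp_def orthogonal_def inner_commute)
  then have "?w \<in> S" using orthogonal_comp_self[OF slice_chart_props(5)] by simp
  then show "v \<in> frechet_derivative \<Phi>' (at (\<Phi> y)) ` S"
    using slice_chart_deriv_inverse(1)[OF y(1), of v] by force
qed

text \<open>In flattened coordinates the retraction is the orthogonal projection onto
  \<open>S\<close>; \<open>W\<close> consists of the points whose projection still lies in the image
  of the chart.\<close>

lemma slice_chart_retraction:
  assumes x: "x \<in> U" "x \<in> N"
  obtains W r where "open W" "x \<in> W" "smooth_on W r" "\<And>y. y \<in> W \<Longrightarrow> r y \<in> N"
    "\<And>y. y \<in> W \<Longrightarrow> y \<in> N \<Longrightarrow> r y = y"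
proof -
  note sub = slice_chart_props(5)
  have bl: "bounded_linear (oproj S)" using linear_oproj[OF sub] linear_conv_bounded_linear by blast
  define W where "W = U \<inter> (\<lambda>y. oproj S (\<Phi> y)) -` (\<Phi> ` U)"
  have W: "open W" unfolding W_def
    by (intro continuous_open_preimage slice_chart_props bounded_linear.continuous_on[OF bl]
        smooth_on_continuous_on)
  have id: "oproj S (\<Phi> y) = \<Phi> y" if "y \<in> U" "y \<in> N" for y
    using slice_chart_mem[OF that(1)] that(2) oproj_ident[OF sub] by blast
  show thesis
  proof
    show "open W" by (rule W)
    show "x \<in> W" using x id by (auto simp: W_def)
    show "smooth_on W (\<lambda>y. \<Phi>' (oproj S (\<Phi> y)))"
      by (intro smooth_on_compose[OF slice_chart_props(4)] smooth_on_linear_compose[OF bl] W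
          smooth_on_subset[OF slice_chart_props(3)]) (auto simp: W_def)
    show "\<Phi>' (oproj S (\<Phi> y)) \<in> N" if "y \<in> W" for y
    proof -
      have i: "oproj S (\<Phi> y) \<in> \<Phi> ` U" using that by (auto simp: W_def)
      show ?thesis using slice_chart_mem[OF slice_chart_props(8)[OF i]] slice_chart_props(9)[OF i]
          oproj_in[OF sub] by simp
    qed
    show "\<Phi>' (oproj S (\<Phi> y)) = y" if "y \<in> W" "y \<in> N" for y
      using that id slice_chart_props(7) by (auto simp: W_def)
  qed
qed

text \<open>The derivative of \<open>\<Phi>'\<close> carries a fixed basis of \<open>S\<close> to
  one that varies smoothly with \<open>y\<close> and spans the tangent space at points of
  \<open>N\<close>. Gram-Schmidt then gives projections that are smooth on the whole open set
  \<open>U\<close>, so \<open>Q\<close> is an ambient extension of the tangent projection.\<close>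

lemma slice_chart_smooth_tproj:
  obtains Q where "\<And>w. smooth_on U (\<lambda>y. Q y w)" "\<And>y w. y \<in> U \<Longrightarrow> y \<in> N \<Longrightarrow> Q y w = tproj N y w"
proof -
  obtain B where B: "B \<subseteq> S" "independent B" "S \<subseteq> span B" "card B = dim S"
    by (rule basis_exists)
  have spB: "span B = S" using B slice_chart_props(5) span_minimal by blast
  let ?b = "\<lambda>s y. frechet_derivative \<Phi>' (at (\<Phi> y)) s"
  have lin: "linear (frechet_derivative \<Phi>' (at (\<Phi> y)))" if "y \<in> U" for y
    using linear_frechet_derivative smooth_on_differentiable[OF slice_chart_props(4)] that by blast
  have inj: "inj (frechet_derivative \<Phi>' (at (\<Phi> y)))" if "y \<in> U" for y
    using slice_chart_deriv_inverse(2)[OF that] by (metis injI)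
  have "\<exists>Q. (\<forall>w. smooth_on U (\<lambda>y. Q y w)) \<and> (\<forall>y\<in>U. linear (Q y) \<and>
    (\<forall>w. Q y w \<in> span ((\<lambda>i. ?b i y) ` B) \<and> (\<forall>i\<in>B. (w - Q y w) \<bullet> ?b i y = 0)))"
  proof (rule smooth_gram_schmidt)
    show "finite B" using B(2) finiteI_independent by blast
    show "smooth_on U (\<lambda>y. ?b s y)" for s
      by (rule smooth_on_compose[OF smooth_on_frechet_derivative_const[OF slice_chart_props(4)] slice_chart_props(3)])
        (auto simp: slice_chart_props(1))
    show "inj_on (\<lambda>s. ?b s y) B" if "y \<in> U" for y using inj[OF that] by (auto intro: inj_on_subset)
    show "independent ((\<lambda>s. ?b s y) ` B)" if "y \<in> U" for y
      using linear_independent_injective_image[OF lin[OF that] B(2)] inj[OF that] by (auto intro: inj_on_subset)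
  qed (rule slice_chart_props)
  then obtain Q where Q: "\<And>w. smooth_on U (\<lambda>y. Q y w)"
    "\<And>y w. y \<in> U \<Longrightarrow> Q y w \<in> span ((\<lambda>i. ?b i y) ` B)"
    "\<And>y w i. y \<in> U \<Longrightarrow> i \<in> B \<Longrightarrow> (w - Q y w) \<bullet> ?b i y = 0" by metis
  show thesis
  proof (rule that[OF Q(1)])
    fix y w assume y: "y \<in> U" "y \<in> N"
    have T: "tangent_space N y = span ((\<lambda>i. ?b i y) ` B)"
      unfolding slice_chart_tangent_space[OF y] linear_span_image[OF lin[OF y(1)]] spB ..
    have "(w - Q y w) \<bullet> t = 0" if "t \<in> span ((\<lambda>i. ?b i y) ` B)" for t
      using that
    proof (induction rule: span_induct_alt)
      case (step c x s)
      then show ?case using Q(3)[OF y(1)] by (auto simp: inner_add_right)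
    qed simp
    then show "Q y w = tproj N y w"
      using Q(2)[OF y(1)] T by (intro oproj_unique[symmetric]) auto
  qed
qed

end

section \<open>The tangent projection and the second fundamental form\<close>

locale submanifold =
  fixes n :: nat and N :: "'e::euclidean_space set"
  assumes embedded: "embedded_submanifold n N"
begin

lemma slice_chart_at:
  assumes "x \<in> N"
  obtains U \<Phi> \<Phi>' S where "slice_chart n N U \<Phi> \<Phi>' S" "x \<in> U"
  using embedded assms unfolding embedded_submanifold_def slice_chart_def by metis

lemma subspace_tangent_space: "x \<in> N \<Longrightarrow> subspace (tangent_space N x)"
proof -
  assume x: "x \<in> N"
  obtain U \<Phi> \<Phi>' S where sc: "slice_chart n N U \<Phi> \<Phi>' S" "x \<in> U" by (rule slice_chart_at[OF x])
  have "linear (frechet_derivative \<Phi>' (at (\<Phi> x)))"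
    using linear_frechet_derivative smooth_on_differentiable[OF slice_chart_props(4)[OF sc(1)]] sc(2) by blast
  then show ?thesis
    unfolding slice_chart_tangent_space[OF sc x]
    using linear_subspace_image slice_chart_props(5)[OF sc(1)] by blast
qed

lemma normal_part_eq: "x \<in> N \<Longrightarrow> normal_part N x w = w - tproj N x w"
proof -
  assume x: "x \<in> N"
  note T = subspace_tangent_space[OF x]
  show ?thesis unfolding normal_part_def
  proof (rule the_equality)
    show "w - tproj N x w \<in> orthogonal_comp (tangent_space N x) \<and> w - (w - tproj N x w) \<in> tangent_space N x"
      using oproj_orth[OF T] oproj_in[OF T]
      by (auto simp: orthogonal_comp_def orthogonal_def inner_commute)
    fix z assume "z \<in> orthogonal_comp (tangent_space N x) \<and> w - z \<in> tangent_space N x"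
    then have "tproj N x w = w - z"
      by (intro oproj_unique[OF T]) (auto simp: orthogonal_comp_def orthogonal_def inner_commute)
    then show "z = w - tproj N x w" by simp
  qed
qed

lemma local_retraction:
  assumes "x \<in> N"
  obtains W r where "open W" "x \<in> W" "smooth_on W r" "\<And>y. y \<in> W \<Longrightarrow> r y \<in> N"
    "\<And>y. y \<in> W \<Longrightarrow> y \<in> N \<Longrightarrow> r y = y"
  by (rule slice_chart_at[OF assms], rule slice_chart_retraction[of n N]) (use assms in auto)

lemma smooth_along_tproj: "smooth_along N (\<lambda>y. tproj N y w)"
  unfolding smooth_along_def
proof
  fix x assume x: "x \<in> N"
  obtain U \<Phi> \<Phi>' S where sc: "slice_chart n N U \<Phi> \<Phi>' S" "x \<in> U" by (rule slice_chart_at[OF x])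
  obtain Q where "\<And>w. smooth_on U (\<lambda>y. Q y w)" "\<And>y w. y \<in> U \<Longrightarrow> y \<in> N \<Longrightarrow> Q y w = tproj N y w"
    by (rule slice_chart_smooth_tproj[OF sc(1)]) blast
  then show "\<exists>U G. open U \<and> x \<in> U \<and> smooth_on U G \<and> (\<forall>y\<in>U \<inter> N. G y = tproj N y w)"
    using sc(2) slice_chart_props(1)[OF sc(1)] by (intro exI[of _ U] exI[of _ "\<lambda>y. Q y w"]) auto
qed

lemma tproj_in: "x \<in> N \<Longrightarrow> tproj N x w \<in> tangent_space N x"
  by (rule oproj_in[OF subspace_tangent_space])

lemma tproj_ident: "x \<in> N \<Longrightarrow> w \<in> tangent_space N x \<Longrightarrow> tproj N x w = w"
  by (rule oproj_ident[OF subspace_tangent_space])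

lemma linear_tproj: "x \<in> N \<Longrightarrow> linear (tproj N x)"
  by (rule linear_oproj[OF subspace_tangent_space])

lemma tproj_symmetric: "x \<in> N \<Longrightarrow> tproj N x v \<bullet> w = v \<bullet> tproj N x w"
  by (rule oproj_symmetric[OF subspace_tangent_space])

lemma tproj_expand: "x \<in> N \<Longrightarrow> tproj N x v = (\<Sum>b\<in>Basis. (v \<bullet> b) *\<^sub>R tproj N x b)"
  by (rule linear_eq_sum_Basis[OF linear_tproj])

lemma smooth_along_tproj_compose:
  assumes "smooth_along N F"
  shows "smooth_along N (\<lambda>y. tproj N y (F y))"
proof (rule smooth_along_cong)
  show "smooth_along N (\<lambda>y. \<Sum>b\<in>Basis. (F y \<bullet> b) *\<^sub>R tproj N y b)"
    by (intro smooth_along_sum smooth_along_bilinear[OF bounded_bilinear_scaleR]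
        smooth_along_bilinear[OF bounded_bilinear_inner] smooth_along_const smooth_along_tproj assms)
qed (simp add: tproj_expand[symmetric])

lemma tproj_vector_field: "smooth_along N F \<Longrightarrow> (\<lambda>y. tproj N y (F y)) \<in> vector_fields N"
  unfolding vector_fields_def using smooth_along_tproj_compose tproj_in by blast

text \<open>Projecting the constant vector \<open>v\<close> at every point gives a global field with
  value \<open>v\<close> at \<open>x\<close>, so the choice in \<open>field_through\<close> is not
  void.\<close>

lemma field_through:
  assumes "x \<in> N" "v \<in> tangent_space N x"
  shows "field_through N x v \<in> vector_fields N" "field_through N x v x = v"
proof -
  have "\<exists>X. X \<in> vector_fields N \<and> X x = v"
    using tproj_vector_field[OF smooth_along_const[of N v]] tproj_ident[OF assms] by blast
  from someI_ex[OF this] show "field_through N x v \<in> vector_fields N" "field_through N x v x = v"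
    unfolding field_through_def by auto
qed

text \<open>The derivative of the tangential projection carries the second fundamental form.\<close>

definition dproj :: "'e \<Rightarrow> 'e \<Rightarrow> 'e \<Rightarrow> 'e" where
  "dproj x u v = dir_deriv N (\<lambda>y. tproj N y v) x u"

lemma linear_dproj_left: "x \<in> N \<Longrightarrow> linear (\<lambda>u. dproj x u v)"
  unfolding dproj_def using linear_dir_deriv[OF smooth_along_tproj] by (metis eta_contract_eq)

lemma dproj_expand:
  assumes "x \<in> N" "u \<in> tangent_space N x"
  shows "dproj x u v = (\<Sum>b\<in>Basis. (v \<bullet> b) *\<^sub>R dproj x u b)"
proof -
  have "dproj x u v = dir_deriv N (\<lambda>y. \<Sum>b\<in>Basis. (v \<bullet> b) *\<^sub>R tproj N y b) x u"
    unfolding dproj_def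
    by (rule dir_deriv_cong[symmetric, OF smooth_along_tproj assms]) (rule tproj_expand)
  also have "\<dots> = (\<Sum>b\<in>Basis. (v \<bullet> b) *\<^sub>R dproj x u b)"
    using assms by (simp add: dir_deriv_sum smooth_along_bilinear[OF bounded_bilinear_scaleR] smooth_along_const
        smooth_along_tproj dir_deriv_bilinear[OF bounded_bilinear_scaleR] dir_deriv_const dproj_def)
  finally show ?thesis .
qed

lemma linear_dproj:
  assumes "x \<in> N" "u \<in> tangent_space N x"
  shows "linear (dproj x u)"
proof (rule linearI)
  show "dproj x u (v + w) = dproj x u v + dproj x u w" for v w
    by (subst (1 2 3) dproj_expand[OF assms]) (simp add: algebra_simps sum.distrib)
  show "dproj x u (c *\<^sub>R v) = c *\<^sub>R dproj x u v" for c v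
    by (subst (1 2) dproj_expand[OF assms]) (simp add: scaleR_sum_right)
qed

text \<open>Each projection is symmetric, and the derivative of a family of symmetric operators is
  symmetric.\<close>

lemma dproj_symmetric:
  assumes "x \<in> N" "u \<in> tangent_space N x"
  shows "dproj x u v \<bullet> w = v \<bullet> dproj x u w"
proof -
  note sm = smooth_along_bilinear[OF bounded_bilinear_inner] smooth_along_const smooth_along_tproj
  have "dproj x u v \<bullet> w = dir_deriv N (\<lambda>y. tproj N y v \<bullet> w) x u"
    using assms by (simp add: dir_deriv_bilinear[OF bounded_bilinear_inner] sm dir_deriv_const dproj_def)
  also have "\<dots> = dir_deriv N (\<lambda>y. v \<bullet> tproj N y w) x u"
    using assms by (intro dir_deriv_cong sm) (auto simp: tproj_symmetric)
  also have "\<dots> = v \<bullet> dproj x u w"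
    using assms by (simp add: dir_deriv_bilinear[OF bounded_bilinear_inner] sm dir_deriv_const dproj_def)
  finally show ?thesis .
qed

text \<open>Product rule for the operator field \<open>P\<close> applied to \<open>F\<close>. Only
  \<open>tproj N y b\<close> with fixed \<open>b\<close> is known to be smooth in \<open>y\<close>,
  hence the expansion of \<open>F\<close> in the ambient basis.\<close>

lemma dir_deriv_tproj:
  assumes "smooth_along N F" "x \<in> N" "u \<in> tangent_space N x"
  shows "dir_deriv N (\<lambda>y. tproj N y (F y)) x u = dproj x u (F x) + tproj N x (dir_deriv N F x u)"
proof -
  note sm = smooth_along_bilinear[OF bounded_bilinear_scaleR] smooth_along_bilinear[OF bounded_bilinear_inner]
    smooth_along_const smooth_along_tproj smooth_along_sum assms(1)
  have "dir_deriv N (\<lambda>y. tproj N y (F y)) x u = dir_deriv N (\<lambda>y. \<Sum>b\<in>Basis. (F y \<bullet> b) *\<^sub>R tproj N y b) x u"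
    by (rule dir_deriv_cong[OF _ assms(2,3)]) (auto intro!: sm simp: tproj_expand[symmetric])
  also have "\<dots> = (\<Sum>b\<in>Basis. (F x \<bullet> b) *\<^sub>R dproj x u b + (dir_deriv N F x u \<bullet> b) *\<^sub>R tproj N x b)"
    using assms(2,3) by (simp add: dir_deriv_sum sm dir_deriv_bilinear[OF bounded_bilinear_scaleR]
        dir_deriv_bilinear[OF bounded_bilinear_inner] dir_deriv_const dproj_def)
  also have "\<dots> = dproj x u (F x) + tproj N x (dir_deriv N F x u)"
    using dproj_expand[OF assms(2,3), of "F x"] tproj_expand[OF assms(2), of "dir_deriv N F x u"]
    by (simp add: sum.distrib)
  finally show ?thesis .
qed

text \<open>Derivative of \<open>P P = P\<close>, that is \<open>dP = dP P + P dP\<close>. On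
  tangent vectors it leaves \<open>P dP = 0\<close>, so the values there are normal; on normal
  vectors it says that the values are tangent.\<close>

lemma dproj_idempotent:
  assumes "x \<in> N" "u \<in> tangent_space N x"
  shows "dproj x u v = dproj x u (tproj N x v) + tproj N x (dproj x u v)"
proof -
  have "dproj x u v = dir_deriv N (\<lambda>y. tproj N y (tproj N y v)) x u"
    unfolding dproj_def
    by (rule dir_deriv_cong[symmetric, OF smooth_along_tproj assms]) (simp add: tproj_ident tproj_in)
  also have "\<dots> = dproj x u (tproj N x v) + tproj N x (dproj x u v)"
    using dir_deriv_tproj[OF smooth_along_tproj assms] unfolding dproj_def .
  finally show ?thesis .
qed

lemma tproj_dproj: "x \<in> N \<Longrightarrow> u \<in> tangent_space N x \<Longrightarrow> v \<in> tangent_space N x \<Longrightarrow> tproj N x (dproj x u v) = 0"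
  using dproj_idempotent[of x u v] by (simp add: tproj_ident)

text \<open>Differentiating \<open>g = P(\<gamma>) g\<close> isolates the normal part of the
  velocity of \<open>g\<close>. It is applied to coordinate curves, for the symmetry of the second
  fundamental form, and to a variation, for its mixed second derivative.\<close>

lemma normal_of_curve_derivative:
  assumes \<gamma>: "(\<gamma> has_vector_derivative u) (at 0)" "\<epsilon> > 0" "\<And>t. t \<in> {-\<epsilon><..<\<epsilon>} \<Longrightarrow> \<gamma> t \<in> N"
    and u: "u \<in> tangent_space N (\<gamma> 0)"
    and g: "(g has_vector_derivative \<eta>) (at 0)" "\<And>t. t \<in> {-\<epsilon><..<\<epsilon>} \<Longrightarrow> g t \<in> tangent_space N (\<gamma> t)"
  shows "\<eta> - tproj N (\<gamma> 0) \<eta> = dproj (\<gamma> 0) u (g 0)"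
proof -
  have N0: "\<gamma> 0 \<in> N" using \<gamma> by auto
  have P: "((\<lambda>t. tproj N (\<gamma> t) b) has_vector_derivative dproj (\<gamma> 0) u b) (at 0)" for b
    unfolding dproj_def
    by (rule has_vector_derivative_compose_within[OF smooth_along_has_derivative[OF smooth_along_tproj N0] \<gamma>])
  have "((\<lambda>t. \<Sum>b\<in>Basis. (g t \<bullet> b) *\<^sub>R tproj N (\<gamma> t) b) has_vector_derivative
     (\<Sum>b\<in>Basis. (g 0 \<bullet> b) *\<^sub>R dproj (\<gamma> 0) u b + (\<eta> \<bullet> b) *\<^sub>R tproj N (\<gamma> 0) b)) (at 0)"
    by (intro has_vector_derivative_sum bounded_bilinear.has_vector_derivative[OF bounded_bilinear_scaleR] P
        bounded_linear.has_vector_derivative[OF bounded_linear_inner_left g(1)])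
  also have "(\<Sum>b\<in>Basis. (g 0 \<bullet> b) *\<^sub>R dproj (\<gamma> 0) u b + (\<eta> \<bullet> b) *\<^sub>R tproj N (\<gamma> 0) b) =
     dproj (\<gamma> 0) u (g 0) + tproj N (\<gamma> 0) \<eta>"
    using dproj_expand[OF N0 u, of "g 0"] tproj_expand[OF N0, of \<eta>] by (simp add: sum.distrib)
  finally have "((\<lambda>t. \<Sum>b\<in>Basis. (g t \<bullet> b) *\<^sub>R tproj N (\<gamma> t) b) has_vector_derivative
     dproj (\<gamma> 0) u (g 0) + tproj N (\<gamma> 0) \<eta>) (at 0)" .
  then have "(g has_vector_derivative dproj (\<gamma> 0) u (g 0) + tproj N (\<gamma> 0) \<eta>) (at 0)"
    by (rule has_vector_derivative_transform_within_open[where S = "{-\<epsilon><..<\<epsilon>}"])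
      (use \<gamma>(2,3) g(2) in \<open>auto simp: tproj_expand[symmetric] tproj_ident\<close>)
  then have "\<eta> = dproj (\<gamma> 0) u (g 0) + tproj N (\<gamma> 0) \<eta>"
    using vector_derivative_unique_at g(1) by blast
  then show ?thesis by (simp add: algebra_simps)
qed

lemma normal_of_field_derivative:
  assumes "X \<in> vector_fields N" "x \<in> N" "u \<in> tangent_space N x"
  shows "dir_deriv N X x u - tproj N x (dir_deriv N X x u) = dproj x u (X x)"
proof -
  have X: "smooth_along N X" using assms(1) by (simp add: vector_fields_def)
  have "dir_deriv N X x u = dir_deriv N (\<lambda>y. tproj N y (X y)) x u"
    using assms(1) by (intro dir_deriv_cong smooth_along_tproj_compose X assms) (auto simp: vector_fields_def tproj_ident)
  then show ?thesis using dir_deriv_tproj[OF X assms(2,3)] by (simp add: algebra_simps)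
qed

text \<open>The right side no longer mentions an extension of \<open>v\<close>, which settles the
  tensoriality that the definition relies on.\<close>

lemma second_ff_eq:
  assumes "x \<in> N" "u \<in> tangent_space N x" "v \<in> tangent_space N x"
  shows "second_ff N x u v = dproj x u v"
  unfolding second_ff_def normal_part_eq[OF assms(1)]
  using normal_of_field_derivative[OF field_through(1)] field_through(2) assms by simp

text \<open>In a slice chart the second fundamental form is the normal part of a second derivative
  of the parametrisation \<open>\<Phi>'\<close>, and second derivatives are symmetric.\<close>

lemma dproj_commute:
  assumes x: "x \<in> N" and u: "u \<in> tangent_space N x" and v: "v \<in> tangent_space N x"
  shows "dproj x u v = dproj x v u"
proof -
  obtain U \<Phi> \<Phi>' S where sc: "slice_chart n N U \<Phi> \<Phi>' S" "x \<in> U" by (rule slice_chart_at[OF x])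
  let ?V = "\<Phi> ` U"
  note sm = slice_chart_props(4)[OF sc(1)] and Vo = slice_chart_props(2)[OF sc(1)]
  let ?D = "\<lambda>z b. frechet_derivative \<Phi>' (at z) b"
  let ?\<eta> = "\<lambda>a b. frechet_derivative (\<lambda>z. ?D z b) (at (\<Phi> x)) a"
  have xV: "\<Phi> x \<in> ?V" using sc(2) by simp
  have key: "?\<eta> a b - tproj N x (?\<eta> a b) = dproj x (?D (\<Phi> x) a) (?D (\<Phi> x) b)" if ab: "a \<in> S" "b \<in> S" for a b
  proof -
    obtain \<epsilon> where \<epsilon>: "\<epsilon> > 0" "\<And>t. t \<in> {-\<epsilon><..<\<epsilon>} \<Longrightarrow> \<Phi> x + t *\<^sub>R a \<in> ?V"
      "\<And>t. t \<in> {-\<epsilon><..<\<epsilon>} \<Longrightarrow> \<Phi>' (\<Phi> x + t *\<^sub>R a) \<in> N"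
      "((\<lambda>t. \<Phi>' (\<Phi> x + t *\<^sub>R a)) has_vector_derivative ?D (\<Phi> x) a) (at 0)"
      by (rule slice_chart_curve[OF sc x ab(1)]) blast
    have 0: "\<Phi>' (\<Phi> x + 0 *\<^sub>R a) = x" using slice_chart_props(7)[OF sc] by simp
    have 1: "((\<lambda>z. ?D z b) has_derivative frechet_derivative (\<lambda>z. ?D z b) (at (\<Phi> x))) (at (\<Phi> x + 0 *\<^sub>R a) within UNIV)"
      using smooth_on_has_derivative[OF smooth_on_frechet_derivative_const[OF sm] xV] by simp
    have 2: "((\<lambda>t. \<Phi> x + t *\<^sub>R a) has_vector_derivative a) (at 0)"
      by (auto intro!: derivative_eq_intros simp: has_vector_derivative_def)
    have g: "((\<lambda>t. ?D (\<Phi> x + t *\<^sub>R a) b) has_vector_derivative ?\<eta> a b) (at 0)"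
      by (rule has_vector_derivative_compose_within[OF 1 2 zero_less_one]) auto
    have gT: "?D (\<Phi> x + t *\<^sub>R a) b \<in> tangent_space N (\<Phi>' (\<Phi> x + t *\<^sub>R a))" if t: "t \<in> {-\<epsilon><..<\<epsilon>}" for t
      using slice_chart_tangent_space[OF sc(1) slice_chart_props(8)[OF sc(1) \<epsilon>(2)[OF t]] \<epsilon>(3)[OF t]]
        slice_chart_props(9)[OF sc(1) \<epsilon>(2)[OF t]] ab(2) by auto
    have "?D (\<Phi> x) a \<in> tangent_space N x" using slice_chart_tangent_space[OF sc x] ab(1) by auto
    then show ?thesis
      using normal_of_curve_derivative[OF \<epsilon>(4,1,3) _ g gT] 0 by simp
  qed
  obtain a b where ab: "a \<in> S" "b \<in> S" "u = ?D (\<Phi> x) a" "v = ?D (\<Phi> x) b"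
    using u v unfolding slice_chart_tangent_space[OF sc x] by auto
  have "?\<eta> a b = ?\<eta> b a" by (rule frechet_derivative_symmetric[OF Vo sm xV])
  then show ?thesis using key[OF ab(1,2)] key[OF ab(2,1)] ab(3,4) by simp
qed

end

section \<open>Curvature\<close>

lemma some_onb: "subspace T \<Longrightarrow> orthonormal_basis T (some_onb T)"
proof -
  assume T: "subspace T"
  obtain B where "B \<subseteq> T" "pairwise orthogonal B" "\<And>x. x \<in> B \<Longrightarrow> norm x = 1" "independent B"
    "card B = dim T" "span B = T"
    using orthonormal_basis_subspace[OF T] by metis
  then have "\<exists>E. orthonormal_basis T E" unfolding orthonormal_basis_def by blast
  then show ?thesis unfolding some_onb_def by (rule someI_ex)
qed

lemma orthonormal_basis_finite: "orthonormal_basis T E \<Longrightarrow> finite E"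
  unfolding orthonormal_basis_def by (metis pairwise_orthogonal_imp_finite)

lemma oproj_onb:
  assumes T: "subspace T" and E: "orthonormal_basis T E"
  shows "oproj T w = (\<Sum>e\<in>E. (w \<bullet> e) *\<^sub>R e)"
proof (rule oproj_unique[OF T])
  note fin = orthonormal_basis_finite[OF E]
  have E': "E \<subseteq> T" "pairwise orthogonal E" "\<And>e. e \<in> E \<Longrightarrow> norm e = 1" "span E = T"
    using E unfolding orthonormal_basis_def by auto
  show "(\<Sum>e\<in>E. (w \<bullet> e) *\<^sub>R e) \<in> T" using E'(1) by (intro subspace_sum subspace_scale T) auto
  fix t assume "t \<in> T"
  then have "t \<in> span E" using E' by simp
  then show "(w - (\<Sum>e\<in>E. (w \<bullet> e) *\<^sub>R e)) \<bullet> t = 0"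
  proof (induction rule: span_induct_alt)
    case (step c e t)
    have "(\<Sum>e'\<in>E. (w \<bullet> e') *\<^sub>R e') \<bullet> e = (\<Sum>e'\<in>E. if e' = e then w \<bullet> e else 0)"
      unfolding inner_sum_left using step E'(2,3)
      by (intro sum.cong) (auto simp: pairwise_def orthogonal_def norm_eq_1)
    then have "(\<Sum>e'\<in>E. (w \<bullet> e') *\<^sub>R e') \<bullet> e = w \<bullet> e" using fin step by simp
    then show ?case using step by (simp add: inner_diff_left inner_add_right)
  qed simp
qed

lemma norm_oproj_onb:
  assumes T: "subspace T" and E: "orthonormal_basis T E"
  shows "(norm (oproj T w))\<^sup>2 = (\<Sum>e\<in>E. (w \<bullet> e)\<^sup>2)"
proof -
  have "(norm (oproj T w))\<^sup>2 = oproj T w \<bullet> w"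
    using oproj_inner[OF T oproj_in[OF T], of w w] by (simp add: dot_square_norm inner_commute)
  also have "\<dots> = (\<Sum>e\<in>E. (w \<bullet> e)\<^sup>2)"
    unfolding oproj_onb[OF assms] by (simp add: inner_sum_right power2_eq_square inner_commute[of _ w])
  finally show ?thesis .
qed

lemma norm_sq_Basis: "(norm (v::'a::euclidean_space))\<^sup>2 = (\<Sum>b\<in>Basis. (v \<bullet> b)\<^sup>2)"
  unfolding dot_square_norm[symmetric] by (subst euclidean_inner) (simp add: power2_eq_square)

text \<open>Product rule with a moving direction \<open>w\<close>: a pure second derivative plus a
  term with the derivative of \<open>w\<close>. Once isolated, the second-order term cancels in
  commutators by its symmetry.\<close>

lemma frechet_derivative_frechet_derivative:
  fixes G :: "'a::euclidean_space \<Rightarrow> 'b::real_normed_vector" and w :: "'a \<Rightarrow> 'a"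
  assumes "open U" "smooth_on U G" "smooth_on U w" "x \<in> U"
  shows "frechet_derivative (\<lambda>y. frechet_derivative G (at y) (w y)) (at x) a =
    frechet_derivative (\<lambda>y. frechet_derivative G (at y) (w x)) (at x) a +
    frechet_derivative G (at x) (frechet_derivative w (at x) a)"
proof -
  have linG: "linear (frechet_derivative G (at y))" if "y \<in> U" for y
    using linear_frechet_derivative smooth_on_differentiable[OF assms(2) that] by blast
  let ?G2 = "\<lambda>b. frechet_derivative (\<lambda>y. frechet_derivative G (at y) b) (at x)"
  have D2: "((\<lambda>y. frechet_derivative G (at y) b) has_derivative ?G2 b) (at x)" for b
    using smooth_on_has_derivative[OF smooth_on_frechet_derivative_const[OF assms(2)] assms(4)] .
  have Dw: "(w has_derivative frechet_derivative w (at x)) (at x)"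
    using smooth_on_has_derivative[OF assms(3,4)] .
  have expand: "((\<lambda>y. frechet_derivative G (at y) (v y)) has_derivative
      (\<lambda>a. \<Sum>b\<in>Basis. (v x \<bullet> b) *\<^sub>R ?G2 b a + (v' a \<bullet> b) *\<^sub>R frechet_derivative G (at x) b)) (at x)"
    if v: "(v has_derivative v') (at x)" for v v'
  proof -
    have "((\<lambda>y. \<Sum>b\<in>Basis. (v y \<bullet> b) *\<^sub>R frechet_derivative G (at y) b) has_derivative
      (\<lambda>a. \<Sum>b\<in>Basis. (v x \<bullet> b) *\<^sub>R ?G2 b a + (v' a \<bullet> b) *\<^sub>R frechet_derivative G (at x) b)) (at x)"
      by (intro has_derivative_sum has_derivative_scaleR has_derivative_inner_left v D2)
    then show ?thesis
      by (rule has_derivative_transform_within_open[OF _ assms(1,4)])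
        (simp add: linear_eq_sum_Basis[OF linG, symmetric])
  qed
  have 1: "frechet_derivative (\<lambda>y. frechet_derivative G (at y) (w y)) (at x) a =
     (\<Sum>b\<in>Basis. (w x \<bullet> b) *\<^sub>R ?G2 b a + (frechet_derivative w (at x) a \<bullet> b) *\<^sub>R frechet_derivative G (at x) b)"
    by (rule fun_cong[OF frechet_derivative_at[OF expand[OF Dw]], symmetric])
  have 2: "frechet_derivative (\<lambda>y. frechet_derivative G (at y) (w x)) (at x) a = (\<Sum>b\<in>Basis. (w x \<bullet> b) *\<^sub>R ?G2 b a)"
    using fun_cong[OF frechet_derivative_at[OF expand[OF has_derivative_const[of "w x"]]], of a] by simp
  show ?thesis unfolding 1 2
    by (simp add: sum.distrib linear_eq_sum_Basis[OF linG[OF assms(4)], of "frechet_derivative w (at x) a"])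
qed

context submanifold
begin

section \<open>Lie brackets, the Levi-Civita connection and the Gauss equation\<close>

text \<open>The normal part of the bracket is \<open>dP(X)Y - dP(Y)X\<close>, zero by the symmetry
  of the second fundamental form.\<close>

lemma lie_bracket_vector_field:
  assumes X: "X \<in> vector_fields N" and Y: "Y \<in> vector_fields N"
  shows "lie_bracket N X Y \<in> vector_fields N"
proof -
  have s: "smooth_along N X" "smooth_along N Y" using assms by (auto simp: vector_fields_def)
  have "smooth_along N (lie_bracket N X Y)"
    using smooth_along_diff[OF smooth_along_dir_deriv[OF s(2) X] smooth_along_dir_deriv[OF s(1) Y]]
    unfolding lie_bracket_def[abs_def] .
  moreover have "lie_bracket N X Y x \<in> tangent_space N x" if x: "x \<in> N" for x
  proof -
    have t: "X x \<in> tangent_space N x" "Y x \<in> tangent_space N x" using assms x by (auto simp: vector_fields_def)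
    have "lie_bracket N X Y x - tproj N x (lie_bracket N X Y x) =
      dproj x (X x) (Y x) - dproj x (Y x) (X x)"
      unfolding lie_bracket_def normal_of_field_derivative[OF Y x t(1), symmetric]
        normal_of_field_derivative[OF X x t(2), symmetric] linear_diff[OF linear_tproj[OF x]] by simp
    then have "lie_bracket N X Y x = tproj N x (lie_bracket N X Y x)" using dproj_commute[OF x t] by simp
    then show ?thesis using tproj_in[OF x] by metis
  qed
  ultimately show ?thesis by (simp add: vector_fields_def)
qed

definition tangential_connection :: "('e \<Rightarrow> 'e) \<Rightarrow> ('e \<Rightarrow> 'e) \<Rightarrow> 'e \<Rightarrow> 'e" where
  "tangential_connection X Y x = tproj N x (dir_deriv N Y x (X x))"

lemma is_levi_civita_tangential_connection: "is_levi_civita N tangential_connection"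
proof -
  have s: "smooth_along N X" if "X \<in> vector_fields N" for X using that by (simp add: vector_fields_def)
  have t: "X x \<in> tangent_space N x" if "X \<in> vector_fields N" "x \<in> N" for X x using that by (simp add: vector_fields_def)
  have 1: "tangential_connection X Y \<in> vector_fields N" if "X \<in> vector_fields N" "Y \<in> vector_fields N" for X Y
    unfolding tangential_connection_def[abs_def]
    by (intro tproj_vector_field smooth_along_dir_deriv s that)
  have 2: "tangential_connection (\<lambda>y. X y + Y y) Z x = tangential_connection X Z x + tangential_connection Y Z x"
    "tangential_connection X (\<lambda>y. Y y + Z y) x = tangential_connection X Y x + tangential_connection X Z x"
    if "X \<in> vector_fields N" "Y \<in> vector_fields N" "Z \<in> vector_fields N" "x \<in> N" for X Y Z x
    unfolding tangential_connection_def using that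
    by (simp_all add: linear_add[OF linear_dir_deriv] s linear_add[OF linear_tproj] dir_deriv_add t)
  have 3: "tangential_connection (\<lambda>y. \<phi> y *\<^sub>R X y) Y x = \<phi> x *\<^sub>R tangential_connection X Y x"
    "tangential_connection X (\<lambda>y. \<phi> y *\<^sub>R Y y) x =
       dir_deriv N \<phi> x (X x) *\<^sub>R Y x + \<phi> x *\<^sub>R tangential_connection X Y x"
    if "smooth_along N \<phi>" "X \<in> vector_fields N" "Y \<in> vector_fields N" "x \<in> N" for \<phi> :: "'e \<Rightarrow> real" and X Y x
    unfolding tangential_connection_def using that
    by (simp_all add: linear_scale[OF linear_dir_deriv] s linear_scale[OF linear_tproj] linear_add[OF linear_tproj]
        dir_deriv_bilinear[OF bounded_bilinear_scaleR] t tproj_ident)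
  have 4: "tangential_connection X Y x - tangential_connection Y X x = lie_bracket N X Y x"
    if "X \<in> vector_fields N" "Y \<in> vector_fields N" "x \<in> N" for X Y x
    using tproj_ident[OF that(3) t[OF lie_bracket_vector_field[OF that(1,2)] that(3)]]
    unfolding tangential_connection_def linear_diff[OF linear_tproj[OF that(3)], symmetric] lie_bracket_def .
  have 5: "dir_deriv N (\<lambda>y. Y y \<bullet> Z y) x (X x) =
      tangential_connection X Y x \<bullet> Z x + Y x \<bullet> tangential_connection X Z x"
    if "X \<in> vector_fields N" "Y \<in> vector_fields N" "Z \<in> vector_fields N" "x \<in> N" for X Y Z x
    unfolding tangential_connection_def using that
    by (simp add: dir_deriv_bilinear[OF bounded_bilinear_inner] s t tproj_symmetric tproj_ident
        flip: tproj_symmetric[of x "Y x"])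
  show ?thesis unfolding is_levi_civita_def by (intro conjI ballI allI impI 1 2 3 4 5)
qed

lemma is_levi_civita_levi_civita: "is_levi_civita N (levi_civita N)"
  using someI[of "is_levi_civita N", OF is_levi_civita_tangential_connection] unfolding levi_civita_def .

lemma levi_civita_vector_field:
  "X \<in> vector_fields N \<Longrightarrow> Y \<in> vector_fields N \<Longrightarrow> levi_civita N X Y \<in> vector_fields N"
  using is_levi_civita_levi_civita unfolding is_levi_civita_def by blast

lemma is_levi_civitaD:
  assumes "is_levi_civita N nab" "X \<in> vector_fields N" "Y \<in> vector_fields N" "x \<in> N"
  shows "nab X Y x - nab Y X x = lie_bracket N X Y x"
    "Z \<in> vector_fields N \<Longrightarrow> dir_deriv N (\<lambda>y. Y y \<bullet> Z y) x (X x) = nab X Y x \<bullet> Z x + Y x \<bullet> nab X Z x"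
  using assms unfolding is_levi_civita_def by blast+

text \<open>\<open>levi_civita\<close> is an arbitrary connection with the defining properties, so
  uniqueness is needed. The difference \<open>D\<close> of two such connections is symmetric in its
  fields and skew with respect to the metric, and the two symmetries together force \<open>D\<close>
  to vanish.\<close>

lemma levi_civita_eq:
  assumes "X \<in> vector_fields N" "Y \<in> vector_fields N" "x \<in> N"
  shows "levi_civita N X Y x = tproj N x (dir_deriv N Y x (X x))"
proof -
  define D where "D X Y = levi_civita N X Y x - tangential_connection X Y x" for X Y
  have sym: "D X Y = D Y X" if "X \<in> vector_fields N" "Y \<in> vector_fields N" for X Y
  proof -
    have "levi_civita N X Y x - levi_civita N Y X x = lie_bracket N X Y x"
      "tangential_connection X Y x - tangential_connection Y X x = lie_bracket N X Y x"
      using is_levi_civitaD[OF is_levi_civita_levi_civita]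
        is_levi_civitaD[OF is_levi_civita_tangential_connection] that assms(3) by blast+
    then show ?thesis by (simp add: D_def algebra_simps)
  qed
  have skew: "D X Y \<bullet> Z x = - (D X Z \<bullet> Y x)"
    if "X \<in> vector_fields N" "Y \<in> vector_fields N" "Z \<in> vector_fields N" for X Y Z
  proof -
    have "dir_deriv N (\<lambda>y. Y y \<bullet> Z y) x (X x) = levi_civita N X Y x \<bullet> Z x + Y x \<bullet> levi_civita N X Z x"
      "dir_deriv N (\<lambda>y. Y y \<bullet> Z y) x (X x) = tangential_connection X Y x \<bullet> Z x + Y x \<bullet> tangential_connection X Z x"
      using is_levi_civitaD[OF is_levi_civita_levi_civita]
        is_levi_civitaD[OF is_levi_civita_tangential_connection] that assms(3) by blast+
    then show ?thesis by (simp add: D_def algebra_simps inner_commute)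
  qed
  \<comment> \<open>Three uses each of skewness and symmetry, in alternation, lead back to the start
    with a minus sign.\<close>
  have z: "D X Y \<bullet> Z x = 0" if "Z \<in> vector_fields N" for Z
    using skew[of X Y Z] skew[of Z X Y] skew[of Y Z X] sym[of X Z] sym[of Y Z] sym[of X Y] assms(1,2) that
    by simp
  \<comment> \<open>The vector \<open>D X Y\<close> is tangent at \<open>x\<close>, so a field with
    this value there can serve as test field; \<open>D X Y\<close> is then orthogonal to
    itself.\<close>
  let ?Z = "\<lambda>y. tproj N y (D X Y)"
  have "D X Y \<in> tangent_space N x"
    unfolding D_def using levi_civita_vector_field[OF assms(1,2)] is_levi_civita_tangential_connection assms
    by (intro subspace_diff[OF subspace_tangent_space]) (auto simp: vector_fields_def tangential_connection_def tproj_in)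
  then have "?Z x = D X Y" by (rule tproj_ident[OF assms(3)])
  then have "D X Y = 0" using z[OF tproj_vector_field[OF smooth_along_const]] by (metis inner_eq_zero_iff)
  then show ?thesis by (simp add: D_def tangential_connection_def)
qed

text \<open>The ambient space is flat: for a local extension \<open>G\<close> the pure second
  derivatives cancel by symmetry, and what remains is the derivative of \<open>G\<close> along the
  bracket.\<close>

lemma dir_deriv_commutator:
  fixes Z :: "'e \<Rightarrow> 'e"
  assumes Z: "smooth_along N Z" and X: "X \<in> vector_fields N" and Y: "Y \<in> vector_fields N" and x: "x \<in> N"
  shows "dir_deriv N (\<lambda>y. dir_deriv N Z y (Y y)) x (X x) - dir_deriv N (\<lambda>y. dir_deriv N Z y (X y)) x (Y x) =
    dir_deriv N Z x (lie_bracket N X Y x)"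
proof -
  obtain U G where U: "open U" "x \<in> U" "smooth_on U G"
    "\<And>y. y \<in> U \<Longrightarrow> y \<in> N \<Longrightarrow> (Z has_derivative frechet_derivative G (at y)) (at y within N)"
    by (rule smooth_along_local_extension[OF Z x]) blast
  let ?G2 = "\<lambda>a b. frechet_derivative (\<lambda>y. frechet_derivative G (at y) b) (at x) a"
  have main: "dir_deriv N (\<lambda>y. dir_deriv N Z y (Y y)) x u =
      ?G2 u (Y x) + frechet_derivative G (at x) (dir_deriv N Y x u)"
    if Y: "Y \<in> vector_fields N" and u: "u \<in> tangent_space N x" for Y u
  proof -
    have sY: "smooth_along N Y" using Y by (simp add: vector_fields_def)
    obtain V Y' where V: "open V" "x \<in> V" "smooth_on V Y'" "\<And>y. y \<in> V \<Longrightarrow> y \<in> N \<Longrightarrow> Y' y = Y y"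
      "\<And>y. y \<in> V \<Longrightarrow> y \<in> N \<Longrightarrow> (Y has_derivative frechet_derivative Y' (at y)) (at y within N)"
      by (rule smooth_along_local_extension[OF sY x]) blast
    let ?W = "U \<inter> V" and ?H = "\<lambda>y. frechet_derivative G (at y) (Y' y)"
    have W: "open ?W" "x \<in> ?W" "smooth_on ?W G" "smooth_on ?W Y'"
      using U V by (auto intro: smooth_on_subset)
    have eq: "dir_deriv N Z y (Y y) = ?H y" if "y \<in> ?W" "y \<in> N" for y
      using dir_deriv_eqI[OF U(4), of y "Y y"] that Y V(4) by (auto simp: vector_fields_def)
    obtain d where d: "d > 0" "ball x d \<subseteq> ?W" using W(1,2) open_contains_ball by blast
    have "(?H has_derivative frechet_derivative ?H (at x)) (at x within N)"
      by (rule has_derivative_at_withinI[OF smooth_on_has_derivative[OF smooth_on_frechet_derivative[OF W(3,4,1)] W(2)]])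
    then have "((\<lambda>y. dir_deriv N Z y (Y y)) has_derivative frechet_derivative ?H (at x)) (at x within N)"
      by (rule has_derivative_transform_within[OF _ d(1) x])
        (use d(2) eq in \<open>auto simp: dist_commute subset_iff\<close>)
    from dir_deriv_eqI[OF this u] show ?thesis
      unfolding frechet_derivative_frechet_derivative[OF W(1,3,4,2)] dir_deriv_eqI[OF V(5)[OF V(2) x] u]
        V(4)[OF V(2) x] .
  qed
  have t: "X x \<in> tangent_space N x" "Y x \<in> tangent_space N x" "lie_bracket N X Y x \<in> tangent_space N x"
    using X Y lie_bracket_vector_field[OF X Y] x by (auto simp: vector_fields_def)
  have "linear (frechet_derivative G (at x))"
    using linear_frechet_derivative smooth_on_differentiable[OF U(3,2)] by blast
  then show ?thesis
    unfolding main[OF Y t(1)] main[OF X t(2)] frechet_derivative_symmetric[OF U(1,3,2), of "X x" "Y x"]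
      dir_deriv_eqI[OF U(4)[OF U(2) x] t(3)] by (simp add: lie_bracket_def linear_diff)
qed

text \<open>The second derivatives of \<open>Z\<close> cancel against the bracket term. What
  survives is \<open>P dP(X)\<close> applied to the ambient derivative of \<open>Z\<close> along
  \<open>Y\<close>, minus the same with \<open>X\<close> and \<open>Y\<close> exchanged.\<close>

lemma gauss_equation:
  assumes X: "X \<in> vector_fields N" and Y: "Y \<in> vector_fields N" and Z: "Z \<in> vector_fields N"
    and x: "x \<in> N" and w: "w \<in> tangent_space N x"
  shows "riemann N X Y Z x \<bullet> w =
    dproj x (Y x) (Z x) \<bullet> dproj x (X x) w - dproj x (X x) (Z x) \<bullet> dproj x (Y x) w"
proof -
  have sZ: "smooth_along N Z" using Z by (simp add: vector_fields_def)
  have iter: "levi_civita N X (levi_civita N Y Z) x =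
      tproj N x (dproj x (X x) (dir_deriv N Z x (Y x))) +
      tproj N x (dir_deriv N (\<lambda>y. dir_deriv N Z y (Y y)) x (X x))"
    if X: "X \<in> vector_fields N" and Y: "Y \<in> vector_fields N" for X Y
  proof -
    have t: "X x \<in> tangent_space N x" using X x by (simp add: vector_fields_def)
    have s: "smooth_along N (\<lambda>y. dir_deriv N Z y (Y y))" by (rule smooth_along_dir_deriv[OF sZ Y])
    have "levi_civita N X (levi_civita N Y Z) x = tproj N x (dir_deriv N (levi_civita N Y Z) x (X x))"
      by (rule levi_civita_eq[OF X levi_civita_vector_field[OF Y Z] x])
    also have "dir_deriv N (levi_civita N Y Z) x (X x) =
        dir_deriv N (\<lambda>y. tproj N y (dir_deriv N Z y (Y y))) x (X x)"
      by (rule dir_deriv_cong[OF smooth_along_tproj_compose[OF s] x t]) (simp add: levi_civita_eq[OF Y Z])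
    also have "\<dots> = dproj x (X x) (dir_deriv N Z x (Y x)) +
        tproj N x (dir_deriv N (\<lambda>y. dir_deriv N Z y (Y y)) x (X x))"
      by (rule dir_deriv_tproj[OF s x t])
    finally show ?thesis
      by (simp add: linear_add[OF linear_tproj[OF x]] tproj_ident[OF x tproj_in[OF x]])
  qed
  have lie: "levi_civita N (lie_bracket N X Y) Z x =
      tproj N x (dir_deriv N (\<lambda>y. dir_deriv N Z y (Y y)) x (X x)) -
      tproj N x (dir_deriv N (\<lambda>y. dir_deriv N Z y (X y)) x (Y x))"
    unfolding levi_civita_eq[OF lie_bracket_vector_field[OF X Y] Z x] dir_deriv_commutator[OF sZ X Y x, symmetric]
      linear_diff[OF linear_tproj[OF x]] ..
  have R: "riemann N X Y Z x = tproj N x (dproj x (X x) (dir_deriv N Z x (Y x))) -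
      tproj N x (dproj x (Y x) (dir_deriv N Z x (X x)))"
    unfolding riemann_def iter[OF X Y] iter[OF Y X] lie by simp
  have key: "tproj N x (dproj x u (dir_deriv N Z x v)) \<bullet> w = dproj x v (Z x) \<bullet> dproj x u w"
    if u: "u \<in> tangent_space N x" and v: "v \<in> tangent_space N x" for u v
  proof -
    have "tproj N x (dproj x u (dir_deriv N Z x v)) \<bullet> w = dir_deriv N Z x v \<bullet> dproj x u w"
      by (simp add: tproj_symmetric[OF x] tproj_ident[OF x w] dproj_symmetric[OF x u])
    \<comment> \<open>\<open>dproj x u w\<close> is normal because \<open>w\<close> is tangent, so
      the tangential part of the derivative of \<open>Z\<close> may be subtracted; the normal part
      left over is given by the second fundamental form.\<close>
    also have "\<dots> = (dir_deriv N Z x v - tproj N x (dir_deriv N Z x v)) \<bullet> dproj x u w"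
      by (simp add: inner_diff_left tproj_symmetric[OF x] tproj_dproj[OF x u w])
    finally show ?thesis unfolding normal_of_field_derivative[OF Z x v] .
  qed
  have "X x \<in> tangent_space N x" "Y x \<in> tangent_space N x" using X Y x by (auto simp: vector_fields_def)
  then show ?thesis unfolding R inner_diff_left by (simp add: key)
qed

section \<open>Traces of the second fundamental form and the sign of the integrand\<close>

abbreviation onb :: "'e \<Rightarrow> 'e set" where
  "onb x \<equiv> some_onb (tangent_space N x)"

definition mean_curvature :: "'e \<Rightarrow> 'e" where
  "mean_curvature x = (\<Sum>e\<in>onb x. dproj x e e)"

lemma onb:
  assumes "x \<in> N"
  shows "orthonormal_basis (tangent_space N x) (onb x)" "finite (onb x)"
    "\<And>e. e \<in> onb x \<Longrightarrow> e \<in> tangent_space N x"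
proof -
  show 1: "orthonormal_basis (tangent_space N x) (onb x)"
    using some_onb subspace_tangent_space assms by blast
  show "finite (onb x)" "\<And>e. e \<in> onb x \<Longrightarrow> e \<in> tangent_space N x"
    using orthonormal_basis_finite[OF 1] 1 unfolding orthonormal_basis_def by auto
qed

lemma ff_theta_eq:
  assumes x: "x \<in> N" and u: "u \<in> tangent_space N x"
  shows "ff_theta N x u = (\<Sum>e\<in>onb x. (norm (dproj x u e))\<^sup>2)"
  unfolding ff_theta_def by (rule sum.cong) (auto simp: second_ff_eq[OF x u] onb[OF x])

text \<open>Trace of the Gauss equation: products of diagonal values add up to the pairing with the
  trace, and the mixed terms are, by symmetry, the squares in \<open>ff_theta\<close>.\<close>

lemma ricci_eq:
  assumes x: "x \<in> N" and u: "u \<in> tangent_space N x"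
  shows "ricci N x u u = dproj x u u \<bullet> mean_curvature x - ff_theta N x u"
proof -
  have "riemann N (field_through N x e) (field_through N x u) (field_through N x u) x \<bullet> e =
     dproj x u u \<bullet> dproj x e e - (norm (dproj x u e))\<^sup>2" if "e \<in> onb x" for e
    unfolding gauss_equation[OF field_through(1)[OF x onb(3)[OF x that]] field_through(1)[OF x u]
        field_through(1)[OF x u] x onb(3)[OF x that]] field_through(2)[OF x onb(3)[OF x that]]
      field_through(2)[OF x u] dproj_commute[OF x onb(3)[OF x that] u]
    by (simp add: dot_square_norm)
  then show ?thesis
    unfolding ricci_def mean_curvature_def ff_theta_eq[OF x u] inner_sum_right
    by (simp add: sum_subtractf)
qed

text \<open>The projections of an ambient orthonormal basis are in general linearly dependent, but
  they form a Parseval frame of the tangent space, and a trace may be taken over such a frame as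
  well as over an orthonormal basis.\<close>

lemma trace_dproj_tproj:
  assumes x: "x \<in> N"
  shows "(\<Sum>a\<in>Basis. dproj x (tproj N x a) (tproj N x a)) = mean_curvature x"
proof -
  have P: "tproj N x w = (\<Sum>e\<in>onb x. (w \<bullet> e) *\<^sub>R e)" for w
    by (rule oproj_onb[OF subspace_tangent_space[OF x] onb(1)[OF x]])
  have "(\<Sum>a\<in>Basis. dproj x (tproj N x a) (tproj N x a)) =
      (\<Sum>a\<in>Basis. \<Sum>e\<in>onb x. (a \<bullet> e) *\<^sub>R dproj x e (tproj N x a))"
  proof (rule sum.cong[OF refl])
    fix a :: 'e
    have "dproj x (tproj N x a) v = (\<Sum>e\<in>onb x. (a \<bullet> e) *\<^sub>R dproj x e v)" for v
      unfolding P[of a] by (simp add: linear_sum[OF linear_dproj_left[OF x]] linear_scale[OF linear_dproj_left[OF x]])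
    then show "dproj x (tproj N x a) (tproj N x a) = (\<Sum>e\<in>onb x. (a \<bullet> e) *\<^sub>R dproj x e (tproj N x a))" .
  qed
  also have "\<dots> = (\<Sum>e\<in>onb x. \<Sum>a\<in>Basis. (a \<bullet> e) *\<^sub>R dproj x e (tproj N x a))" by (rule sum.swap)
  also have "\<dots> = mean_curvature x" unfolding mean_curvature_def
  proof (rule sum.cong[OF refl])
    fix e assume e: "e \<in> onb x"
    have "(\<Sum>a\<in>Basis. (a \<bullet> e) *\<^sub>R dproj x e (tproj N x a)) = dproj x e (\<Sum>a\<in>Basis. (e \<bullet> a) *\<^sub>R tproj N x a)"
      by (simp add: inner_commute linear_sum[OF linear_dproj[OF x onb(3)[OF x e]]]
          linear_scale[OF linear_dproj[OF x onb(3)[OF x e]]])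
    also have "\<dots> = dproj x e e"
      unfolding tproj_expand[OF x, of e, symmetric] tproj_ident[OF x onb(3)[OF x e]] ..
    finally show "(\<Sum>a\<in>Basis. (a \<bullet> e) *\<^sub>R dproj x e (tproj N x a)) = dproj x e e" .
  qed
  finally show ?thesis .
qed

text \<open>
  \<open>dproj x u\<close> is symmetric and interchanges the tangent and the normal space, so that the
  two off-diagonal blocks contribute equally.
\<close>

lemma hilbert_schmidt_dproj:
  assumes x: "x \<in> N" and u: "u \<in> tangent_space N x"
  shows "(\<Sum>a\<in>Basis. (norm (dproj x u a))\<^sup>2) = 2 * ff_theta N x u"
proof -
  let ?S = "dproj x u" and ?P = "tproj N x"
  have split: "(norm (?S a))\<^sup>2 = (norm (?S (?P a)))\<^sup>2 + (norm (?P (?S a)))\<^sup>2" for a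
  proof -
    \<comment> \<open>The two terms of the differentiated idempotence are orthogonal, since
      \<open>?S\<close> maps tangent vectors to normal ones.\<close>
    have "?S (?P a) \<bullet> ?P (?S a) = 0"
      using tproj_symmetric[OF x, of "?S (?P a)" "?S a"] tproj_dproj[OF x u tproj_in[OF x]] by simp
    then have "(norm (?S (?P a) + ?P (?S a)))\<^sup>2 = (norm (?S (?P a)))\<^sup>2 + (norm (?P (?S a)))\<^sup>2"
      by (simp add: dot_square_norm[symmetric] algebra_simps inner_commute)
    then show ?thesis using dproj_idempotent[OF x u, of a] by simp
  qed
  \<comment> \<open>\<open>?S\<close> after \<open>?P\<close> and \<open>?P\<close> after
    \<open>?S\<close> are adjoint to each other, hence have equal Hilbert-Schmidt norm; the squared
    matrix entries are summed in the other order.\<close>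
  have "(\<Sum>a\<in>Basis. (norm (?S (?P a)))\<^sup>2) = (\<Sum>a\<in>Basis. \<Sum>b\<in>Basis. (a \<bullet> ?P (?S b))\<^sup>2)"
    by (simp add: norm_sq_Basis[of "?S (?P _)"] dproj_symmetric[OF x u] tproj_symmetric[OF x])
  also have "\<dots> = (\<Sum>b\<in>Basis. (norm (?P (?S b)))\<^sup>2)"
    by (subst sum.swap) (simp add: norm_sq_Basis[of "?P _"] inner_commute)
  finally have eq: "(\<Sum>a\<in>Basis. (norm (?S (?P a)))\<^sup>2) = (\<Sum>b\<in>Basis. (norm (?P (?S b)))\<^sup>2)" .
  have "(\<Sum>a\<in>Basis. (norm (?S a))\<^sup>2) = (\<Sum>a\<in>Basis. (norm (?S (?P a)))\<^sup>2 + (norm (?P (?S a)))\<^sup>2)"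
    by (rule sum.cong[OF refl split])
  also have "\<dots> = 2 * (\<Sum>b\<in>Basis. (norm (?P (?S b)))\<^sup>2)"
    by (simp only: sum.distrib eq mult_2)
  also have "(\<Sum>b\<in>Basis. (norm (?P (?S b)))\<^sup>2) = (\<Sum>b\<in>Basis. \<Sum>e\<in>onb x. (b \<bullet> ?S e)\<^sup>2)"
    by (simp add: norm_oproj_onb[OF subspace_tangent_space[OF x] onb(1)[OF x]] dproj_symmetric[OF x u])
  also have "\<dots> = ff_theta N x u"
    unfolding ff_theta_eq[OF x u] by (subst sum.swap) (simp add: norm_sq_Basis[of "?S _"] inner_commute)
  finally show ?thesis .
qed

text \<open>By homogeneity only unit vectors matter, and there this is the supremum property. That
  property presupposes boundedness of the set in \<open>ff_max\<close>, which has to be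
  shown.\<close>

lemma dproj_le_ff_max:
  assumes x: "x \<in> N" and u: "u \<in> tangent_space N x"
  shows "norm (dproj x u u) \<le> sqrt (ff_max N x) * (norm u)\<^sup>2"
proof (cases "u = 0")
  case True
  then show ?thesis using linear_0[OF linear_dproj[OF x u]] by simp
next
  case False
  let ?U = "{v \<in> tangent_space N x. norm v = 1}"
  \<comment> \<open>A crude bound from ambient coordinates. \<open>dproj x a b\<close> is linear in
    \<open>a\<close> on the whole space, although its values at non-tangent \<open>a\<close> depend
    on which derivative was selected.\<close>
  define K where "K = (\<Sum>a\<in>Basis. \<Sum>b\<in>Basis. norm (dproj x a b))"
  have bd: "norm (dproj x v v) \<le> K" if "v \<in> ?U" for v
  proof -
    have v: "v \<in> tangent_space N x" "\<And>b. b \<in> Basis \<Longrightarrow> \<bar>v \<bullet> b\<bar> \<le> 1"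
      using that Basis_le_norm[of _ v] by auto
    have "dproj x v v = (\<Sum>b\<in>Basis. (v \<bullet> b) *\<^sub>R dproj x v b)" by (rule dproj_expand[OF x v(1)])
    also have "\<dots> = (\<Sum>b\<in>Basis. \<Sum>a\<in>Basis. (v \<bullet> b) *\<^sub>R (v \<bullet> a) *\<^sub>R dproj x a b)"
      by (subst linear_eq_sum_Basis[OF linear_dproj_left[OF x], of v]) (simp add: scaleR_sum_right)
    also have "norm \<dots> \<le> (\<Sum>b\<in>Basis. \<Sum>a\<in>Basis. norm (dproj x a b))"
    proof (intro sum_norm_le order_trans[OF norm_sum] sum_mono)
      fix a b :: 'e assume "a \<in> Basis" "b \<in> Basis"
      then have "\<bar>v \<bullet> b\<bar> * (\<bar>v \<bullet> a\<bar> * norm (dproj x a b)) \<le> 1 * (1 * norm (dproj x a b))"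
        using v(2) by (intro mult_mono) auto
      then show "norm ((v \<bullet> b) *\<^sub>R (v \<bullet> a) *\<^sub>R dproj x a b) \<le> norm (dproj x a b)"
        by (simp add: abs_mult mult.assoc)
    qed
    also have "\<dots> = K" unfolding K_def by (rule sum.swap)
    finally show ?thesis .
  qed
  have bdd: "bdd_above ((\<lambda>v. (norm (second_ff N x v v))\<^sup>2) ` ?U)"
  proof (rule bdd_aboveI[where M = "K\<^sup>2"])
    fix r assume "r \<in> (\<lambda>v. (norm (second_ff N x v v))\<^sup>2) ` ?U"
    then obtain v where v: "v \<in> ?U" "r = (norm (second_ff N x v v))\<^sup>2" by auto
    then have "second_ff N x v v = dproj x v v" using second_ff_eq[OF x] by blast
    then show "r \<le> K\<^sup>2" using bd[OF v(1)] v(2) by (simp add: power_mono)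
  qed
  let ?v = "(1 / norm u) *\<^sub>R u"
  have v: "?v \<in> ?U" using False u by (auto intro: subspace_scale[OF subspace_tangent_space[OF x]])
  have "(norm (second_ff N x ?v ?v))\<^sup>2 \<le> ff_max N x"
    unfolding ff_max_def by (rule cSUP_upper[OF v bdd])
  then have "(norm (dproj x ?v ?v))\<^sup>2 \<le> ff_max N x" using second_ff_eq[OF x] v by auto
  then have le: "norm (dproj x ?v ?v) \<le> sqrt (ff_max N x)" by (rule real_le_rsqrt)
  have "dproj x u u = (norm u)\<^sup>2 *\<^sub>R dproj x ?v ?v"
    using v linear_scale[OF linear_dproj[OF x]] linear_scale[OF linear_dproj_left[OF x]] False u
    by (simp add: power2_eq_square)
  then have "norm (dproj x u u) = (norm u)\<^sup>2 * norm (dproj x ?v ?v)" by simp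
  also have "\<dots> \<le> (norm u)\<^sup>2 * sqrt (ff_max N x)" using le by (rule mult_left_mono) simp
  finally show ?thesis by (simp add: mult.commute)
qed

lemma ff_theta_scale:
  assumes x: "x \<in> N" and u: "u \<in> tangent_space N x"
  shows "ff_theta N x (c *\<^sub>R u) = c\<^sup>2 * ff_theta N x u"
proof -
  have "c *\<^sub>R u \<in> tangent_space N x" using subspace_scale[OF subspace_tangent_space[OF x] u] .
  then show ?thesis
    using ff_theta_eq[OF x] u linear_scale[OF linear_dproj_left[OF x]]
    by (simp add: power_mult_distrib sum_distrib_left)
qed

text \<open>All terms are quadratic in \<open>u\<close>, so the hypothesis on unit vectors scales.
  The factor 2 arises because replacing the Ricci curvature by means of \<open>ricci_eq\<close>
  brings in a second \<open>ff_theta\<close>.\<close>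

lemma curvature_condition_homogeneous:
  assumes cond: "\<And>v. v \<in> tangent_space N x \<Longrightarrow> norm v = 1 \<Longrightarrow>
      c * ff_max N x + ff_theta N x v < ricci N x v v"
    and x: "x \<in> N" and u: "u \<in> tangent_space N x" "u \<noteq> 0"
  shows "c * ff_max N x * (norm u)\<^sup>2 + 2 * ff_theta N x u - dproj x u u \<bullet> mean_curvature x < 0"
proof -
  let ?v = "(1 / norm u) *\<^sub>R u"
  have v: "?v \<in> tangent_space N x" "norm ?v = 1"
    using u by (auto intro: subspace_scale[OF subspace_tangent_space[OF x]])
  have uv: "u = norm u *\<^sub>R ?v" using u by simp
  have d: "dproj x u u = (norm u)\<^sup>2 *\<^sub>R dproj x ?v ?v"
    using v linear_scale[OF linear_dproj[OF x]] linear_scale[OF linear_dproj_left[OF x]] u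
    by (simp add: power2_eq_square)
  have t: "ff_theta N x u = (norm u)\<^sup>2 * ff_theta N x ?v"
    using ff_theta_scale[OF x v(1), of "norm u"] uv by simp
  have "c * ff_max N x + 2 * ff_theta N x ?v - dproj x ?v ?v \<bullet> mean_curvature x < 0"
    using cond[OF v] ricci_eq[OF x v(1)] by simp
  then have "(norm u)\<^sup>2 * (c * ff_max N x + 2 * ff_theta N x ?v - dproj x ?v ?v \<bullet> mean_curvature x) < 0"
    using u by (simp add: mult_pos_neg)
  then show ?thesis unfolding d t by (simp add: algebra_simps)
qed

text \<open>\<open>Z\<close> is the summed integrand at one point, with \<open>u i\<close> the
  images of the frame. The coefficient \<open>2 * (\<alpha> - 1)\<close> in the curvature condition
  originates here: one factor of \<open>h * h\<close> is enlarged to \<open>1 + h\<close> to make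
  the exponents of the two terms agree, and \<open>4 * \<alpha> * (\<alpha> - 1)\<close> is then
  split as \<open>2 * \<alpha>\<close> times \<open>2 * (\<alpha> - 1)\<close>.\<close>

lemma index_integrand_negative:
  fixes u :: "'i::finite \<Rightarrow> 'e" and \<alpha> :: real and x :: 'e
  defines "h \<equiv> (\<Sum>i\<in>UNIV. (norm (u i))\<^sup>2)"
  defines "Z \<equiv> (\<Sum>a\<in>Basis. 4 * \<alpha> * (\<alpha> - 1) * (1 + h) powr (\<alpha> - 2) * (\<Sum>i\<in>UNIV. dproj x (u i) a \<bullet> u i)\<^sup>2 +
      2 * \<alpha> * (1 + h) powr (\<alpha> - 1) * ((\<Sum>i\<in>UNIV. (norm (dproj x (u i) a))\<^sup>2) -
        (\<Sum>i\<in>UNIV. dproj x (u i) (u i) \<bullet> dproj x (tproj N x a) (tproj N x a))))"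
  assumes cond: "\<And>v. v \<in> tangent_space N x \<Longrightarrow> norm v = 1 \<Longrightarrow>
      2 * (\<alpha> - 1) * ff_max N x + ff_theta N x v < ricci N x v v"
    and \<alpha>: "\<alpha> > 1" and x: "x \<in> N" and u: "\<And>i. u i \<in> tangent_space N x"
  shows "Z \<le> 0" "u i \<noteq> 0 \<Longrightarrow> Z < 0"
proof -
  let ?B = "\<Sum>i\<in>UNIV. dproj x (u i) (u i)"
  let ?f = "ff_max N x"
  let ?c = "\<lambda>i. 2 * (\<alpha> - 1) * ?f * (norm (u i))\<^sup>2 + 2 * ff_theta N x (u i) - dproj x (u i) (u i) \<bullet> mean_curvature x"
  have h0: "h \<ge> 0" unfolding h_def by (intro sum_nonneg) simp
  have sq: "(\<Sum>a\<in>Basis. (\<Sum>i\<in>UNIV. dproj x (u i) a \<bullet> u i)\<^sup>2) = (norm ?B)\<^sup>2"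
  proof -
    have "(\<Sum>i\<in>UNIV. dproj x (u i) a \<bullet> u i) = ?B \<bullet> a" for a
      unfolding inner_sum_left dproj_symmetric[OF x u, of _ a] by (rule sum.cong) (auto simp: inner_commute)
    then show ?thesis unfolding norm_sq_Basis[of ?B] by simp
  qed
  have hs: "(\<Sum>a\<in>Basis. \<Sum>i\<in>UNIV. (norm (dproj x (u i) a))\<^sup>2) = (\<Sum>i\<in>UNIV. 2 * ff_theta N x (u i))"
    by (subst sum.swap) (simp add: hilbert_schmidt_dproj[OF x u])
  have mc: "(\<Sum>a\<in>Basis. \<Sum>i\<in>UNIV. dproj x (u i) (u i) \<bullet> dproj x (tproj N x a) (tproj N x a)) =
      (\<Sum>i\<in>UNIV. dproj x (u i) (u i) \<bullet> mean_curvature x)"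
    by (subst sum.swap) (simp add: trace_dproj_tproj[OF x, symmetric] inner_sum_right)
  have Z: "Z = 4 * \<alpha> * (\<alpha> - 1) * (1 + h) powr (\<alpha> - 2) * (norm ?B)\<^sup>2 +
      2 * \<alpha> * (1 + h) powr (\<alpha> - 1) *
       (\<Sum>i\<in>UNIV. 2 * ff_theta N x (u i) - dproj x (u i) (u i) \<bullet> mean_curvature x)"
    unfolding Z_def sum.distrib sum_distrib_left[symmetric] sum_subtractf sq hs mc by simp
  have "norm ?B \<le> (\<Sum>i\<in>UNIV. norm (dproj x (u i) (u i)))" by (rule norm_sum)
  also have "\<dots> \<le> (\<Sum>i\<in>UNIV. sqrt ?f * (norm (u i))\<^sup>2)" by (intro sum_mono dproj_le_ff_max x u)
  also have "\<dots> = sqrt ?f * h" by (simp add: h_def sum_distrib_left)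
  finally have B: "norm ?B \<le> sqrt ?f * h" .
  have Bf: "(norm ?B)\<^sup>2 \<le> (1 + h) * (?f * h)"
  proof (cases "h = 0")
    case True
    then show ?thesis using B by simp
  next
    case False
    \<comment> \<open>This needs a unit tangent vector, since over an empty set the supremum is
      unspecified; a nonzero \<open>u i\<close> provides one. Were \<open>?f\<close> negative,
      \<open>sqrt ?f\<close> would be negative as well and could not bound a norm.\<close>
    have "?f \<ge> 0"
    proof (rule ccontr)
      assume "\<not> 0 \<le> ?f"
      have "\<exists>i. u i \<noteq> 0" using False by (rule contrapos_np) (simp add: h_def)
      then obtain i where i: "u i \<noteq> 0" by blast
      then have "(1 / norm (u i)) *\<^sub>R u i \<in> tangent_space N x" by (intro subspace_scale[OF subspace_tangent_space[OF x]] u)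
      moreover have "norm ((1 / norm (u i)) *\<^sub>R u i) = 1" using i by simp
      ultimately have "0 \<le> sqrt ?f" using dproj_le_ff_max[OF x] norm_ge_zero
        by (metis mult.right_neutral one_power2 order_trans)
      then show False using \<open>\<not> 0 \<le> ?f\<close> by simp
    qed
    have "(norm ?B)\<^sup>2 \<le> (sqrt ?f * h)\<^sup>2" using B by (intro power_mono) auto
    also have "\<dots> = h * (?f * h)" using \<open>?f \<ge> 0\<close> by (simp add: power_mult_distrib power2_eq_square)
    also have "\<dots> \<le> (1 + h) * (?f * h)" using \<open>?f \<ge> 0\<close> h0 by (intro mult_right_mono) auto
    finally show ?thesis .
  qed
  have pw: "(1 + h) powr (\<alpha> - 2) * (1 + h) = (1 + h) powr (\<alpha> - 1)"
    using h0 powr_add[of "1 + h" "\<alpha> - 2" 1] by simp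
  have "4 * \<alpha> * (\<alpha> - 1) * (1 + h) powr (\<alpha> - 2) * (norm ?B)\<^sup>2 \<le>
      4 * \<alpha> * (\<alpha> - 1) * (1 + h) powr (\<alpha> - 2) * ((1 + h) * (?f * h))"
    using \<alpha> Bf by (intro mult_left_mono) auto
  also have "\<dots> = 2 * \<alpha> * ((1 + h) powr (\<alpha> - 2) * (1 + h)) * (2 * (\<alpha> - 1) * ?f * h)" by simp
  also have "\<dots> = 2 * \<alpha> * (1 + h) powr (\<alpha> - 1) * (\<Sum>i\<in>UNIV. 2 * (\<alpha> - 1) * ?f * (norm (u i))\<^sup>2)"
    unfolding pw unfolding h_def sum_distrib_left[symmetric] ..
  finally have le: "Z \<le> 2 * \<alpha> * (1 + h) powr (\<alpha> - 1) * (\<Sum>i\<in>UNIV. ?c i)"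
    unfolding Z by (simp add: sum.distrib sum_subtractf algebra_simps)
  have pos: "2 * \<alpha> * (1 + h) powr (\<alpha> - 1) > 0" using \<alpha> h0 by simp
  have c: "?c i < 0" if "u i \<noteq> 0" for i
    by (rule curvature_condition_homogeneous[OF cond x u that])
  have c0: "?c i \<le> 0" for i
  proof (cases "u i = 0")
    case True
    moreover have "dproj x (u i) (u i) = 0" using True linear_0[OF linear_dproj[OF x u[of i]]] by simp
    moreover have "ff_theta N x (u i) = 0" using True ff_theta_scale[OF x u[of i], of 0] by simp
    ultimately show ?thesis by simp
  qed (use c in force)
  have "(\<Sum>i\<in>UNIV. ?c i) \<le> 0" by (rule sum_nonpos) (rule c0)
  then have "2 * \<alpha> * (1 + h) powr (\<alpha> - 1) * (\<Sum>i\<in>UNIV. ?c i) \<le> 0"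
    using pos by (simp add: mult_le_0_iff)
  then show "Z \<le> 0" using le by linarith
  assume i: "u i \<noteq> 0"
  have "(\<Sum>i\<in>UNIV. ?c i) < (\<Sum>i\<in>(UNIV::'i set). 0)"
    by (rule sum_strict_mono_ex1) (use c0 c[OF i] in auto)
  then have "2 * \<alpha> * (1 + h) powr (\<alpha> - 1) * (\<Sum>i\<in>UNIV. ?c i) < 0"
    using pos by (simp add: mult_pos_neg)
  then show "Z < 0" using le by linarith
qed

end

section \<open>Charts and orthonormal frames\<close>

definition metric_frame :: "real ^ 'm ^ 'm \<Rightarrow> ('m \<Rightarrow> real ^ 'm::finite) \<Rightarrow> bool" where
  "metric_frame g e \<longleftrightarrow> (\<forall>i j. e i \<bullet> (g *v e j) = (if i = j then 1 else 0))"

text \<open>Gram-Schmidt for the form \<open>g\<close>: given fewer than \<open>CARD('m)\<close>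
  vectors, some nonzero \<open>w\<close> is orthogonal in the Euclidean sense to all
  \<open>g *v v i\<close>, hence \<open>g\<close>-orthogonal to the \<open>v i\<close>, and it is
  then normalised. The induction runs over natural numbers, and a bijection transports the result to
  the index type.\<close>

lemma metric_frame_exists:
  fixes g :: "real ^ 'm::finite ^ 'm"
  assumes sym: "transpose g = g" and pos: "\<And>v. v \<noteq> 0 \<Longrightarrow> v \<bullet> (g *v v) > 0"
  obtains e where "metric_frame g e"
proof -
  have symm: "a \<bullet> (g *v b) = b \<bullet> (g *v a)" for a b
    using dot_lmul_matrix[of a g b] sym by (metis inner_commute transpose_matrix_vector)
  have "\<exists>v::nat \<Rightarrow> real ^ 'm. \<forall>i<k. \<forall>j<k. v i \<bullet> (g *v v j) = (if i = j then 1 else 0)"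
    if "k \<le> CARD('m)" for k
    using that
  proof (induction k)
    case (Suc k)
    then obtain v :: "nat \<Rightarrow> real ^ 'm" where v: "\<And>i j. i < k \<Longrightarrow> j < k \<Longrightarrow> v i \<bullet> (g *v v j) = (if i = j then 1 else 0)"
      by (metis Suc_leD)
    have "dim ((\<lambda>i. g *v v i) ` {..<k}) \<le> card ((\<lambda>i. g *v v i) ` {..<k})"
      by (rule dim_le_card') simp
    also have "\<dots> \<le> k" using card_image_le[of "{..<k}" "\<lambda>i. g *v v i"] by simp
    finally have "dim ((\<lambda>i. g *v v i) ` {..<k}) < DIM(real ^ 'm)" using Suc.prems by simp
    then obtain w where w: "w \<noteq> 0" "\<And>y. y \<in> span ((\<lambda>i. g *v v i) ` {..<k}) \<Longrightarrow> orthogonal w y"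
      by (rule orthogonal_to_subspace_exists) blast
    have wv: "w \<bullet> (g *v v i) = 0" "v i \<bullet> (g *v w) = 0" if "i < k" for i
      using w(2)[OF span_base, of "g *v v i"] that symm[of w "v i"] by (auto simp: orthogonal_def)
    define s where "s = 1 / sqrt (w \<bullet> (g *v w))"
    have s: "s * s * (w \<bullet> (g *v w)) = 1" using pos[OF w(1)] by (simp add: s_def)
    let ?v = "v(k := s *\<^sub>R w)"
    have "?v i \<bullet> (g *v ?v j) = (if i = j then 1 else 0)" if "i < Suc k" "j < Suc k" for i j
      using that v wv s by (auto simp: less_Suc_eq matrix_vector_mult_scaleR)
    then show ?case by blast
  qed simp
  then obtain v :: "nat \<Rightarrow> real ^ 'm" where v: "\<And>i j. i < CARD('m) \<Longrightarrow> j < CARD('m) \<Longrightarrow>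
      v i \<bullet> (g *v v j) = (if i = j then 1 else 0)" by blast
  obtain h :: "'m \<Rightarrow> nat" where h: "bij_betw h UNIV {0..<CARD('m)}"
    using ex_bij_betw_finite_nat[of "UNIV :: 'm set"] by auto
  have h': "h i < CARD('m)" "h i = h j \<longleftrightarrow> i = j" for i j
    using bij_betwE[OF h] bij_betw_imp_inj_on[OF h] by (auto simp: inj_eq)
  have "metric_frame g (\<lambda>i. v (h i))" unfolding metric_frame_def using v h' by simp
  then show thesis by (rule that)
qed

text \<open>The entries of the inverse matrix by Cramer's rule, a form in which continuity is evident.\<close>

definition metric_inverse :: "real ^ 'm::finite ^ 'm \<Rightarrow> 'm \<Rightarrow> 'm \<Rightarrow> real" where
  "metric_inverse g j k = det (\<chi> a b. if b = j then axis k 1 $ a else g $ a $ b) / det g"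

context
  fixes g :: "real ^ 'm::finite ^ 'm" and e :: "'m \<Rightarrow> real ^ 'm"
  assumes e: "metric_frame g e"
begin

lemma metric_frame_matrix:
  defines "E \<equiv> (\<chi> j i. e i $ j) :: real ^ 'm ^ 'm"
  shows "transpose E ** (g ** E) = mat 1" "g ** (E ** transpose E) = mat 1" "E ** (transpose E ** g) = mat 1"
proof -
  show 1: "transpose E ** (g ** E) = mat 1"
    using e unfolding metric_frame_def E_def
    by (simp add: vec_eq_iff matrix_matrix_mult_def transpose_def mat_def inner_vec_def matrix_vector_mult_def)
  then have "(transpose E ** g) ** E = mat 1" by (simp add: matrix_mul_assoc)
  then show 2: "E ** (transpose E ** g) = mat 1" by (rule matrix_left_right_inverse[THEN iffD1])
  then have "(E ** transpose E) ** g = mat 1" by (simp add: matrix_mul_assoc)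
  then show "g ** (E ** transpose E) = mat 1" by (rule matrix_left_right_inverse[THEN iffD1])
qed

lemma metric_frame_det: "det g > 0"
proof -
  define E where "E = ((\<chi> j i. e i $ j) :: real ^ 'm ^ 'm)"
  have "det E * (det g * det E) = 1"
    using arg_cong[OF metric_frame_matrix(1), of det] by (simp add: det_mul det_transpose E_def)
  then have "det g * (det E)\<^sup>2 = 1" by (simp add: power2_eq_square algebra_simps)
  then show ?thesis by (metis mult_nonpos_nonneg not_le zero_le_power2 zero_less_one)
qed

text \<open>With the frame as columns of a matrix \<open>E\<close>, the left side is an entry of
  \<open>E ** transpose E\<close>, the inverse of \<open>g\<close>, and so depends on the metric
  alone. This is how the arbitrary choice of a frame disappears from traces.\<close>

lemma metric_frame_inverse: "(\<Sum>i\<in>UNIV. e i $ j * e i $ k) = metric_inverse g j k"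
proof -
  define E where "E = ((\<chi> j i. e i $ j) :: real ^ 'm ^ 'm)"
  let ?x = "(E ** transpose E) *v axis k 1"
  have "g *v ?x = axis k 1"
    using metric_frame_matrix(2) by (simp add: matrix_vector_mul_assoc E_def)
  then have "?x = (\<chi> j. det (\<chi> a b. if b = j then axis k 1 $ a else g $ a $ b) / det g)"
    using metric_frame_det by (intro cramer[THEN iffD1]) auto
  moreover have "?x $ j = (\<Sum>i\<in>UNIV. e i $ j * e i $ k)"
    by (simp add: matrix_vector_mult_basis column_def matrix_matrix_mult_def transpose_def E_def)
  ultimately show ?thesis by (simp add: metric_inverse_def)
qed

lemma metric_frame_inner_sum:
  fixes L1 L2 :: "real ^ 'm \<Rightarrow> 'e::real_inner"
  assumes "linear L1" "linear L2"
  shows "(\<Sum>i\<in>UNIV. L1 (e i) \<bullet> L2 (e i)) =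
    (\<Sum>j\<in>UNIV. \<Sum>k\<in>UNIV. metric_inverse g j k * (L1 (axis j 1) \<bullet> L2 (axis k 1)))"
proof -
  have expand: "L w = (\<Sum>j\<in>UNIV. w $ j *\<^sub>R L (axis j 1))" if "linear L" for L :: "real ^ 'm \<Rightarrow> 'e" and w
  proof -
    have "L w = L (\<Sum>j\<in>UNIV. w $ j *\<^sub>R axis j 1)"
      using basis_expansion[of w] by (simp add: scalar_mult_eq_scaleR)
    then show ?thesis using that by (simp add: linear_sum linear_scale)
  qed
  have "(\<Sum>i\<in>UNIV. L1 (e i) \<bullet> L2 (e i)) =
     (\<Sum>i\<in>UNIV. \<Sum>j\<in>UNIV. \<Sum>k\<in>UNIV. (e i $ j * e i $ k) * (L1 (axis j 1) \<bullet> L2 (axis k 1)))"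
  proof (rule sum.cong[OF refl])
    fix i
    have "L1 (e i) \<bullet> L2 (e i) = (\<Sum>j\<in>UNIV. e i $ j *\<^sub>R L1 (axis j 1)) \<bullet> (\<Sum>k\<in>UNIV. e i $ k *\<^sub>R L2 (axis k 1))"
      using expand[OF assms(1)] expand[OF assms(2)] by metis
    then show "L1 (e i) \<bullet> L2 (e i) =
        (\<Sum>j\<in>UNIV. \<Sum>k\<in>UNIV. (e i $ j * e i $ k) * (L1 (axis j 1) \<bullet> L2 (axis k 1)))"
      unfolding inner_sum_left unfolding inner_sum_right by (simp add: mult_ac)
  qed
  also have "\<dots> = (\<Sum>j\<in>UNIV. \<Sum>i\<in>UNIV. \<Sum>k\<in>UNIV. (e i $ j * e i $ k) * (L1 (axis j 1) \<bullet> L2 (axis k 1)))"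
    by (rule sum.swap)
  also have "\<dots> = (\<Sum>j\<in>UNIV. \<Sum>k\<in>UNIV. \<Sum>i\<in>UNIV. (e i $ j * e i $ k) * (L1 (axis j 1) \<bullet> L2 (axis k 1)))"
    by (intro sum.cong refl sum.swap)
  finally show ?thesis by (simp add: sum_distrib_right[symmetric] metric_frame_inverse)
qed

text \<open>An orthonormal frame spans: the coefficients of \<open>w\<close> are the entries of
  \<open>(transpose E ** g) *v w\<close>.\<close>

lemma metric_frame_linear_eq_0:
  assumes L: "linear L" and z: "\<And>i. L (e i) = 0"
  shows "L w = 0"
proof -
  define E where "E = ((\<chi> j i. e i $ j) :: real ^ 'm ^ 'm)"
  define z' where "z' = (transpose E ** g) *v w"
  have "w = E *v z'"
    using metric_frame_matrix(3) by (simp add: z'_def E_def matrix_vector_mul_assoc)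
  also have "\<dots> = (\<Sum>i\<in>UNIV. z' $ i *\<^sub>R e i)"
    by (simp add: matrix_mult_sum column_def E_def scalar_mult_eq_scaleR vec_lambda_eta)
  finally have "L w = (\<Sum>i\<in>UNIV. z' $ i *\<^sub>R L (e i))" using L by (simp add: linear_sum linear_scale)
  then show ?thesis by (simp add: z)
qed

end

lemma continuous_on_det:
  fixes f :: "'a::topological_space \<Rightarrow> real ^ 'm::finite ^ 'm"
  assumes "\<And>i j. continuous_on S (\<lambda>x. f x $ i $ j)"
  shows "continuous_on S (\<lambda>x. det (f x))"
  unfolding det_def by (intro continuous_intros assms)

lemma continuous_on_metric_inverse:
  fixes f :: "'a::topological_space \<Rightarrow> real ^ 'm::finite ^ 'm"
  assumes "continuous_on S f" "\<And>x. x \<in> S \<Longrightarrow> det (f x) \<noteq> 0"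
  shows "continuous_on S (\<lambda>x. metric_inverse (f x) j k)"
proof -
  have c: "continuous_on S (\<lambda>x. f x $ a $ b)" for a b by (intro continuous_intros assms)
  have "continuous_on S (\<lambda>x. det (\<chi> a b. if b = j then axis k 1 $ a else f x $ a $ b))"
  proof (rule continuous_on_det)
    fix a b show "continuous_on S (\<lambda>x. (\<chi> a b. if b = j then axis k 1 $ a else f x $ a $ b) $ a $ b)"
      by (cases "b = j") (auto intro!: c)
  qed
  then show ?thesis unfolding metric_inverse_def
    by (rule continuous_on_divide[OF _ continuous_on_det[OF c]]) (use assms(2) in auto)
qed

locale chart_manifold =
  fixes M :: "'a::{t2_space, second_countable_topology} set"
    and A :: "('a, 'm::finite) coord_chart set"
    and G :: "('a, 'm) coord_chart \<Rightarrow> 'a \<Rightarrow> real ^ 'm ^ 'm"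
  assumes atlas: "smooth_atlas M A" and metric: "riemannian_metric A G"
begin

abbreviation chart_img :: "('a, 'm) coord_chart \<Rightarrow> (real ^ 'm) set" where
  "chart_img c \<equiv> chart_map c ` chart_dom c"

lemma chart_at: "x \<in> M \<Longrightarrow> \<exists>c\<in>A. x \<in> chart_dom c"
  using atlas unfolding smooth_atlas_def by auto

context
  fixes c assumes c: "c \<in> A"
begin

lemma chart_dom_subset: "chart_dom c \<subseteq> M"
  using atlas c unfolding smooth_atlas_def by auto

lemma chart_dom_openin: "openin (top_of_set M) (chart_dom c)"
  using atlas c unfolding smooth_atlas_def by auto

lemma open_chart_img: "open (chart_img c)"
  using atlas c unfolding smooth_atlas_def by auto

lemma chart_homeomorphism: "homeomorphism (chart_dom c) (chart_img c) (chart_map c) (chart_inv c)"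
  using atlas c unfolding smooth_atlas_def by auto

lemma chart_inv_map: "x \<in> chart_dom c \<Longrightarrow> chart_inv c (chart_map c x) = x"
  using chart_homeomorphism homeomorphism_apply1 by blast

lemma chart_map_inv: "y \<in> chart_img c \<Longrightarrow> chart_map c (chart_inv c y) = y"
  using chart_homeomorphism homeomorphism_apply2 by blast

lemma chart_inv_in: "y \<in> chart_img c \<Longrightarrow> chart_inv c y \<in> chart_dom c"
  using chart_inv_map by auto

lemma continuous_on_chart_map: "continuous_on (chart_dom c) (chart_map c)"
  using chart_homeomorphism homeomorphism_cont1 by blast

lemma continuous_on_chart_inv: "continuous_on (chart_img c) (chart_inv c)"
  using chart_homeomorphism homeomorphism_cont2 by blast

lemma metric_frame_at:
  assumes "x \<in> chart_dom c"
  obtains e where "metric_frame (G c x) e"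
proof -
  have "transpose (G c x) = G c x" "\<And>v. v \<noteq> 0 \<Longrightarrow> v \<bullet> (G c x *v v) > 0"
    using metric c assms unfolding riemannian_metric_def by blast+
  then show thesis using metric_frame_exists that by blast
qed

lemma metric_det_pos: "x \<in> chart_dom c \<Longrightarrow> det (G c x) > 0"
  using metric_frame_at metric_frame_det by metis

lemma continuous_on_metric: "continuous_on (chart_dom c) (G c)"
proof -
  have "continuous_on (chart_img c) (\<lambda>y. G c (chart_inv c y))"
    using metric c smooth_on_continuous_on unfolding riemannian_metric_def by blast
  then have "continuous_on (chart_dom c) (\<lambda>x. G c (chart_inv c (chart_map c x)))"
    by (rule continuous_on_compose2[OF _ continuous_on_chart_map]) auto
  then show ?thesis by (rule continuous_on_eq) (simp add: chart_inv_map)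
qed

lemma openin_chart_map_image:
  assumes "openin (top_of_set M) O'"
  shows "open (chart_map c ` (chart_dom c \<inter> O'))"
proof -
  have "openin (top_of_set (chart_dom c)) (chart_dom c \<inter> O')"
  proof -
    obtain U where "open U" "O' = M \<inter> U" using assms openin_open by blast
    then have "chart_dom c \<inter> O' = chart_dom c \<inter> U" using chart_dom_subset by blast
    then show ?thesis using \<open>open U\<close> openin_open by blast
  qed
  from homeomorphism_imp_open_map[OF chart_homeomorphism this]
  show ?thesis using open_chart_img openin_open_trans by blast
qed

lemma openin_chart_inv_image:
  assumes "open U" "U \<subseteq> chart_img c"
  shows "openin (top_of_set M) (chart_inv c ` U)"
proof -
  have "openin (top_of_set (chart_img c)) U" using assms open_subset by blast
  from homeomorphism_imp_open_map[OF homeomorphism_symD[OF chart_homeomorphism] this]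
  show ?thesis using chart_dom_openin openin_trans by blast
qed

end

lemma transition_props:
  assumes "c \<in> A" "d \<in> A"
  shows "open (chart_map c ` (chart_dom c \<inter> chart_dom d))"
    "smooth_on (chart_map c ` (chart_dom c \<inter> chart_dom d)) (transition c d)"
    "\<And>x. x \<in> chart_dom c \<Longrightarrow> transition c d (chart_map c x) = chart_map d x"
  using openin_chart_map_image[OF assms(1) chart_dom_openin[OF assms(2)]] atlas assms
  unfolding smooth_atlas_def by (auto simp: transition_def chart_inv_map)

section \<open>Derivatives in the chosen chart and frame\<close>

text \<open>Together with \<open>frame_of\<close>, this names the choices made inside
  \<open>hs_norm_sq\<close>, so that the comparison with \<open>hs_inner\<close> is mere
  unfolding.\<close>

definition chart_of :: "'a \<Rightarrow> ('a, 'm) coord_chart" where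
  "chart_of x = (SOME c. c \<in> A \<and> x \<in> chart_dom c)"

definition frame_of :: "'a \<Rightarrow> 'm \<Rightarrow> real ^ 'm" where
  "frame_of x = (SOME e. metric_frame (G (chart_of x) x) e)"

definition frame_deriv :: "('a \<Rightarrow> 'e::euclidean_space) \<Rightarrow> 'a \<Rightarrow> 'm \<Rightarrow> 'e" where
  "frame_deriv F x i = frechet_derivative (F \<circ> chart_inv (chart_of x)) (at (chart_map (chart_of x) x)) (frame_of x i)"

text \<open>Polarisation of \<open>hs_norm_sq\<close>. At a given point all maps are evaluated in
  one and the same frame, which makes it symmetric, and bilinear on differentiable maps.\<close>

definition hs_inner :: "('a \<Rightarrow> 'e::euclidean_space) \<Rightarrow> ('a \<Rightarrow> 'e) \<Rightarrow> 'a \<Rightarrow> real" where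
  "hs_inner F F' x = (\<Sum>i\<in>UNIV. frame_deriv F x i \<bullet> frame_deriv F' x i)"

lemma hs_norm_sq_eq: "hs_norm_sq A G F x = hs_inner F F x"
  by (simp add: hs_norm_sq_def hs_inner_def frame_deriv_def chart_of_def frame_of_def metric_frame_def
      Let_def dot_square_norm)

lemma hs_inner_commute: "hs_inner F F' x = hs_inner F' F x"
  by (simp add: hs_inner_def inner_commute)

lemma chart_of: "x \<in> M \<Longrightarrow> chart_of x \<in> A \<and> x \<in> chart_dom (chart_of x)"
  unfolding chart_of_def by (rule someI_ex) (use chart_at in blast)

lemma frame_of: "x \<in> M \<Longrightarrow> metric_frame (G (chart_of x) x) (frame_of x)"
  unfolding frame_of_def using metric_frame_at chart_of by (metis someI_ex)

text \<open>Without this condition \<open>frechet_derivative\<close> has an unspecified value. All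
  charts around \<open>x\<close> are included, so that a change of chart costs no further
  hypothesis.\<close>

definition diff_at :: "('a \<Rightarrow> 'e::euclidean_space) \<Rightarrow> 'a \<Rightarrow> bool" where
  "diff_at F x \<longleftrightarrow> (\<forall>c\<in>A. x \<in> chart_dom c \<longrightarrow> (F \<circ> chart_inv c) differentiable (at (chart_map c x)))"

text \<open>The Jacobian of the transition map carries the chosen frame to a frame that is
  orthonormal in the other chart, by the transformation rule of the metric. The frame is obtained
  before the map \<open>F\<close>, so it serves several maps at once.\<close>

lemma frame_deriv_in_chart:
  assumes x: "x \<in> M" and d: "d \<in> A" "x \<in> chart_dom d"
  obtains e where "metric_frame (G d x) e"
    "\<And>F :: 'a \<Rightarrow> 'e::euclidean_space. \<And>i. diff_at F x \<Longrightarrow>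
      frame_deriv F x i = frechet_derivative (F \<circ> chart_inv d) (at (chart_map d x)) (e i)"
proof -
  define c where "c = chart_of x"
  have c: "c \<in> A" "x \<in> chart_dom c" using chart_of[OF x] by (auto simp: c_def)
  define J where "J = jacobian c d x"
  let ?V = "chart_map c ` (chart_dom c \<inter> chart_dom d)"
  have xV: "chart_map c x \<in> ?V" using c d by auto
  note tr = transition_props[OF c(1) d(1)]
  have Gt: "G c x = transpose J ** G d x ** J"
    using metric c d unfolding riemannian_metric_def J_def by blast
  have dt: "transition c d differentiable (at (chart_map c x))"
    using smooth_on_differentiable[OF tr(2) xV] .
  have J: "J *v v = frechet_derivative (transition c d) (at (chart_map c x)) v" for v
    unfolding J_def jacobian_def by (rule fun_cong[OF matrix_vector_mul(2)[OF linear_frechet_derivative[OF dt]]])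
  have fr: "metric_frame (G c x) (frame_of x)" using frame_of[OF x] by (simp add: c_def)
  have "(J *v a) \<bullet> (G d x *v (J *v b)) = a \<bullet> (G c x *v b)" for a b
    unfolding Gt using dot_lmul_matrix[of a "transpose J" "G d x *v (J *v b)"]
    by (simp add: matrix_vector_mul_assoc[symmetric] matrix_mul_assoc)
  then have 1: "metric_frame (G d x) (\<lambda>i. J *v frame_of x i)"
    using fr by (simp add: metric_frame_def)
  show thesis
  proof (rule that[OF 1])
    fix F :: "'a \<Rightarrow> 'e" and i assume F: "diff_at F x"
    have dF: "(F \<circ> chart_inv d) differentiable (at (transition c d (chart_map c x)))"
      using F d tr(3)[OF c(2)] by (simp add: diff_at_def)
    have dFc: "(F \<circ> chart_inv c) differentiable (at (chart_map c x))"
      using F c by (simp add: diff_at_def)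
    have "frechet_derivative (F \<circ> chart_inv c) (at (chart_map c x)) =
       frechet_derivative (\<lambda>y. (F \<circ> chart_inv d) (transition c d y)) (at (chart_map c x))"
      by (rule frechet_derivative_transform_within_open[OF dFc tr(1) xV])
        (auto simp: transition_def chart_inv_map[OF c(1)] chart_inv_map[OF d(1)])
    then show "frame_deriv F x i = frechet_derivative (F \<circ> chart_inv d) (at (chart_map d x)) (J *v frame_of x i)"
      unfolding frame_deriv_def c_def[symmetric] J
      using frechet_derivative_chain[OF dF dt] tr(3)[OF c(2)] by simp
  qed
qed

lemma hs_inner_in_chart:
  fixes F F' :: "'a \<Rightarrow> 'e::euclidean_space"
  assumes x: "x \<in> M" and d: "d \<in> A" "x \<in> chart_dom d" and F: "diff_at F x" "diff_at F' x"
  shows "hs_inner F F' x = (\<Sum>j\<in>UNIV. \<Sum>k\<in>UNIV. metric_inverse (G d x) j k *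
    (frechet_derivative (F \<circ> chart_inv d) (at (chart_map d x)) (axis j 1) \<bullet>
     frechet_derivative (F' \<circ> chart_inv d) (at (chart_map d x)) (axis k 1)))"
proof -
  obtain e where e: "metric_frame (G d x) e" "\<And>F :: 'a \<Rightarrow> 'e. \<And>i. diff_at F x \<Longrightarrow>
      frame_deriv F x i = frechet_derivative (F \<circ> chart_inv d) (at (chart_map d x)) (e i)"
    by (rule frame_deriv_in_chart[OF x d]) blast
  have "linear (frechet_derivative (F \<circ> chart_inv d) (at (chart_map d x)))"
    "linear (frechet_derivative (F' \<circ> chart_inv d) (at (chart_map d x)))"
    using F d unfolding diff_at_def by (blast intro: linear_frechet_derivative)+
  from metric_frame_inner_sum[OF e(1) this] show ?thesis
    by (simp add: hs_inner_def e(2) F)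
qed

lemma smooth_from_diff_at: "smooth_from A F \<Longrightarrow> diff_at F x"
  unfolding smooth_from_def diff_at_def using smooth_on_differentiable by (metis imageI)

section \<open>Smooth families of maps\<close>

definition smooth_family :: "'p::euclidean_space set \<Rightarrow> ('p \<Rightarrow> 'a \<Rightarrow> 'e::euclidean_space) \<Rightarrow> bool" where
  "smooth_family B \<Psi> \<longleftrightarrow> (\<forall>c\<in>A. smooth_on (B \<times> chart_img c) (\<lambda>(p, y). \<Psi> p (chart_inv c y)))"

lemma smooth_family_subset: "smooth_family B \<Psi> \<Longrightarrow> B' \<subseteq> B \<Longrightarrow> smooth_family B' \<Psi>"
  unfolding smooth_family_def by (blast intro: smooth_on_subset)

lemma smooth_family_const: "open B \<Longrightarrow> smooth_from A F \<Longrightarrow> smooth_family B (\<lambda>p. F)"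
  unfolding smooth_family_def
proof
  fix c assume B: "open B" and F: "smooth_from A F" and c: "c \<in> A"
  have o: "open (B \<times> chart_img c)" by (intro open_Times B open_chart_img c)
  have "smooth_on (chart_img c) (F \<circ> chart_inv c)" using F c unfolding smooth_from_def by blast
  from smooth_on_compose[OF this smooth_on_snd[OF smooth_on_id o] _ o]
  have "smooth_on (B \<times> chart_img c) (\<lambda>z. (F \<circ> chart_inv c) (snd z))" by force
  then show "smooth_on (B \<times> chart_img c) (\<lambda>(p, y). F (chart_inv c y))"
    by (simp add: case_prod_beta')
qed

lemma smooth_family_smooth_from:
  assumes "smooth_family B \<Psi>" "p \<in> B"
  shows "smooth_from A (\<Psi> p)"
  unfolding smooth_from_def
proof
  fix c assume c: "c \<in> A"
  have "smooth_on (chart_img c) (\<lambda>y. (\<lambda>(p, y). \<Psi> p (chart_inv c y)) (p, y))"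
    by (rule smooth_on_compose[where T = "B \<times> chart_img c"])
      (use assms c in \<open>auto simp: smooth_family_def intro!: smooth_intros open_chart_img\<close>)
  then show "smooth_on (chart_img c) (\<Psi> p \<circ> chart_inv c)" by (simp add: o_def)
qed

lemma has_derivative_Pair_const:
  "((\<lambda>y. (p, y)) has_derivative (\<lambda>w. (0, w))) (at y)" "((\<lambda>p. (p, y)) has_derivative (\<lambda>v. (v, 0))) (at p)"
  by (auto intro!: derivative_eq_intros)

lemma partial_frechet_derivative:
  assumes "f differentiable (at (p, y))"
  shows "((\<lambda>y. f (p, y)) has_derivative (\<lambda>w. frechet_derivative f (at (p, y)) (0, w))) (at y)"
    "((\<lambda>p. f (p, y)) has_derivative (\<lambda>v. frechet_derivative f (at (p, y)) (v, 0))) (at p)"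
  using diff_chain_at[OF has_derivative_Pair_const(1)[of p y], of f] diff_chain_at[OF has_derivative_Pair_const(2)[of y p], of f]
    assms by (auto simp: frechet_derivative_works o_def)

definition param_deriv :: "'p::euclidean_space \<Rightarrow> ('p \<Rightarrow> 'a \<Rightarrow> 'e::euclidean_space) \<Rightarrow> 'p \<Rightarrow> 'a \<Rightarrow> 'e" where
  "param_deriv v \<Psi> p x = frechet_derivative (\<lambda>p. \<Psi> p x) (at p) v"

context
  fixes B :: "'p::euclidean_space set" and \<Psi> :: "'p \<Rightarrow> 'a \<Rightarrow> 'e::euclidean_space"
  assumes B: "open B" and fam: "smooth_family B \<Psi>"
begin

lemma smooth_family_chart: "c \<in> A \<Longrightarrow> smooth_on (B \<times> chart_img c) (\<lambda>(p, y). \<Psi> p (chart_inv c y))"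
  using fam by (simp add: smooth_family_def)

lemma smooth_family_diff_at: "p \<in> B \<Longrightarrow> diff_at (\<Psi> p) x"
  using smooth_from_diff_at smooth_family_smooth_from[OF fam] by blast

lemma smooth_family_param:
  assumes "c \<in> A" "p \<in> B" "y \<in> chart_img c"
  shows "((\<lambda>p. \<Psi> p (chart_inv c y)) has_derivative
      (\<lambda>v. frechet_derivative (\<lambda>(p, y). \<Psi> p (chart_inv c y)) (at (p, y)) (v, 0))) (at p)"
    "((\<Psi> p \<circ> chart_inv c) has_derivative
      (\<lambda>w. frechet_derivative (\<lambda>(p, y). \<Psi> p (chart_inv c y)) (at (p, y)) (0, w))) (at y)"
  using partial_frechet_derivative[of "\<lambda>(p, y). \<Psi> p (chart_inv c y)" p y]
    smooth_on_differentiable[OF smooth_family_chart[OF assms(1)], of "(p, y)"] assms(2,3)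
  by (auto simp: o_def)

lemma param_deriv_chart:
  assumes "c \<in> A" "p \<in> B" "y \<in> chart_img c"
  shows "param_deriv v \<Psi> p (chart_inv c y) =
    frechet_derivative (\<lambda>(p, y). \<Psi> p (chart_inv c y)) (at (p, y)) (v, 0)"
  unfolding param_deriv_def using frechet_derivative_at[OF smooth_family_param(1)[OF assms]] by metis

lemma param_has_derivative:
  assumes "x \<in> M" "p \<in> B"
  shows "((\<lambda>p. \<Psi> p x) has_derivative (\<lambda>v. param_deriv v \<Psi> p x)) (at p)"
proof -
  obtain c where c: "c \<in> A" "x \<in> chart_dom c" using chart_at assms by blast
  then have "chart_map c x \<in> chart_img c" by simp
  from smooth_family_param(1)[OF c(1) assms(2) this] param_deriv_chart[OF c(1) assms(2) this]
  show ?thesis by (simp add: chart_inv_map[OF c])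
qed

lemma smooth_family_param_deriv: "smooth_family B (param_deriv v \<Psi>)"
  unfolding smooth_family_def
proof
  fix c assume c: "c \<in> A"
  have o: "open (B \<times> chart_img c)" by (intro open_Times B open_chart_img c)
  show "smooth_on (B \<times> chart_img c) (\<lambda>(p, y). param_deriv v \<Psi> p (chart_inv c y))"
    by (rule smooth_on_cong[OF o smooth_on_frechet_derivative_const[OF smooth_family_chart[OF c]]])
      (auto simp: param_deriv_chart[OF c])
qed

text \<open>Chart and frame at \<open>x\<close> do not move with the parameter, so this is the
  symmetry of the second derivatives of the joint representation in the directions
  \<open>(v, 0)\<close> and \<open>(0, e)\<close>.\<close>

lemma frame_deriv_has_derivative:
  assumes x: "x \<in> M" and p: "p \<in> B"
  shows "((\<lambda>p. frame_deriv (\<Psi> p) x i) has_derivative (\<lambda>v. frame_deriv (param_deriv v \<Psi> p) x i)) (at p)"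
proof -
  define c where "c = chart_of x"
  have c: "c \<in> A" "x \<in> chart_dom c" using chart_of[OF x] by (auto simp: c_def)
  define y where "y = chart_map c x"
  have y: "y \<in> chart_img c" using c by (simp add: y_def)
  define e where "e = frame_of x i"
  let ?f = "\<lambda>(p, y). \<Psi> p (chart_inv c y)"
  have o: "open (B \<times> chart_img c)" by (intro open_Times B open_chart_img c)
  note sm = smooth_family_chart[OF c(1)]
  have fd: "frame_deriv (\<Psi> p) x i = frechet_derivative ?f (at (p, y)) (0, e)" if "p \<in> B" for p
    unfolding frame_deriv_def c_def[symmetric] y_def[symmetric] e_def[symmetric]
    using frechet_derivative_at[OF smooth_family_param(2)[OF c(1) that y]] by metis
  have py: "(p, y) \<in> B \<times> chart_img c" using p y by simp
  have fd': "frame_deriv (param_deriv v \<Psi> p) x i =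
      frechet_derivative (\<lambda>z. frechet_derivative ?f (at z) (v, 0)) (at (p, y)) (0, e)" for v
  proof -
    let ?h = "\<lambda>z. frechet_derivative ?f (at z) (v, 0)"
    have 1: "((\<lambda>y. ?h (p, y)) has_derivative (\<lambda>w. frechet_derivative ?h (at (p, y)) (0, w))) (at y)"
      by (rule partial_frechet_derivative(1)[OF smooth_on_differentiable[OF smooth_on_frechet_derivative_const[OF sm] py]])
    have "((param_deriv v \<Psi> p \<circ> chart_inv c) has_derivative (\<lambda>w. frechet_derivative ?h (at (p, y)) (0, w))) (at y)"
      by (rule has_derivative_transform_within_open[OF 1 open_chart_img[OF c(1)] y])
        (simp add: param_deriv_chart[OF c(1) p])
    from frechet_derivative_at[OF this] show ?thesis
      unfolding frame_deriv_def c_def[symmetric] y_def[symmetric] e_def[symmetric] by metis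
  qed
  let ?g = "\<lambda>z. frechet_derivative ?f (at z) (0, e)"
  have "((\<lambda>p. ?g (p, y)) has_derivative (\<lambda>v. frechet_derivative ?g (at (p, y)) (v, 0))) (at p)"
    by (rule partial_frechet_derivative(2)[OF smooth_on_differentiable[OF smooth_on_frechet_derivative_const[OF sm] py]])
  moreover have "frechet_derivative ?g (at (p, y)) (v, 0) = frame_deriv (param_deriv v \<Psi> p) x i" for v
    unfolding fd' by (rule frechet_derivative_symmetric[OF o sm py])
  ultimately have "((\<lambda>p. ?g (p, y)) has_derivative (\<lambda>v. frame_deriv (param_deriv v \<Psi> p) x i)) (at p)" by simp
  then show ?thesis
    by (rule has_derivative_transform_within_open[OF _ B p]) (simp add: fd)
qed

end

lemma hs_inner_has_derivative:
  assumes "open B" "smooth_family B \<Phi>" "smooth_family B \<Psi>" "x \<in> M" "p \<in> B"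
  shows "((\<lambda>p. hs_inner (\<Phi> p) (\<Psi> p) x) has_derivative
    (\<lambda>v. hs_inner (\<Phi> p) (param_deriv v \<Psi> p) x + hs_inner (param_deriv v \<Phi> p) (\<Psi> p) x)) (at p)"
proof -
  have "((\<lambda>p. hs_inner (\<Phi> p) (\<Psi> p) x) has_derivative
    (\<lambda>v. \<Sum>i\<in>UNIV. frame_deriv (\<Phi> p) x i \<bullet> frame_deriv (param_deriv v \<Psi> p) x i +
       frame_deriv (param_deriv v \<Phi> p) x i \<bullet> frame_deriv (\<Psi> p) x i)) (at p)"
    unfolding hs_inner_def
    by (intro has_derivative_sum has_derivative_inner frame_deriv_has_derivative[OF assms(1)] assms)
  then show ?thesis by (simp add: hs_inner_def sum.distrib)
qed

lemma continuous_on_chartwise: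
  fixes B :: "'p::t2_space set" and f :: "'p \<times> 'a \<Rightarrow> 'b::topological_space"
  assumes "\<And>c. c \<in> A \<Longrightarrow> continuous_on (B \<times> chart_dom c) f"
  shows "continuous_on (B \<times> M) f"
  unfolding continuous_on_eq_continuous_within[of "B \<times> M"]
proof
  fix z assume z: "z \<in> B \<times> M"
  obtain c where c: "c \<in> A" "snd z \<in> chart_dom c" using chart_at z by (metis mem_Times_iff)
  obtain O' where O': "open O'" "chart_dom c = M \<inter> O'" using chart_dom_openin[OF c(1)] openin_open by blast
  have "continuous (at z within B \<times> chart_dom c) f"
    using assms[OF c(1)] z c(2) unfolding continuous_on_eq_continuous_within by (cases z) auto
  moreover have "at z within B \<times> chart_dom c = at z within B \<times> M"
    by (rule at_within_nhd[where S = "UNIV \<times> O'"]) (use z c O' in \<open>auto simp: open_Times mem_Times_iff\<close>)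
  ultimately show "continuous (at z within B \<times> M) f" by simp
qed

lemma continuous_on_chart_map_prod:
  assumes "c \<in> A" "continuous_on (B \<times> chart_img c) f"
  shows "continuous_on (B \<times> chart_dom c) (\<lambda>z. f (fst z, chart_map c (snd z)))"
  by (rule continuous_on_compose2[OF assms(2)])
     (auto intro!: continuous_intros continuous_on_compose2[OF continuous_on_chart_map[OF assms(1)]])

lemma smooth_family_continuous:
  assumes "smooth_family B \<Psi>"
  shows "continuous_on (B \<times> M) (\<lambda>z. \<Psi> (fst z) (snd z))"
proof (rule continuous_on_chartwise)
  fix c assume c: "c \<in> A"
  have "continuous_on (B \<times> chart_img c) (\<lambda>(p, y). \<Psi> p (chart_inv c y))"
    using assms c smooth_on_continuous_on unfolding smooth_family_def by blast
  from continuous_on_chart_map_prod[OF c this]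
  show "continuous_on (B \<times> chart_dom c) (\<lambda>z. \<Psi> (fst z) (snd z))"
    by (rule continuous_on_eq) (auto simp: chart_inv_map[OF c])
qed

text \<open>The chosen chart and frame may jump from point to point. Over a fixed chart the sum is
  rewritten with the inverse metric matrix and coordinate derivatives, all of which are
  continuous.\<close>

lemma hs_inner_continuous:
  assumes B: "open B" and fam: "smooth_family B \<Phi>" "smooth_family B \<Psi>"
  shows "continuous_on (B \<times> M) (\<lambda>z. hs_inner (\<Phi> (fst z)) (\<Psi> (fst z)) (snd z))"
proof (rule continuous_on_chartwise)
  fix c assume c: "c \<in> A"
  let ?D = "\<lambda>\<Psi> w z. frechet_derivative (\<lambda>(p, y). \<Psi> p (chart_inv c y)) (at z) (0, w)"
  let ?H = "\<lambda>z. \<Sum>j\<in>UNIV. \<Sum>k\<in>UNIV. metric_inverse (G c (snd z)) j k *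
    (?D \<Phi> (axis j 1) (fst z, chart_map c (snd z)) \<bullet> ?D \<Psi> (axis k 1) (fst z, chart_map c (snd z)))"
  have D: "continuous_on (B \<times> chart_dom c) (\<lambda>z. ?D \<Psi> w (fst z, chart_map c (snd z)))"
    if "smooth_family B \<Psi>" for \<Psi> w
    by (rule continuous_on_chart_map_prod[OF c smooth_on_continuous_on[OF smooth_on_frechet_derivative_const]])
      (use that c in \<open>simp add: smooth_family_def\<close>)
  have cG: "continuous_on (B \<times> chart_dom c) (\<lambda>z. G c (snd z))"
    by (rule continuous_on_compose2[OF continuous_on_metric[OF c]]) (auto intro!: continuous_intros)
  have det: "det (G c (snd z)) \<noteq> 0" if "z \<in> B \<times> chart_dom c" for z
    using metric_det_pos[OF c, of "snd z"] that by auto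
  have "continuous_on (B \<times> chart_dom c) ?H"
    by (intro continuous_on_sum continuous_on_mult continuous_on_inner D fam
        continuous_on_metric_inverse cG det)
  then show "continuous_on (B \<times> chart_dom c) (\<lambda>z. hs_inner (\<Phi> (fst z)) (\<Psi> (fst z)) (snd z))"
  proof (rule continuous_on_eq)
    fix z assume z: "z \<in> B \<times> chart_dom c"
    obtain p x where px: "z = (p, x)" "p \<in> B" "x \<in> chart_dom c" using z by auto
    have y: "chart_map c x \<in> chart_img c" using px by simp
    have x: "x \<in> M" using px chart_dom_subset[OF c] by blast
    have fd: "frechet_derivative (\<Psi> p \<circ> chart_inv c) (at (chart_map c x)) w = ?D \<Psi> w (p, chart_map c x)"
      if "smooth_family B \<Psi>" for \<Psi> w
      using frechet_derivative_at[OF smooth_family_param(2)[OF B that c px(2) y]] by metis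
    show "?H z = hs_inner (\<Phi> (fst z)) (\<Psi> (fst z)) (snd z)"
      unfolding px fst_conv snd_conv
        hs_inner_in_chart[OF x c px(3) smooth_family_diff_at[OF B fam(1) px(2)] smooth_family_diff_at[OF B fam(2) px(2)]]
        fd[OF fam(1)] fd[OF fam(2)] ..
  qed
qed

lemma frame_deriv_cong:
  assumes "x \<in> M" "diff_at F x" "\<And>y. y \<in> M \<Longrightarrow> F y = F' y"
  shows "frame_deriv F x i = frame_deriv F' x i"
proof -
  note c = chart_of[OF assms(1)]
  have "frechet_derivative (F \<circ> chart_inv (chart_of x)) (at (chart_map (chart_of x) x)) =
      frechet_derivative (F' \<circ> chart_inv (chart_of x)) (at (chart_map (chart_of x) x))"
  proof (rule frechet_derivative_transform_within_open[OF _ open_chart_img])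
    show "(F \<circ> chart_inv (chart_of x)) differentiable (at (chart_map (chart_of x) x))"
      using assms(2) c by (simp add: diff_at_def)
    fix y assume "y \<in> chart_img (chart_of x)"
    then have "chart_inv (chart_of x) y \<in> M" using chart_inv_in chart_dom_subset c by blast
    then show "(F \<circ> chart_inv (chart_of x)) y = (F' \<circ> chart_inv (chart_of x)) y" using assms(3) by simp
  qed (use c in auto)
  then show ?thesis by (simp add: frame_deriv_def)
qed

text \<open>A frame spans, so the full differential vanishes and the map is constant on coordinate
  balls; connectedness does the rest.\<close>

lemma frame_deriv_zero_imp_constant:
  assumes F: "smooth_from A F" and con: "connected M"
    and zero: "\<And>x i. x \<in> M \<Longrightarrow> frame_deriv F x i = 0"
  shows "F constant_on M"
proof (rule locally_constant_imp_constant[OF con])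
  fix a assume a: "a \<in> M"
  obtain c where c: "c \<in> A" "a \<in> chart_dom c" using chart_at a by blast
  have "chart_map c a \<in> chart_img c" using c by simp
  then obtain r where r: "r > 0" "ball (chart_map c a) r \<subseteq> chart_img c"
    using open_chart_img[OF c(1)] open_contains_ball by blast
  have "((F \<circ> chart_inv c) has_derivative (\<lambda>h. 0)) (at y within ball (chart_map c a) r)"
    if y: "y \<in> ball (chart_map c a) r" for y
  proof -
    have yi: "y \<in> chart_img c" using y r by blast
    let ?x = "chart_inv c y"
    have x: "?x \<in> chart_dom c" "?x \<in> M" "chart_map c ?x = y"
      using chart_inv_in[OF c(1) yi] chart_dom_subset[OF c(1)] chart_map_inv[OF c(1) yi] by auto
    have d: "(F \<circ> chart_inv c) differentiable (at y)"
      using F c(1) yi smooth_on_differentiable unfolding smooth_from_def by blast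
    obtain e where e: "metric_frame (G c ?x) e" "\<And>F :: 'a \<Rightarrow> 'b. \<And>i. diff_at F ?x \<Longrightarrow>
        frame_deriv F ?x i = frechet_derivative (F \<circ> chart_inv c) (at (chart_map c ?x)) (e i)"
      by (rule frame_deriv_in_chart[OF x(2) c(1) x(1)]) blast
    have "frechet_derivative (F \<circ> chart_inv c) (at y) (e i) = 0" for i
      using e(2)[OF smooth_from_diff_at[OF F], of i] zero[OF x(2)] x(3) by simp
    then have "frechet_derivative (F \<circ> chart_inv c) (at y) w = 0" for w
      by (rule metric_frame_linear_eq_0[OF e(1) linear_frechet_derivative[OF d]])
    then have "frechet_derivative (F \<circ> chart_inv c) (at y) = (\<lambda>h. 0)" by blast
    then have "((F \<circ> chart_inv c) has_derivative (\<lambda>h. 0)) (at y)"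
      using d unfolding frechet_derivative_works by simp
    then show ?thesis by (rule has_derivative_at_withinI)
  qed
  then obtain k where k: "\<And>y. y \<in> ball (chart_map c a) r \<Longrightarrow> (F \<circ> chart_inv c) y = k"
    using has_derivative_zero_constant[OF convex_ball, of "chart_map c a" r "F \<circ> chart_inv c"] by auto
  let ?T = "chart_inv c ` ball (chart_map c a) r"
  have "openin (top_of_set M) ?T" by (rule openin_chart_inv_image[OF c(1) open_ball r(2)])
  moreover have "a \<in> ?T" using chart_inv_map[OF c] r(1) by (metis centre_in_ball imageI)
  ultimately show "\<exists>T. openin (top_of_set M) T \<and> a \<in> T \<and> (\<forall>x\<in>T. F x = F a)"
    using k by (intro exI[of _ ?T]) auto
qed

end

section \<open>The Riemannian measure\<close>

locale compact_chart_manifold = chart_manifold M A G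
  for M :: "'a::{t2_space, second_countable_topology} set"
    and A :: "('a, 'm::finite) coord_chart set"
    and G :: "('a, 'm) coord_chart \<Rightarrow> 'a \<Rightarrow> real ^ 'm ^ 'm" +
  assumes compact: "compact M"
begin

abbreviation borelM :: "'a measure" where
  "borelM \<equiv> restrict_space borel M"

abbreviation vol :: "'a measure" where
  "vol \<equiv> riemannian_measure M A G"

lemma M_borel: "M \<in> sets borel"
  by (rule borel_closed[OF compact_imp_closed[OF compact]])

lemma sets_borelM: "S \<in> sets borelM \<longleftrightarrow> S \<subseteq> M \<and> S \<in> sets borel"
  using sets_restrict_space_iff[of M borel S] M_borel by simp

text \<open>Compactness gives finitely many closed coordinate balls that cover \<open>M\<close>;
  making them disjoint one after the other leaves Borel pieces, each still inside its compact
  ball.\<close>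

lemma chart_partition_exists: "\<exists>P. chart_partition M A P"
proof -
  have loc: "\<exists>c K U. c \<in> A \<and> compact K \<and> K \<subseteq> chart_dom c \<and> open U \<and> x \<in> U \<and> M \<inter> U \<subseteq> K" if x: "x \<in> M" for x
  proof -
    obtain c where c: "c \<in> A" "x \<in> chart_dom c" using chart_at x by blast
    then have "chart_map c x \<in> chart_img c" by simp
    then obtain r where r: "r > 0" "cball (chart_map c x) r \<subseteq> chart_img c"
      using open_chart_img[OF c(1)] open_contains_cball by blast
    let ?K = "chart_inv c ` cball (chart_map c x) r" and ?O = "chart_inv c ` ball (chart_map c x) r"
    have "?O \<subseteq> ?K" by (intro image_mono ball_subset_cball)
    have "openin (top_of_set M) ?O"
      by (rule openin_chart_inv_image[OF c(1) open_ball]) (use r ball_subset_cball in blast)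
    then obtain U where U: "open U" "?O = M \<inter> U" using openin_open by blast
    have "compact ?K"
      by (rule compact_continuous_image[OF continuous_on_subset[OF continuous_on_chart_inv[OF c(1)] r(2)] compact_cball])
    moreover have "?K \<subseteq> chart_dom c" using r(2) chart_inv_in[OF c(1)] by blast
    moreover have "x \<in> ?O" using chart_inv_map[OF c] r(1) by (metis centre_in_ball imageI)
    ultimately show ?thesis using c(1) U \<open>?O \<subseteq> ?K\<close> by (intro exI[of _ c] exI[of _ ?K] exI[of _ U]) auto
  qed
  obtain c K U where cKU: "\<And>x. x \<in> M \<Longrightarrow> c x \<in> A" "\<And>x. x \<in> M \<Longrightarrow> compact (K x)"
    "\<And>x. x \<in> M \<Longrightarrow> K x \<subseteq> chart_dom (c x)" "\<And>x. x \<in> M \<Longrightarrow> open (U x)" "\<And>x. x \<in> M \<Longrightarrow> x \<in> U x"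
    "\<And>x. x \<in> M \<Longrightarrow> M \<inter> U x \<subseteq> K x"
  proof -
    assume *: thesis if "\<And>x. x \<in> M \<Longrightarrow> c x \<in> A" "\<And>x. x \<in> M \<Longrightarrow> compact (K x)"
      "\<And>x. x \<in> M \<Longrightarrow> K x \<subseteq> chart_dom (c x)" "\<And>x. x \<in> M \<Longrightarrow> open (U x)"
      "\<And>x. x \<in> M \<Longrightarrow> x \<in> U x" "\<And>x. x \<in> M \<Longrightarrow> M \<inter> U x \<subseteq> K x" for c K U
    \<comment> \<open>Chart, compact set and neighbourhood are bundled into one tuple, so that
      choice is applied only once.\<close>
    have "\<forall>x. \<exists>P. x \<in> M \<longrightarrow> fst P \<in> A \<and> compact (fst (snd P)) \<and> fst (snd P) \<subseteq> chart_dom (fst P) \<and>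
        open (snd (snd P)) \<and> x \<in> snd (snd P) \<and> M \<inter> snd (snd P) \<subseteq> fst (snd P)"
      using loc by (metis fst_conv snd_conv)
    then obtain P where P: "\<forall>x. x \<in> M \<longrightarrow> fst (P x) \<in> A \<and> compact (fst (snd (P x))) \<and>
        fst (snd (P x)) \<subseteq> chart_dom (fst (P x)) \<and> open (snd (snd (P x))) \<and> x \<in> snd (snd (P x)) \<and>
        M \<inter> snd (snd (P x)) \<subseteq> fst (snd (P x))"
      unfolding choice_iff by blast
    show thesis by (rule *[of "\<lambda>x. fst (P x)" "\<lambda>x. fst (snd (P x))" "\<lambda>x. snd (snd (P x))"]) (use P in auto)
  qed
  obtain F where F: "F \<subseteq> M" "finite F" "M \<subseteq> (\<Union>x\<in>F. U x)"
    by (rule compactE_image[OF compact, of M U]) (use cKU(4,5) in auto)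
  obtain h where h: "bij_betw h {0..<card F} F" using ex_bij_betw_nat_finite[OF F(2)] by blast
  have hM: "h i \<in> M" if "i < card F" for i using bij_betwE[OF h] F(1) that by auto
  have hF: "F = h ` {0..<card F}" using h by (simp add: bij_betw_def)
  \<comment> \<open>Empty beyond the finite cover, because \<open>disjointed\<close> works on
    sequences indexed by all natural numbers.\<close>
  define E where "E i = (if i < card F then K (h i) else {})" for i
  have "K x \<subseteq> M" if "x \<in> M" for x using cKU(3)[OF that] chart_dom_subset[OF cKU(1)[OF that]] by blast
  then have sub: "E i \<subseteq> M" "E i \<in> sets borel" for i
    using hM[of i] borel_closed[OF compact_imp_closed[OF cKU(2)]] by (auto simp: E_def)
  define k where "k = card F"
  have Ek: "(\<Union>i<k. disjointed E i) = (\<Union>i<k. E i)"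
    using finite_UN_disjointed_eq[of E k] by (simp add: atLeast0LessThan)
  have "M \<subseteq> (\<Union>i<k. E i)"
  proof
    fix x assume "x \<in> M"
    then obtain z where z: "z \<in> F" "x \<in> U z" using F(3) by blast
    have "z \<in> h ` {0..<card F}" using z(1) by (subst (asm) hF)
    then obtain i where "i < card F" "x \<in> U (h i)" using z(2) by auto
    then show "x \<in> (\<Union>i<k. E i)" using cKU(6)[OF hM] \<open>x \<in> M\<close> by (auto simp: E_def k_def)
  qed
  then have U: "(\<Union>i<k. disjointed E i) = M" using Ek sub(1) by auto
  have "chart_partition M A (k, \<lambda>i. c (h i), disjointed E)"
    unfolding chart_partition_def case_prod_conv
  proof (intro conjI allI impI U)
    show "disjoint_family_on (disjointed E) {..<k}"
      using disjoint_family_disjointed[of E] by (auto simp: disjoint_family_on_def)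
    fix i assume i: "i < k"
    have d: "disjointed E i \<subseteq> E i" by (rule disjointed_subset)
    show "c (h i) \<in> A" using i cKU(1) hM by (simp add: k_def)
    have "disjointed E i \<in> sets borel" using sub(2) unfolding disjointed_def by auto
    then show "disjointed E i \<in> sets borelM" using d sub(1)[of i] sets_borelM by auto
    show "\<exists>K. compact K \<and> disjointed E i \<subseteq> K \<and> K \<subseteq> chart_dom (c (h i))"
      using i d cKU(2,3) hM by (intro exI[of _ "K (h i)"]) (auto simp: E_def k_def)
  qed
  then show ?thesis by blast
qed

definition vol_density :: "('a, 'm) coord_chart \<Rightarrow> real ^ 'm \<Rightarrow> ennreal" where
  "vol_density c y = ennreal (sqrt (det (G c (chart_inv c y))))"

lemma continuous_on_sqrt_det: "c \<in> A \<Longrightarrow> continuous_on (chart_img c) (\<lambda>y. sqrt (det (G c (chart_inv c y))))"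
proof -
  assume c: "c \<in> A"
  have "continuous_on (chart_img c) (\<lambda>y. G c (chart_inv c y))"
    using continuous_on_compose2[OF continuous_on_metric[OF c] continuous_on_chart_inv[OF c]] chart_inv_in[OF c] by auto
  then show ?thesis by (intro continuous_intros continuous_on_det)
qed

lemma measurable_restrict_lborel: "measurable (restrict_space lborel V) N = measurable (restrict_space borel V) N"
  by (rule measurable_cong_sets[OF sets_restrict_space_cong refl]) simp

lemma measurable_vol_density: "c \<in> A \<Longrightarrow> vol_density c \<in> borel_measurable (restrict_space lborel (chart_img c))"
proof -
  assume c: "c \<in> A"
  have "(\<lambda>y. sqrt (det (G c (chart_inv c y)))) \<in> borel_measurable (restrict_space borel (chart_img c))"
    by (rule borel_measurable_continuous_on_restrict[OF continuous_on_sqrt_det[OF c]])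
  then have "(\<lambda>y. sqrt (det (G c (chart_inv c y)))) \<in> borel_measurable (restrict_space lborel (chart_img c))"
    unfolding measurable_restrict_lborel .
  then show ?thesis unfolding vol_density_def[abs_def] by measurable
qed

lemma measurable_chart_inv: "c \<in> A \<Longrightarrow> chart_inv c \<in> restrict_space lborel (chart_img c) \<rightarrow>\<^sub>M borelM"
proof -
  assume c: "c \<in> A"
  have "chart_inv c \<in> borel_measurable (restrict_space borel (chart_img c))"
    by (rule borel_measurable_continuous_on_restrict[OF continuous_on_chart_inv[OF c]])
  moreover have "chart_inv c \<in> space (restrict_space borel (chart_img c)) \<rightarrow> M"
    using chart_inv_in[OF c] chart_dom_subset[OF c] by (auto simp: space_restrict_space)
  ultimately show ?thesis unfolding measurable_restrict_lborel by (rule measurable_restrict_space2[rotated])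
qed

text \<open>\<open>measure_of\<close> is guaranteed to take the intended values only for a countably
  additive set function. Realising each summand through a genuine measure, the image of a density,
  supplies that additivity.\<close>

definition chart_vol :: "('a, 'm) coord_chart \<Rightarrow> 'a measure" where
  "chart_vol c = distr (density (restrict_space lborel (chart_img c)) (vol_density c)) borelM (chart_inv c)"

lemma emeasure_chart_vol:
  assumes c: "c \<in> A" and S: "S \<in> sets borelM" "S \<subseteq> chart_dom c"
  shows "emeasure (chart_vol c) S = (\<integral>\<^sup>+ y \<in> chart_map c ` S. vol_density c y \<partial>lborel)"
    "chart_map c ` S \<in> sets lborel"
proof -
  let ?V = "chart_img c" and ?L = "restrict_space lborel (chart_img c)"
  note o = open_chart_img[OF c]
  have sp: "space ?L = ?V" by (simp add: space_restrict_space)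
  have pre: "chart_inv c -` S \<inter> ?V = chart_map c ` S"
    using S(2) chart_inv_map[OF c] chart_map_inv[OF c] by (auto simp: image_iff)
  have mL: "chart_inv c -` S \<inter> ?V \<in> sets ?L"
    using measurable_sets[OF measurable_chart_inv[OF c] S(1)] sp by simp
  have m: "chart_inv c \<in> density ?L (vol_density c) \<rightarrow>\<^sub>M borelM"
    using measurable_chart_inv[OF c] by simp
  have "emeasure (chart_vol c) S = emeasure (density ?L (vol_density c)) (chart_inv c -` S \<inter> ?V)"
    unfolding chart_vol_def using emeasure_distr[OF m S(1)] sp by simp
  also have "\<dots> = (\<integral>\<^sup>+ y. vol_density c y * indicator (chart_map c ` S) y \<partial>?L)"
    using emeasure_density[OF measurable_vol_density[OF c] mL] pre by simp
  also have "\<dots> = (\<integral>\<^sup>+ y. vol_density c y * indicator (chart_map c ` S) y * indicator ?V y \<partial>lborel)"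
    by (rule nn_integral_restrict_space) (use o in simp)
  also have "\<dots> = (\<integral>\<^sup>+ y \<in> chart_map c ` S. vol_density c y \<partial>lborel)"
    using S(2) by (intro nn_integral_cong) (auto simp: indicator_def)
  finally show "emeasure (chart_vol c) S = (\<integral>\<^sup>+ y \<in> chart_map c ` S. vol_density c y \<partial>lborel)" .
  show "chart_map c ` S \<in> sets lborel"
    using mL pre o by (simp add: sets_restrict_space_iff)
qed

lemma sets_chart_vol: "sets (chart_vol c) = sets borelM"
  by (simp add: chart_vol_def)

text \<open>The partition is kept existential: the later arguments work for whichever one was
  chosen.\<close>

lemma riemannian_measure_props:
  shows sets_vol: "sets vol = sets borelM"
    and space_vol: "space vol = M"
    and emeasure_vol: "\<exists>k C D. chart_partition M A (k, C, D) \<and>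
      (\<forall>S\<in>sets borelM. emeasure vol S = (\<Sum>i<k. emeasure (chart_vol (C i)) (S \<inter> D i)))"
proof -
  obtain k C D where P: "(SOME P. chart_partition M A P) = (k, C, D)" by (metis prod_cases3)
  have part: "chart_partition M A (k, C, D)"
    using someI_ex[OF chart_partition_exists] unfolding P .
  have CA: "C i \<in> A" and DB: "D i \<in> sets borelM" and Dd: "D i \<subseteq> chart_dom (C i)" if "i < k" for i
    using part that unfolding chart_partition_def by auto
  let ?f = "\<lambda>S. \<Sum>i<k. \<integral>\<^sup>+ y \<in> chart_map (C i) ` (S \<inter> D i). vol_density (C i) y \<partial>lborel"
  let ?g = "\<lambda>S. \<Sum>i<k. emeasure (chart_vol (C i)) (S \<inter> D i)"
  have sp: "space borelM = M" by (simp add: space_restrict_space)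
  have pow: "sets borelM \<subseteq> Pow M" using sets.space_closed[of borelM] sp by simp
  have sig: "sigma_sets M (sets borelM) = sets borelM" using sets.sigma_sets_eq[of borelM] sp by simp
  have v: "vol = measure_of M (sets borelM) ?f"
    by (simp add: riemannian_measure_def P vol_density_def)
  also have "\<dots> = measure_of M (sets borelM) ?g"
  proof (rule measure_of_eq[OF pow])
    fix S assume "S \<in> sigma_sets M (sets borelM)"
    then have S: "S \<in> sets borelM" by (simp add: sig)
    show "?f S = ?g S"
      by (intro sum.cong refl emeasure_chart_vol(1)[symmetric] CA sets.Int S DB) (use Dd in auto)
  qed
  finally have v2: "vol = measure_of M (sets borelM) ?g" .
  show s: "sets vol = sets borelM" unfolding v2 by (simp add: sets_measure_of[OF pow] sig)
  show "space vol = M" unfolding v2 by (simp add: space_measure_of[OF pow])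
  have "emeasure vol S = ?g S" if S: "S \<in> sets borelM" for S
  proof (rule emeasure_measure_of[OF v2 pow])
    show "S \<in> sets vol" using S s by simp
    show "positive (sets vol) ?g" by (simp add: positive_def)
    show "countably_additive (sets vol) ?g"
    proof (rule countably_additiveI)
      fix F :: "nat \<Rightarrow> 'a set"
      assume F: "range F \<subseteq> sets vol" "disjoint_family F" "(\<Union>i. F i) \<in> sets vol"
      have "(\<Sum>n. ?g (F n)) = (\<Sum>i<k. \<Sum>n. emeasure (chart_vol (C i)) (F n \<inter> D i))"
        by (rule suminf_sum) simp
      also have "\<dots> = (\<Sum>i<k. emeasure (chart_vol (C i)) (\<Union>n. F n \<inter> D i))"
      proof (intro sum.cong refl suminf_emeasure)
        fix i assume "i \<in> {..<k}"
        then show "range (\<lambda>n. F n \<inter> D i) \<subseteq> sets (chart_vol (C i))"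
          using F(1) DB[of i] s sets_chart_vol by (auto intro!: sets.Int)
        show "disjoint_family (\<lambda>n. F n \<inter> D i)" using F(2) by (auto simp: disjoint_family_on_def)
      qed
      finally show "(\<Sum>n. ?g (F n)) = ?g (\<Union>n. F n)" by simp
    qed
  qed
  then show "\<exists>k C D. chart_partition M A (k, C, D) \<and>
      (\<forall>S\<in>sets borelM. emeasure vol S = (\<Sum>i<k. emeasure (chart_vol (C i)) (S \<inter> D i)))"
    using part by blast
qed

text \<open>The density may be unbounded on a chart domain, but the compact set around each piece of
  the partition bounds both the density and the coordinate volume.\<close>

lemma finite_measure_vol: "finite_measure vol"
proof (rule finite_measureI)
  obtain k C D where part: "chart_partition M A (k, C, D)" and
    em: "\<And>S. S \<in> sets borelM \<Longrightarrow> emeasure vol S = (\<Sum>i<k. emeasure (chart_vol (C i)) (S \<inter> D i))"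
    using emeasure_vol by blast
  have "emeasure (chart_vol (C i)) (M \<inter> D i) < \<infinity>" if i: "i < k" for i
  proof -
    obtain K where c: "C i \<in> A" and D: "D i \<in> sets borelM" and K: "compact K" "D i \<subseteq> K" "K \<subseteq> chart_dom (C i)"
      using part i unfolding chart_partition_def by auto
    have MD: "M \<inter> D i = D i" using D sets_borelM by blast
    let ?K = "chart_map (C i) ` K"
    have cK: "compact ?K"
      by (rule compact_continuous_image[OF continuous_on_subset[OF continuous_on_chart_map[OF c] K(3)] K(1)])
    have "continuous_on ?K (\<lambda>y. sqrt (det (G (C i) (chart_inv (C i) y))))"
      using continuous_on_subset[OF continuous_on_sqrt_det[OF c]] K(3) by blast
    from continuous_on_compact_bound[OF cK this]
    obtain B where B: "\<And>y. y \<in> ?K \<Longrightarrow> norm (sqrt (det (G (C i) (chart_inv (C i) y)))) \<le> B" by blast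
    have "emeasure (chart_vol (C i)) (M \<inter> D i) = (\<integral>\<^sup>+ y \<in> chart_map (C i) ` D i. vol_density (C i) y \<partial>lborel)"
      unfolding MD by (rule emeasure_chart_vol(1)[OF c D]) (use K in blast)
    also have "\<dots> \<le> (\<integral>\<^sup>+ y. ennreal B * indicator ?K y \<partial>lborel)"
    proof (rule nn_integral_mono)
      fix y :: "real ^ 'm"
      show "vol_density (C i) y * indicator (chart_map (C i) ` D i) y \<le> ennreal B * indicator ?K y"
      proof (cases "y \<in> chart_map (C i) ` D i")
        case True
        then have "y \<in> ?K" using K(2) by blast
        then show ?thesis using True abs_le_D1[OF B[unfolded real_norm_def, of y]]
          by (simp add: vol_density_def ennreal_leI)
      qed simp
    qed
    also have "\<dots> = ennreal B * emeasure lborel ?K"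
      by (rule nn_integral_cmult_indicator) (use borel_compact[OF cK] in simp)
    also have "\<dots> < \<infinity>" using emeasure_compact_finite[OF cK] by (simp add: ennreal_mult_less_top)
    finally show ?thesis .
  qed
  then show "emeasure vol (space vol) \<noteq> \<infinity>"
    using em[of M] sets_borelM M_borel by (simp add: space_vol less_top)
qed

text \<open>If the set were null, its coordinate image on each piece would be negligible, as the
  density is positive. Transition maps preserve negligible sets, so all pieces can be viewed in one
  chart; there they would cover a nonempty open set, which is not negligible.\<close>

lemma emeasure_vol_open_pos:
  assumes O: "openin (top_of_set M) O'" "O' \<noteq> {}"
  shows "emeasure vol O' \<noteq> 0"
proof
  assume z: "emeasure vol O' = 0"
  obtain k C D where part: "chart_partition M A (k, C, D)" and
    em: "\<And>S. S \<in> sets borelM \<Longrightarrow> emeasure vol S = (\<Sum>i<k. emeasure (chart_vol (C i)) (S \<inter> D i))"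
    using emeasure_vol by blast
  obtain U where U: "open U" "O' = M \<inter> U" using O openin_open by blast
  have OM: "O' \<in> sets borelM" "O' \<subseteq> M" using U M_borel sets_borelM by auto
  have neg: "negligible (chart_map (C i) ` (O' \<inter> D i))" if i: "i < k" for i
  proof -
    have c: "C i \<in> A" and D: "D i \<in> sets borelM" "D i \<subseteq> chart_dom (C i)"
      using part i unfolding chart_partition_def by auto
    have S: "O' \<inter> D i \<in> sets borelM" "O' \<inter> D i \<subseteq> chart_dom (C i)" using OM D by auto
    let ?Z = "chart_map (C i) ` (O' \<inter> D i)"
    note Z = emeasure_chart_vol[OF c S]
    have "emeasure (chart_vol (C i)) (O' \<inter> D i) = 0" using z em[OF OM(1)] i by simp
    then have "(\<integral>\<^sup>+ y. vol_density (C i) y * indicator ?Z y \<partial>lborel) = 0" using Z(1) by simp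
    moreover have meas: "(\<lambda>y. vol_density (C i) y * indicator ?Z y) \<in> borel_measurable lborel"
    proof -
      have "(\<lambda>y. vol_density (C i) y * indicator (chart_img (C i)) y) \<in> borel_measurable lborel"
        using measurable_vol_density[OF c] open_chart_img[OF c]
        by (subst (asm) borel_measurable_restrict_space_iff_ennreal) auto
      then have "(\<lambda>y. vol_density (C i) y * indicator (chart_img (C i)) y * indicator ?Z y) \<in> borel_measurable lborel"
        using Z(2) by measurable
      moreover have "vol_density (C i) y * indicator (chart_img (C i)) y * indicator ?Z y =
          vol_density (C i) y * indicator ?Z y" for y using D(2) by (auto simp: indicator_def)
      ultimately show ?thesis by simp
    qed
    ultimately have ae: "AE y in lborel. vol_density (C i) y * indicator ?Z y = 0"
      using nn_integral_0_iff_AE by blast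
    have "AE y in lborel. y \<notin> ?Z"
      using ae
    proof eventually_elim
      case (elim y)
      show ?case
      proof
        assume y: "y \<in> ?Z"
        then obtain x where x: "x \<in> chart_dom (C i)" "y = chart_map (C i) x" using S(2) by auto
        then have "vol_density (C i) y > 0"
          using metric_det_pos[OF c x(1)] chart_inv_map[OF c x(1)] by (simp add: vol_density_def)
        then show False using elim y by simp
      qed
    qed
    then have "?Z \<in> null_sets lborel" using Z(2) AE_iff_null_sets by blast
    then show ?thesis unfolding negligible_iff_null_sets by (rule null_sets_completionI)
  qed
  obtain x where x: "x \<in> O'" using O(2) by blast
  then obtain c where c: "c \<in> A" "x \<in> chart_dom c" using chart_at OM(2) by blast
  let ?W = "chart_map c ` (chart_dom c \<inter> O')"
  have "open ?W" by (rule openin_chart_map_image[OF c(1) O(1)])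
  moreover have "?W \<noteq> {}" using x c by blast
  moreover have "negligible ?W"
  proof (rule negligible_subset)
    let ?Y = "\<lambda>i. chart_map (C i) ` (chart_dom (C i) \<inter> chart_dom c \<inter> (O' \<inter> D i))"
    show "negligible (\<Union>i<k. transition (C i) c ` ?Y i)"
    proof (rule negligible_Union[OF finite_imageI[OF finite_lessThan]])
      fix t assume "t \<in> (\<lambda>i. transition (C i) c ` ?Y i) ` {..<k}"
      then obtain i where i: "i \<in> {..<k}" and t: "t = transition (C i) c ` ?Y i" by blast
      then have Ci: "C i \<in> A" using part unfolding chart_partition_def by auto
      note tr = transition_props[OF Ci c(1)]
      show "negligible t" unfolding t
      proof (rule negligible_differentiable_image_negligible[OF order_refl])
        show "negligible (?Y i)" by (rule negligible_subset[OF neg]) (use i in auto)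
        show "transition (C i) c differentiable_on ?Y i"
          unfolding differentiable_on_def
          by (rule ballI, rule differentiable_at_withinI, rule smooth_on_differentiable[OF tr(2)]) auto
      qed
    qed
    show "?W \<subseteq> (\<Union>i<k. transition (C i) c ` ?Y i)"
    proof
      fix y assume "y \<in> ?W"
      then obtain z where zz: "z \<in> chart_dom c" "z \<in> O'" "y = chart_map c z" by auto
      then have "z \<in> M" using OM by blast
      then obtain i where i: "i < k" "z \<in> D i" using part unfolding chart_partition_def by auto
      then have Ci: "C i \<in> A" "z \<in> chart_dom (C i)" using part unfolding chart_partition_def by auto
      have "y = transition (C i) c (chart_map (C i) z)"
        using transition_props(3)[OF Ci(1) c(1) Ci(2)] zz by simp
      then show "y \<in> (\<Union>i<k. transition (C i) c ` ?Y i)" using i zz Ci by blast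
    qed
  qed
  ultimately show False using open_not_negligible by blast
qed

lemma integrable_continuous:
  fixes f :: "'a \<Rightarrow> real"
  assumes "continuous_on M f"
  shows "integrable vol f"
proof -
  interpret finite_measure vol by (rule finite_measure_vol)
  obtain B where B: "\<And>x. x \<in> M \<Longrightarrow> norm (f x) \<le> B"
    using continuous_on_compact_bound[OF compact assms] by blast
  show ?thesis
  proof (rule integrable_const_bound)
    show "AE x in vol. norm (f x) \<le> B" using B by (intro AE_I2) (simp add: space_vol)
    show "f \<in> borel_measurable vol"
      using borel_measurable_continuous_on_restrict[OF assms] unfolding measurable_cong_sets[OF sets_vol refl] .
  qed
qed

lemma continuous_on_slice:
  assumes "continuous_on (T \<times> M) f" "t \<in> T"
  shows "continuous_on M (\<lambda>x. f (t, x))"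
  by (rule continuous_on_compose2[OF assms(1)]) (use assms(2) in \<open>auto intro!: continuous_intros\<close>)

text \<open>Compactness gives uniformity in \<open>x\<close>: near \<open>t0\<close>,
  \<open>f'\<close> is within a prescribed distance of its value at \<open>t0\<close> for all
  \<open>x\<close> at once, and the mean value inequality transfers this to the increments of
  \<open>f\<close> before integration.\<close>

lemma has_real_derivative_integral:
  fixes f f' :: "real \<times> 'a \<Rightarrow> real"
  assumes T: "open T" "t0 \<in> T"
    and f: "continuous_on (T \<times> M) f" and f': "continuous_on (T \<times> M) f'"
    and D: "\<And>t x. t \<in> T \<Longrightarrow> x \<in> M \<Longrightarrow> ((\<lambda>t. f (t, x)) has_real_derivative f' (t, x)) (at t)"
  shows "((\<lambda>t. \<integral>x. f (t, x) \<partial>vol) has_real_derivative (\<integral>x. f' (t0, x) \<partial>vol)) (at t0)"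
  unfolding has_field_derivative_def has_derivative_at_alt
proof (intro conjI allI impI)
  interpret finite_measure vol by (rule finite_measure_vol)
  show "bounded_linear ((*) (\<integral>x. f' (t0, x) \<partial>vol))" by (rule bounded_linear_mult_right)
  fix e :: real assume e: "e > 0"
  \<comment> \<open>The summand 1 keeps the divisor positive whatever the volume is.\<close>
  define m where "m = measure vol M + 1"
  have m: "m > 0" by (simp add: m_def add_nonneg_pos)
  obtain X0 where X0: "t0 \<in> X0" "open X0" "\<forall>t\<in>X0 \<inter> T. \<forall>x\<in>M. dist (f' (t, x)) (f' (t0, x)) \<le> e / m"
    by (rule continuous_on_prod_compactE[OF f' compact T(2), of "e / m"]) (use e m in auto)
  obtain d where d: "d > 0" "ball t0 d \<subseteq> X0 \<inter> T"
    using open_contains_ball[of "X0 \<inter> T"] X0(1,2) T by blast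
  note int = integrable_continuous[OF continuous_on_slice[OF f]] integrable_continuous[OF continuous_on_slice[OF f']]
  show "\<exists>d>0. \<forall>y. norm (y - t0) < d \<longrightarrow> norm ((\<integral>x. f (y, x) \<partial>vol) - (\<integral>x. f (t0, x) \<partial>vol) -
      (\<integral>x. f' (t0, x) \<partial>vol) * (y - t0)) \<le> e * norm (y - t0)"
  proof (intro exI[of _ d] conjI allI impI d)
    fix y assume "norm (y - t0) < d"
    then have y: "y \<in> ball t0 d" "y \<in> T" using d(2) by (auto simp: dist_norm norm_minus_commute)
    have pt: "norm (f (y, x) - f (t0, x) - f' (t0, x) * (y - t0)) \<le> e / m * norm (y - t0)" if x: "x \<in> M" for x
    proof -
      \<comment> \<open>Subtracting the linear function with slope \<open>f' (t0, x)\<close> turns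
        the remainder into an increment, to which the mean value inequality applies.\<close>
      have "norm ((f (y, x) - f' (t0, x) * y) - (f (t0, x) - f' (t0, x) * t0)) \<le> e / m * norm (y - t0)"
      proof (rule field_differentiable_bound[OF convex_ball])
        fix z assume z: "z \<in> ball t0 d"
        then have zT: "z \<in> T" "z \<in> X0" using d(2) by auto
        have "((\<lambda>t. f (t, x) - f' (t0, x) * t) has_real_derivative (f' (z, x) - f' (t0, x))) (at z)"
          using D[OF zT(1) x] by (auto intro!: derivative_eq_intros)
        then show "((\<lambda>t. f (t, x) - f' (t0, x) * t) has_real_derivative (f' (z, x) - f' (t0, x))) (at z within ball t0 d)"
          by (rule has_field_derivative_at_within)
        show "norm (f' (z, x) - f' (t0, x)) \<le> e / m" using X0(3) zT x by (auto simp: dist_norm)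
      qed (use y d in auto)
      then show ?thesis by (simp add: algebra_simps)
    qed
    have i: "integrable vol (\<lambda>x. f (y, x) - f (t0, x) - f' (t0, x) * (y - t0))"
      using int T y by auto
    have "(\<integral>x. f (y, x) \<partial>vol) - (\<integral>x. f (t0, x) \<partial>vol) - (\<integral>x. f' (t0, x) \<partial>vol) * (y - t0) =
        (\<integral>x. f (y, x) - f (t0, x) - f' (t0, x) * (y - t0) \<partial>vol)"
      using int T y by simp
    also have "norm \<dots> \<le> (\<integral>x. norm (f (y, x) - f (t0, x) - f' (t0, x) * (y - t0)) \<partial>vol)"
      by (rule integral_norm_bound)
    also have "\<dots> \<le> (\<integral>x. e / m * norm (y - t0) \<partial>vol)"
      using i pt by (intro integral_mono) (auto simp: space_vol)
    also have "\<dots> = e / m * norm (y - t0) * measure vol M" by (simp add: space_vol)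
    also have "\<dots> \<le> e / m * norm (y - t0) * m" using e m by (intro mult_left_mono) (auto simp: m_def)
    also have "\<dots> = e * norm (y - t0)" using m by simp
    finally show "norm ((\<integral>x. f (y, x) \<partial>vol) - (\<integral>x. f (t0, x) \<partial>vol) - (\<integral>x. f' (t0, x) \<partial>vol) * (y - t0)) \<le> e * norm (y - t0)" .
  qed
qed

text \<open>By continuity \<open>f\<close> stays below \<open>f x / 2\<close> on a nonempty
  relatively open set, and such sets have positive measure.\<close>

lemma integral_negative:
  fixes f :: "'a \<Rightarrow> real"
  assumes f: "continuous_on M f" and le: "\<And>x. x \<in> M \<Longrightarrow> f x \<le> 0" and x: "x \<in> M" "f x < 0"
  shows "(\<integral>x. f x \<partial>vol) < 0"
proof -
  interpret finite_measure vol by (rule finite_measure_vol)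
  let ?O = "{y \<in> M. f y < f x / 2}"
  have "openin (top_of_set M) (M \<inter> f -` {..<f x / 2})"
    by (rule continuous_openin_preimage_gen[OF f]) simp
  moreover have eq: "M \<inter> f -` {..<f x / 2} = ?O" by auto
  ultimately have o: "openin (top_of_set M) ?O" by simp
  moreover have "?O \<noteq> {}" using x by auto
  ultimately have pos: "emeasure vol ?O \<noteq> 0" by (rule emeasure_vol_open_pos)
  obtain U where "open U" "?O = M \<inter> U" using o openin_open by blast
  then have m: "?O \<in> sets vol" using M_borel sets_borelM by (simp add: sets_vol)
  have "(\<integral>x. f x \<partial>vol) < (\<integral>x. 0 \<partial>vol)"
    by (rule integral_less_AE[OF integrable_continuous[OF f] _ pos m])
      (use x(2) le in \<open>auto intro!: AE_I2 simp: space_vol\<close>)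
  then show ?thesis by simp
qed

end

section \<open>Existence of variations\<close>

locale maps_setting = compact_chart_manifold M A G + submanifold n N
  for M :: "'a::{t2_space, second_countable_topology} set"
    and A :: "('a, 'm::finite) coord_chart set"
    and G :: "('a, 'm) coord_chart \<Rightarrow> 'a \<Rightarrow> real ^ 'm ^ 'm"
    and n :: nat and N :: "'e::euclidean_space set"
begin

lemma smooth_variation_iff:
  "smooth_variation M A N \<psi> \<Psi> \<longleftrightarrow> (\<exists>\<epsilon>>0. smooth_family (ball 0 \<epsilon>) \<Psi> \<and> (\<forall>p\<in>ball 0 \<epsilon>. \<forall>x\<in>M. \<Psi> p x \<in> N)) \<and>
    (\<forall>x\<in>M. \<Psi> 0 x = \<psi> x)"
  unfolding smooth_variation_def smooth_family_def ..

lemma smooth_from_continuous: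
  fixes F :: "'a \<Rightarrow> 'b::euclidean_space"
  assumes "smooth_from A F"
  shows "continuous_on M F"
proof -
  have "smooth_family (UNIV :: real set) (\<lambda>p. F)" by (rule smooth_family_const[OF open_UNIV assms])
  then have "continuous_on ((UNIV :: real set) \<times> M) (\<lambda>z. F (snd z))" by (rule smooth_family_continuous)
  then have "continuous_on M (\<lambda>x. F (snd (0::real, x)))"
    by (rule continuous_on_compose2) (auto intro!: continuous_intros)
  then show ?thesis by simp
qed

lemma smooth_fromI: "(\<And>c. c \<in> A \<Longrightarrow> smooth_on (chart_img c) (\<lambda>y. F (chart_inv c y))) \<Longrightarrow> smooth_from A F"
  and smooth_fromD: "smooth_from A F \<Longrightarrow> c \<in> A \<Longrightarrow> smooth_on (chart_img c) (\<lambda>y. F (chart_inv c y))"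
  unfolding smooth_from_def o_def by blast+

lemma smooth_from_bilinear:
  "bounded_bilinear b \<Longrightarrow> smooth_from A F \<Longrightarrow> smooth_from A F' \<Longrightarrow> smooth_from A (\<lambda>x. b (F x) (F' x))"
  by (rule smooth_fromI, rule smooth_on_bilinear) (auto intro: smooth_fromD open_chart_img)

lemma smooth_from_sum:
  "(\<And>i. i \<in> I \<Longrightarrow> smooth_from A (F i)) \<Longrightarrow> smooth_from A (\<lambda>x. \<Sum>i\<in>I. F i x)"
  by (rule smooth_fromI, rule smooth_on_sum) (auto intro: smooth_fromD open_chart_img)

lemma smooth_from_const: "smooth_from A (\<lambda>x. c)"
  by (rule smooth_fromI, rule smooth_on_const)

lemma smooth_from_compose:
  fixes F :: "'a \<Rightarrow> 'b::euclidean_space"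
  shows "smooth_on UNIV f \<Longrightarrow> smooth_from A F \<Longrightarrow> smooth_from A (\<lambda>x. f (F x))"
  by (rule smooth_fromI, rule smooth_on_compose[where T = UNIV]) (auto intro: smooth_fromD open_chart_img)

lemma smooth_from_inverse:
  fixes F :: "'a \<Rightarrow> real"
  assumes "smooth_from A F" "\<And>x. x \<in> M \<Longrightarrow> F x \<noteq> 0"
  shows "smooth_from A (\<lambda>x. inverse (F x))"
proof (rule smooth_fromI)
  fix c assume c: "c \<in> A"
  show "smooth_on (chart_img c) (\<lambda>y. inverse (F (chart_inv c y)))"
    using chart_inv_in[OF c] chart_dom_subset[OF c] assms(2)
    by (intro smooth_on_inverse open_chart_img[OF c] smooth_fromD[OF assms(1) c]) blast
qed

text \<open>On \<open>N\<close> the retraction is the identity, so its derivative and the identity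
  are both derivatives within \<open>N\<close> of the same function; these agree on tangent
  vectors.\<close>

lemma retraction_derivative:
  assumes r: "open W" "smooth_on W r" "\<And>y. y \<in> W \<Longrightarrow> y \<in> N \<Longrightarrow> r y = y"
    and x: "x \<in> W" "x \<in> N" and u: "u \<in> tangent_space N x"
  shows "frechet_derivative r (at x) u = u"
proof -
  obtain d where d: "d > 0" "ball x d \<subseteq> W" using r(1) x(1) open_contains_ball by blast
  have "(r has_derivative frechet_derivative r (at x)) (at x within N)"
    by (rule has_derivative_at_withinI[OF smooth_on_has_derivative[OF r(2) x(1)]])
  then have "((\<lambda>y. y) has_derivative frechet_derivative r (at x)) (at x within N)"
    by (rule has_derivative_transform_within[OF _ d(1) x(2)])
      (use d r(3) in \<open>auto simp: dist_commute subset_iff\<close>)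
  from dir_deriv_eqI[OF this u] dir_deriv_eqI[OF has_derivative_ident u] show ?thesis by metis
qed

text \<open>The inductive step of the patching: the part
  \<open>f (\<psi> x) *\<^sub>R \<xi> x\<close> is added to the velocity by moving linearly in the
  ambient space and retracting to \<open>N\<close>. Outside the closed set \<open>C\<close>, where
  \<open>f\<close> vanishes, the old variation is kept.\<close>

lemma extend_variation:
  fixes \<Psi> :: "real \<Rightarrow> 'a \<Rightarrow> 'e" and f :: "'e \<Rightarrow> real"
  assumes \<psi>: "smooth_map_into M A N \<psi>"
    and \<Psi>: "smooth_variation M A N \<psi> \<Psi>"
    and vel: "\<And>x. x \<in> M \<Longrightarrow> ((\<lambda>t. \<Psi> t x) has_vector_derivative \<zeta> x) (at 0)"
    and \<zeta>: "\<And>x. x \<in> M \<Longrightarrow> \<zeta> x \<in> tangent_space N (\<psi> x)"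
    and \<xi>: "field_along M A N \<psi> \<xi>"
    and r: "open W" "smooth_on W r" "\<And>y. y \<in> W \<Longrightarrow> r y \<in> N" "\<And>y. y \<in> W \<Longrightarrow> y \<in> N \<Longrightarrow> r y = y"
    and f: "smooth_on UNIV f" "closed C" "C \<subseteq> W" "\<And>y. y \<notin> C \<Longrightarrow> f y = 0"
  obtains \<Psi>' where "smooth_variation M A N \<psi> \<Psi>'"
    "\<And>x. x \<in> M \<Longrightarrow> ((\<lambda>t. \<Psi>' t x) has_vector_derivative \<zeta> x + f (\<psi> x) *\<^sub>R \<xi> x) (at (0::real))"
proof -
  obtain \<epsilon> where \<epsilon>: "\<epsilon> > 0" "smooth_family (ball 0 \<epsilon>) \<Psi>" "\<And>t x. t \<in> ball 0 \<epsilon> \<Longrightarrow> x \<in> M \<Longrightarrow> \<Psi> t x \<in> N"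
    and \<Psi>0: "\<And>x. x \<in> M \<Longrightarrow> \<Psi> 0 x = \<psi> x"
    using \<Psi> unfolding smooth_variation_iff by blast
  have sm: "smooth_from A \<psi>" "smooth_from A \<xi>" and \<psi>N: "\<And>x. x \<in> M \<Longrightarrow> \<psi> x \<in> N"
    and \<xi>T: "\<And>x. x \<in> M \<Longrightarrow> \<xi> x \<in> tangent_space N (\<psi> x)"
    using \<psi> \<xi> unfolding smooth_map_into_def field_along_def by auto
  define v where "v t x = \<Psi> t x + (t * f (\<psi> x)) *\<^sub>R \<xi> x" for t x
  have vfam: "smooth_family (ball 0 \<epsilon>) v"
    unfolding smooth_family_def
  proof
    fix c assume c: "c \<in> A"
    have o: "open (ball (0::real) \<epsilon> \<times> chart_img c)" by (intro open_Times open_ball open_chart_img c)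
    note fam = smooth_family_const[OF open_ball sm(1), of 0 \<epsilon>] smooth_family_const[OF open_ball sm(2), of 0 \<epsilon>] \<epsilon>(2)
    have s: "smooth_on (ball (0::real) \<epsilon> \<times> chart_img c) (\<lambda>z. \<psi> (chart_inv c (snd z)))"
      "smooth_on (ball (0::real) \<epsilon> \<times> chart_img c) (\<lambda>z. \<xi> (chart_inv c (snd z)))"
      "smooth_on (ball (0::real) \<epsilon> \<times> chart_img c) (\<lambda>z. \<Psi> (fst z) (chart_inv c (snd z)))"
      using fam c unfolding smooth_family_def case_prod_beta' by blast+
    have "smooth_on (ball 0 \<epsilon> \<times> chart_img c) (\<lambda>z. v (fst z) (chart_inv c (snd z)))"
      unfolding v_def
      by (intro smooth_on_add smooth_on_scaleR smooth_on_mult smooth_on_fst smooth_on_id s o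
          smooth_on_compose[OF f(1)] subset_UNIV)
    then show "smooth_on (ball 0 \<epsilon> \<times> chart_img c) (\<lambda>(p, y). v p (chart_inv c y))" by (simp add: case_prod_beta')
  qed
  \<comment> \<open>The retraction is applied only over this compact set, and compactness gives one
    parameter interval on which all its moved points stay in \<open>W\<close>.\<close>
  define K where "K = {x \<in> M. \<psi> x \<in> C}"
  have "closedin (top_of_set M) (M \<inter> \<psi> -` C)"
    by (rule continuous_closedin_preimage[OF smooth_from_continuous[OF sm(1)] f(2)])
  moreover have "M \<inter> \<psi> -` C = K" by (auto simp: K_def)
  ultimately have K: "compact K" using closedin_compact[OF compact] by metis
  have KM: "K \<subseteq> M" by (auto simp: K_def)
  have cv: "continuous_on (ball 0 \<epsilon> \<times> K) (\<lambda>z. v (fst z) (snd z))"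
    by (rule continuous_on_subset[OF smooth_family_continuous[OF vfam]]) (use KM in auto)
  have v0: "v 0 x = \<psi> x" if "x \<in> M" for x using \<Psi>0[OF that] by (simp add: v_def)
  have "compact (\<psi> ` K)"
    by (rule compact_continuous_image[OF continuous_on_subset[OF smooth_from_continuous[OF sm(1)] KM] K])
  moreover have "\<psi> ` K \<subseteq> W" using f(3) by (auto simp: K_def)
  ultimately obtain e where e: "e > 0" "(\<Union>y\<in>\<psi> ` K. cball y e) \<subseteq> W"
    by (rule compact_subset_open_imp_cball_epsilon_subset[OF _ r(1)])
  have 0: "0 \<in> ball (0::real) \<epsilon>" using \<epsilon>(1) by simp
  have "\<exists>X0. 0 \<in> X0 \<and> open X0 \<and> (\<forall>t\<in>X0 \<inter> ball 0 \<epsilon>. \<forall>x\<in>K. dist (v t x) (v 0 x) \<le> e)"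
  proof (rule continuous_on_prod_compactE[OF cv K 0 e(1)], unfold fst_conv snd_conv)
    fix X0 :: "real set"
    assume "0 \<in> X0" "open X0" "\<forall>t\<in>X0 \<inter> ball 0 \<epsilon>. \<forall>x\<in>K. dist (v t x) (v 0 x) \<le> e"
    then show ?thesis by (intro exI conjI)
  qed
  then obtain X0 where X0: "0 \<in> X0" "open X0" "\<forall>t\<in>X0 \<inter> ball 0 \<epsilon>. \<forall>x\<in>K. dist (v t x) (v 0 x) \<le> e"
    by (elim exE conjE)
  obtain \<epsilon>' where \<epsilon>': "\<epsilon>' > 0" "ball 0 \<epsilon>' \<subseteq> X0 \<inter> ball 0 \<epsilon>"
    using open_contains_ball[of "X0 \<inter> ball 0 \<epsilon>"] X0 0 by blast
  have vW: "v t x \<in> W" if "t \<in> ball 0 \<epsilon>'" "x \<in> K" for t x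
  proof -
    have "t \<in> X0 \<inter> ball 0 \<epsilon>" using that(1) \<epsilon>'(2) by blast
    then have "dist (v t x) (v 0 x) \<le> e" using X0(3) that(2) by blast
    then have "v t x \<in> cball (\<psi> x) e" using v0 that(2) KM by (simp add: subset_iff dist_commute)
    then show ?thesis using e(2) that(2) by blast
  qed
  define \<Psi>' where "\<Psi>' t x = (if \<psi> x \<in> C then r (v t x) else \<Psi> t x)" for t x
  \<comment> \<open>Off \<open>C\<close> the moved point is the old one and lies in
    \<open>N\<close>, where the retraction is the identity. Hence the retraction formula holds
    wherever the moved point lies in \<open>W\<close>, an open condition, and not merely over
    \<open>C\<close>.\<close>
  have eq: "\<Psi>' t x = r (v t x)" if "t \<in> ball 0 \<epsilon>'" "x \<in> M" "v t x \<in> W" for t x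
  proof (cases "\<psi> x \<in> C")
    case False
    then have "v t x = \<Psi> t x" using f(4) by (simp add: v_def)
    moreover have "\<Psi> t x \<in> N" using \<epsilon>(3) \<epsilon>'(2) that(1,2) by blast
    ultimately show ?thesis using False r(4) that(3) by (simp add: \<Psi>'_def)
  qed (simp add: \<Psi>'_def)
  have fam': "smooth_family (ball 0 \<epsilon>') \<Psi>'"
    unfolding smooth_family_def
  proof
    fix c assume c: "c \<in> A"
    let ?B = "ball (0::real) \<epsilon>' \<times> chart_img c"
    have o: "open ?B" by (intro open_Times open_ball open_chart_img c)
    have fams: "smooth_family (ball 0 \<epsilon>') v" "smooth_family (ball 0 \<epsilon>') \<Psi>"
      using vfam \<epsilon>(2) \<epsilon>'(2) smooth_family_subset by blast+
    have s: "smooth_on ?B (\<lambda>z. v (fst z) (chart_inv c (snd z)))" "smooth_on ?B (\<lambda>z. \<Psi> (fst z) (chart_inv c (snd z)))"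
      using fams c unfolding smooth_family_def case_prod_beta' by blast+
    have "smooth_family (ball (0::real) \<epsilon>') (\<lambda>p. \<psi>)" by (rule smooth_family_const[OF open_ball sm(1)])
    then have s\<psi>: "smooth_on ?B (\<lambda>z. \<psi> (chart_inv c (snd z)))"
      using c unfolding smooth_family_def case_prod_beta' by blast
    \<comment> \<open>Two open sets covering the domain, with one smooth formula for the variation
      on each.\<close>
    let ?T1 = "?B \<inter> (\<lambda>z. v (fst z) (chart_inv c (snd z))) -` W"
    let ?T2 = "?B \<inter> (\<lambda>z. \<psi> (chart_inv c (snd z))) -` (- C)"
    have T: "open ?T1" "open ?T2"
      using continuous_open_preimage[OF smooth_on_continuous_on[OF s(1)] o r(1)]
        continuous_open_preimage[OF smooth_on_continuous_on[OF s\<psi>] o] f(2) by auto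
    have inM: "chart_inv c y \<in> M" if "y \<in> chart_img c" for y
      using chart_inv_in[OF c that] chart_dom_subset[OF c] by blast
    have 1: "smooth_on ?T1 (\<lambda>z. \<Psi>' (fst z) (chart_inv c (snd z)))"
    proof (rule smooth_on_cong[OF T(1)])
      show "smooth_on ?T1 (\<lambda>z. r (v (fst z) (chart_inv c (snd z))))"
        by (rule smooth_on_compose[OF r(2) smooth_on_subset[OF s(1)] _ T(1)]) auto
      fix z assume "z \<in> ?T1"
      then show "r (v (fst z) (chart_inv c (snd z))) = \<Psi>' (fst z) (chart_inv c (snd z))"
        using eq[of "fst z" "chart_inv c (snd z)"] inM[of "snd z"] by (simp add: mem_Times_iff)
    qed
    have 2: "smooth_on ?T2 (\<lambda>z. \<Psi>' (fst z) (chart_inv c (snd z)))"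
      by (rule smooth_on_cong[OF T(2) smooth_on_subset[OF s(2)]]) (auto simp: \<Psi>'_def)
    have "smooth_on ?B (\<lambda>z. \<Psi>' (fst z) (chart_inv c (snd z)))"
    proof (rule smooth_on_locally)
      fix z assume z: "z \<in> ?B"
      show "\<exists>T. open T \<and> z \<in> T \<and> smooth_on T (\<lambda>z. \<Psi>' (fst z) (chart_inv c (snd z)))"
      proof (cases "\<psi> (chart_inv c (snd z)) \<in> C")
        case True
        then have "chart_inv c (snd z) \<in> K" using inM[of "snd z"] z by (simp add: K_def mem_Times_iff)
        then have "z \<in> ?T1" using vW[of "fst z" "chart_inv c (snd z)"] z by (simp add: mem_Times_iff)
        then show ?thesis using T(1) 1 by blast
      next
        case False
        then have "z \<in> ?T2" using z by simp
        then show ?thesis using T(2) 2 by blast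
      qed
    qed
    then show "smooth_on ?B (\<lambda>(p, y). \<Psi>' p (chart_inv c y))" by (simp add: case_prod_beta')
  qed
  have inN: "\<Psi>' t x \<in> N" if t: "t \<in> ball 0 \<epsilon>'" and x: "x \<in> M" for t x
  proof (cases "\<psi> x \<in> C")
    case True
    then show ?thesis using vW[OF t, of x] x r(3) by (simp add: \<Psi>'_def K_def)
  next
    case False
    then show ?thesis using \<epsilon>(3) \<epsilon>'(2) t x by (auto simp: \<Psi>'_def)
  qed
  have at0: "\<Psi>' 0 x = \<psi> x" if "x \<in> M" for x
    using v0[OF that] \<Psi>0[OF that] r(4) \<psi>N[OF that] f(3) by (auto simp: \<Psi>'_def)
  have vel': "((\<lambda>t. \<Psi>' t x) has_vector_derivative \<zeta> x + f (\<psi> x) *\<^sub>R \<xi> x) (at 0)" if x: "x \<in> M" for x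
  proof (cases "\<psi> x \<in> C")
    case False
    then show ?thesis using vel[OF x] f(4) by (simp add: \<Psi>'_def)
  next
    case True
    let ?w = "\<zeta> x + f (\<psi> x) *\<^sub>R \<xi> x"
    have "((\<lambda>t. (t * f (\<psi> x)) *\<^sub>R \<xi> x) has_vector_derivative f (\<psi> x) *\<^sub>R \<xi> x) (at 0)"
      by (auto intro!: derivative_eq_intros simp: has_vector_derivative_def)
    from has_vector_derivative_add[OF vel[OF x] this]
    have dv: "((\<lambda>t. v t x) has_vector_derivative ?w) (at 0)" by (simp add: v_def)
    have W: "\<psi> x \<in> W" using True f(3) by blast
    have dr: "(r has_derivative frechet_derivative r (at (\<psi> x))) (at (v 0 x) within UNIV)"
      using smooth_on_has_derivative[OF r(2) W] v0[OF x] by simp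
    have "((\<lambda>t. r (v t x)) has_vector_derivative frechet_derivative r (at (\<psi> x)) ?w) (at 0)"
      by (rule has_vector_derivative_compose_within[OF dr dv zero_less_one]) auto
    moreover have "frechet_derivative r (at (\<psi> x)) ?w = ?w"
      using \<zeta>[OF x] \<xi>T[OF x] subspace_tangent_space[OF \<psi>N[OF x]]
      by (intro retraction_derivative[OF r(1,2,4) W \<psi>N[OF x]] subspace_add subspace_scale) auto
    ultimately show ?thesis using True by (simp add: \<Psi>'_def)
  qed
  show thesis
  proof (rule that[OF _ vel'])
    show "smooth_variation M A N \<psi> \<Psi>'"
      unfolding smooth_variation_iff using \<epsilon>'(1) fam' inN at0 by blast
  qed
qed

text \<open>
  Bump functions on the ambient space take the role of a partition of unity; dividing the field by
  their sum beforehand makes normalising them unnecessary.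
\<close>

lemma variation_exists:
  assumes \<psi>: "smooth_map_into M A N \<psi>" and \<xi>: "field_along M A N \<psi> \<xi>"
  obtains \<Psi> where "smooth_variation M A N \<psi> \<Psi>"
    "\<And>x. x \<in> M \<Longrightarrow> ((\<lambda>t. \<Psi> t x) has_vector_derivative \<xi> x) (at (0::real))"
proof -
  have sm: "smooth_from A \<psi>" "smooth_from A \<xi>" and \<psi>N: "\<And>x. x \<in> M \<Longrightarrow> \<psi> x \<in> N"
    and \<xi>T: "\<And>x. x \<in> M \<Longrightarrow> \<xi> x \<in> tangent_space N (\<psi> x)"
    using \<psi> \<xi> unfolding smooth_map_into_def field_along_def by auto
  have loc: "\<exists>W r \<rho> f. open W \<and> smooth_on W r \<and> (\<forall>z\<in>W. r z \<in> N) \<and> (\<forall>z\<in>W \<inter> N. r z = z) \<and> \<rho> > 0 \<and>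
      cball y \<rho> \<subseteq> W \<and> smooth_on UNIV f \<and> (\<forall>z. f z \<ge> (0::real)) \<and> (\<forall>z. f z > 0 \<longleftrightarrow> z \<in> ball y \<rho>)" if y: "y \<in> N" for y
  proof -
    obtain W r where W: "open W" "y \<in> W" "smooth_on W r" "\<And>z. z \<in> W \<Longrightarrow> r z \<in> N"
      "\<And>z. z \<in> W \<Longrightarrow> z \<in> N \<Longrightarrow> r z = z" by (rule local_retraction[OF y]) blast
    obtain \<rho> where \<rho>: "\<rho> > 0" "cball y \<rho> \<subseteq> W" using W(1,2) open_contains_cball by blast
    obtain f :: "'e \<Rightarrow> real" where "smooth_on UNIV f" "\<And>z. f z \<ge> 0" "\<And>z. f z > 0 \<longleftrightarrow> z \<in> ball y \<rho>"
      by (rule smooth_bump[OF \<rho>(1), of y]) blast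
    then show ?thesis using W \<rho>
      by (intro exI[of _ W] exI[of _ r] exI[of _ \<rho>] exI[of _ f] conjI ballI allI) auto
  qed
  \<comment> \<open>All that \<open>extend_variation\<close> asks of one bump function, together
    with the positivity and openness used to extract a finite cover of the image of
    \<open>\<psi>\<close>.\<close>
  define step where "step y f \<longleftrightarrow> smooth_on UNIV f \<and> (\<forall>z. f z \<ge> 0) \<and> f y > (0::real) \<and> open {z. f z > 0} \<and>
     (\<exists>W r C. open W \<and> smooth_on W r \<and> (\<forall>z\<in>W. r z \<in> N) \<and> (\<forall>z\<in>W \<inter> N. r z = z) \<and>
       closed C \<and> C \<subseteq> W \<and> (\<forall>z. z \<notin> C \<longrightarrow> f z = 0))" for y f
  have "\<exists>f. step y f" if y: "y \<in> N" for y
  proof -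
    obtain W r \<rho> f where *: "open W" "smooth_on W r" "\<forall>z\<in>W. r z \<in> N" "\<forall>z\<in>W \<inter> N. r z = z" "\<rho> > 0"
      "cball y \<rho> \<subseteq> W" "smooth_on UNIV f" "\<forall>z. f z \<ge> (0::real)" "\<forall>z. f z > 0 \<longleftrightarrow> z \<in> ball y \<rho>"
      using loc[OF y] by blast
    have "f z = 0" if "z \<notin> cball y \<rho>" for z
    proof -
      have "\<not> f z > 0" using *(9) that by auto
      then show ?thesis using *(8) by (simp add: order_antisym not_less)
    qed
    moreover have "{z. f z > 0} = ball y \<rho>" using *(9) by (intro set_eqI) simp
    ultimately have "open {z. f z > 0}" "\<And>z. z \<notin> cball y \<rho> \<Longrightarrow> f z = 0" by simp_all
    moreover have "f y > 0" using *(5,9) by simp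
    moreover have "\<exists>W r C. open W \<and> smooth_on W r \<and> (\<forall>z\<in>W. r z \<in> N) \<and> (\<forall>z\<in>W \<inter> N. r z = z) \<and>
        closed C \<and> C \<subseteq> W \<and> (\<forall>z. z \<notin> C \<longrightarrow> f z = 0)"
      using *(1-4,6) calculation(2) closed_cball
      by (intro exI[of _ W] exI[of _ r] exI[of _ "cball y \<rho>"] conjI allI impI) simp_all
    ultimately show ?thesis unfolding step_def using *(7,8) by (intro exI[of _ f]) simp
  qed
  then obtain f where f: "\<And>y. y \<in> N \<Longrightarrow> step y (f y)" by metis
  have "compact (\<psi> ` M)" by (rule compact_continuous_image[OF smooth_from_continuous[OF sm(1)] compact])
  then obtain F where F: "F \<subseteq> \<psi> ` M" "finite F" "\<psi> ` M \<subseteq> (\<Union>y\<in>F. {z. f y z > 0})"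
  proof (rule compactE_image)
    show "open {z. f y z > 0}" if "y \<in> \<psi> ` M" for y using f \<psi>N that unfolding step_def by blast
    show "\<psi> ` M \<subseteq> (\<Union>y\<in>\<psi> ` M. {z. f y z > 0})" using f \<psi>N unfolding step_def by auto
  qed
  have FN: "F \<subseteq> N" using F(1) \<psi>N by auto
  define s where "s z = (\<Sum>y\<in>F. f y z)" for z
  have s_smooth: "smooth_on UNIV s"
    unfolding s_def using f FN by (intro smooth_on_sum) (auto simp: step_def)
  have s_pos: "s (\<psi> x) > 0" if x: "x \<in> M" for x
  proof -
    obtain y where y: "y \<in> F" "f y (\<psi> x) > 0" using F(3) x by blast
    show ?thesis unfolding s_def
      by (rule sum_pos2[where i = y]) (use F(2) y f FN in \<open>auto simp: step_def\<close>)
  qed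
  define \<xi>' where "\<xi>' x = inverse (s (\<psi> x)) *\<^sub>R \<xi> x" for x
  have \<xi>': "field_along M A N \<psi> \<xi>'"
    unfolding field_along_def
  proof
    show "smooth_from A \<xi>'"
      unfolding \<xi>'_def
      by (intro smooth_from_bilinear[OF bounded_bilinear_scaleR] smooth_from_inverse
          smooth_from_compose[OF s_smooth] sm) (use s_pos in force)
    show "\<forall>x\<in>M. \<xi>' x \<in> tangent_space N (\<psi> x)"
      unfolding \<xi>'_def using \<xi>T subspace_scale[OF subspace_tangent_space[OF \<psi>N]] by blast
  qed
  have "\<exists>\<Psi>. smooth_variation M A N \<psi> \<Psi> \<and> (\<forall>x\<in>M. ((\<lambda>t. \<Psi> t x) has_vector_derivative
      (\<Sum>y\<in>F'. f y (\<psi> x)) *\<^sub>R \<xi>' x) (at (0::real)))" if "F' \<subseteq> F" for F'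
    using finite_subset[OF that F(2)] that
  proof (induction F' rule: finite_induct)
    case empty
    have "smooth_variation M A N \<psi> (\<lambda>t::real. \<psi>)"
      unfolding smooth_variation_iff using smooth_family_const[OF open_ball sm(1)] \<psi>N zero_less_one by blast
    then show ?case by (intro exI[of _ "\<lambda>t. \<psi>"]) (auto simp: has_vector_derivative_const)
  next
    case (insert y F')
    then obtain \<Psi> where \<Psi>: "smooth_variation M A N \<psi> \<Psi>"
      "\<And>x. x \<in> M \<Longrightarrow> ((\<lambda>t. \<Psi> t x) has_vector_derivative (\<Sum>y\<in>F'. f y (\<psi> x)) *\<^sub>R \<xi>' x) (at (0::real))" by auto
    have "step y (f y)" using f FN insert.prems by auto
    then obtain W r C where W: "smooth_on UNIV (f y)" "open W" "smooth_on W r" "\<And>z. z \<in> W \<Longrightarrow> r z \<in> N"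
      "\<And>z. z \<in> W \<Longrightarrow> z \<in> N \<Longrightarrow> r z = z" "closed C" "C \<subseteq> W" "\<And>z. z \<notin> C \<Longrightarrow> f y z = 0"
      unfolding step_def by auto
    have T: "(\<Sum>y\<in>F'. f y (\<psi> x)) *\<^sub>R \<xi>' x \<in> tangent_space N (\<psi> x)" if "x \<in> M" for x
      using \<xi>' that subspace_scale[OF subspace_tangent_space[OF \<psi>N[OF that]]] unfolding field_along_def by blast
    obtain \<Psi>' where "smooth_variation M A N \<psi> \<Psi>'" "\<And>x. x \<in> M \<Longrightarrow> ((\<lambda>t. \<Psi>' t x) has_vector_derivative
        (\<Sum>y\<in>F'. f y (\<psi> x)) *\<^sub>R \<xi>' x + f y (\<psi> x) *\<^sub>R \<xi>' x) (at (0::real))"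
      by (rule extend_variation[OF \<psi> \<Psi> T \<xi>' W(2-5) W(1) W(6-8)]) blast+
    then show ?case using insert.hyps by (intro exI[of _ \<Psi>']) (auto simp: algebra_simps)
  qed
  then obtain \<Psi> where \<Psi>: "smooth_variation M A N \<psi> \<Psi>"
    "\<And>x. x \<in> M \<Longrightarrow> ((\<lambda>t. \<Psi> t x) has_vector_derivative (\<Sum>y\<in>F. f y (\<psi> x)) *\<^sub>R \<xi>' x) (at (0::real))" by blast
  have "(\<Sum>y\<in>F. f y (\<psi> x)) *\<^sub>R \<xi>' x = \<xi> x" if "x \<in> M" for x
    using s_pos[OF that] by (simp add: \<xi>'_def s_def)
  then show thesis using \<Psi> by (intro that[of \<Psi>]) auto
qed

text \<open>Stability evaluates \<open>index_form\<close> on equal fields only, so a one-parameter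
  variation at time \<open>t + s\<close> has the right velocities; halving the radius keeps
  \<open>t + s\<close> in range.\<close>

lemma two_parameter_variation_exists:
  assumes \<psi>: "smooth_map_into M A N \<psi>" and \<xi>: "field_along M A N \<psi> \<xi>"
  obtains \<Psi> :: "real \<times> real \<Rightarrow> 'a \<Rightarrow> 'e" where "smooth_variation M A N \<psi> \<Psi>"
    "\<And>x. x \<in> M \<Longrightarrow> ((\<lambda>t. \<Psi> (t, 0) x) has_vector_derivative \<xi> x) (at 0)"
    "\<And>x. x \<in> M \<Longrightarrow> ((\<lambda>s. \<Psi> (0, s) x) has_vector_derivative \<xi> x) (at 0)"
proof -
  obtain \<Psi> :: "real \<Rightarrow> 'a \<Rightarrow> 'e" where \<Psi>: "smooth_variation M A N \<psi> \<Psi>"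
    "\<And>x. x \<in> M \<Longrightarrow> ((\<lambda>t. \<Psi> t x) has_vector_derivative \<xi> x) (at 0)"
    using variation_exists[OF assms] by blast
  obtain \<epsilon> where \<epsilon>: "\<epsilon> > 0" "smooth_family (ball 0 \<epsilon>) \<Psi>" "\<And>t x. t \<in> ball 0 \<epsilon> \<Longrightarrow> x \<in> M \<Longrightarrow> \<Psi> t x \<in> N"
    and \<Psi>0: "\<And>x. x \<in> M \<Longrightarrow> \<Psi> 0 x = \<psi> x"
    using \<Psi>(1) unfolding smooth_variation_iff by blast
  let ?\<Psi> = "\<lambda>p::real \<times> real. \<Psi> (fst p + snd p)"
  have b: "fst p + snd p \<in> ball 0 \<epsilon>" if "p \<in> ball 0 (\<epsilon> / 2)" for p :: "real \<times> real"
  proof -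
    have "\<bar>fst p\<bar> \<le> norm p" "\<bar>snd p\<bar> \<le> norm p"
      using norm_fst_le[of "fst p" "snd p"] norm_snd_le[of "snd p" "fst p"] by auto
    then show ?thesis using that by auto
  qed
  have "smooth_family (ball 0 (\<epsilon> / 2)) ?\<Psi>"
    unfolding smooth_family_def
  proof
    fix c assume c: "c \<in> A"
    let ?B = "ball (0::real \<times> real) (\<epsilon> / 2) \<times> chart_img c"
    have o: "open ?B" by (intro open_Times open_ball open_chart_img c)
    have "smooth_on (ball 0 \<epsilon> \<times> chart_img c) (\<lambda>(p, y). \<Psi> p (chart_inv c y))"
      using \<epsilon>(2) c unfolding smooth_family_def by blast
    then have "smooth_on ?B (\<lambda>z. (\<lambda>(p, y). \<Psi> p (chart_inv c y)) (fst (fst z) + snd (fst z), snd z))"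
      by (rule smooth_on_compose)
        (use b o in \<open>auto intro!: smooth_on_Pair smooth_on_add smooth_on_fst smooth_on_snd smooth_on_id\<close>)
    then show "smooth_on ?B (\<lambda>(p, y). ?\<Psi> p (chart_inv c y))" by (simp add: case_prod_beta')
  qed
  then have "smooth_variation M A N \<psi> ?\<Psi>"
    unfolding smooth_variation_iff using \<epsilon> b \<Psi>0 by (intro conjI exI[of _ "\<epsilon> / 2"]) auto
  then show thesis by (rule that) (use \<Psi>(2) in auto)
qed

end

section \<open>First and second variation\<close>

lemma has_derivative_along_line:
  fixes F :: "'p::real_normed_vector \<Rightarrow> 'b::real_normed_vector"
  assumes "(F has_derivative F') (at (p + h *\<^sub>R v))"
  shows "((\<lambda>h. F (p + h *\<^sub>R v)) has_vector_derivative F' v) (at h)"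
proof -
  have "((\<lambda>h. p + h *\<^sub>R v) has_derivative (\<lambda>s. s *\<^sub>R v)) (at h)"
    by (auto intro!: derivative_eq_intros)
  from diff_chain_at[OF this assms] show ?thesis
    unfolding has_vector_derivative_def using linear_scale[OF has_derivative_linear[OF assms]] by (simp add: o_def)
qed

context maps_setting
begin

definition alpha_first :: "real \<Rightarrow> ('a \<Rightarrow> 'e) \<Rightarrow> ('a \<Rightarrow> 'e) \<Rightarrow> 'a \<Rightarrow> real" where
  "alpha_first \<alpha> F V x = 2 * \<alpha> * (1 + hs_inner F F x) powr (\<alpha> - 1) * hs_inner F V x"

text \<open>The derivative of \<open>alpha_first\<close> when \<open>F\<close> moves with velocity
  \<open>U\<close> and \<open>V\<close> with velocity \<open>W\<close>. In the second variation
  \<open>W\<close> is the mixed second derivative.\<close>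

definition alpha_second :: "real \<Rightarrow> ('a \<Rightarrow> 'e) \<Rightarrow> ('a \<Rightarrow> 'e) \<Rightarrow> ('a \<Rightarrow> 'e) \<Rightarrow> ('a \<Rightarrow> 'e) \<Rightarrow> 'a \<Rightarrow> real" where
  "alpha_second \<alpha> F U V W x =
     4 * \<alpha> * (\<alpha> - 1) * (1 + hs_inner F F x) powr (\<alpha> - 2) * hs_inner F U x * hs_inner F V x +
     2 * \<alpha> * (1 + hs_inner F F x) powr (\<alpha> - 1) * (hs_inner F W x + hs_inner U V x)"

lemma hs_inner_nonneg: "hs_inner F F x \<ge> 0"
  unfolding hs_inner_def by (intro sum_nonneg) simp

lemma alpha_energy_eq: "alpha_energy \<alpha> M A G F = (\<integral>x. (1 + hs_inner F F x) powr \<alpha> \<partial>vol)"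
  by (simp add: alpha_energy_def hs_norm_sq_eq)

context
  fixes B :: "'p::euclidean_space set" and \<Psi> :: "'p \<Rightarrow> 'a \<Rightarrow> 'e"
  assumes B: "open B" and fam: "smooth_family B \<Psi>"
begin

lemma open_line: "open {h::real. p + h *\<^sub>R v \<in> B}"
proof -
  have "open ((\<lambda>h::real. p + h *\<^sub>R v) -` B)"
    by (rule continuous_open_vimage[OF B]) (auto intro!: continuous_intros)
  then show ?thesis by (simp add: vimage_def)
qed

lemma hs_inner_line_continuous:
  assumes "smooth_family B \<Phi>" "smooth_family B \<Phi>'"
  shows "continuous_on ({h::real. p + h *\<^sub>R v \<in> B} \<times> M)
    (\<lambda>z. hs_inner (\<Phi> (p + fst z *\<^sub>R v)) (\<Phi>' (p + fst z *\<^sub>R v)) (snd z))"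
proof -
  have "continuous_on ({h::real. p + h *\<^sub>R v \<in> B} \<times> M)
    (\<lambda>z. (\<lambda>z. hs_inner (\<Phi> (fst z)) (\<Phi>' (fst z)) (snd z)) (p + fst z *\<^sub>R v, snd z))"
    by (rule continuous_on_compose2[OF hs_inner_continuous[OF B assms]]) (auto intro!: continuous_intros)
  then show ?thesis by simp
qed

lemma hs_inner_line_derivative:
  assumes "smooth_family B \<Phi>" "smooth_family B \<Phi>'" "x \<in> M" "p + h *\<^sub>R v \<in> B"
  shows "((\<lambda>h. hs_inner (\<Phi> (p + h *\<^sub>R v)) (\<Phi>' (p + h *\<^sub>R v)) x) has_real_derivative
    hs_inner (\<Phi> (p + h *\<^sub>R v)) (param_deriv v \<Phi>' (p + h *\<^sub>R v)) x +
    hs_inner (param_deriv v \<Phi> (p + h *\<^sub>R v)) (\<Phi>' (p + h *\<^sub>R v)) x) (at h)"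
  using has_derivative_along_line[OF hs_inner_has_derivative[OF B assms(1,2,3,4)]]
  by (simp add: has_real_derivative_iff_has_vector_derivative)

lemma alpha_first_variation:
  assumes p: "p \<in> B"
  shows "((\<lambda>h. alpha_energy \<alpha> M A G (\<Psi> (p + h *\<^sub>R v))) has_real_derivative
    (\<integral>x. alpha_first \<alpha> (\<Psi> p) (param_deriv v \<Psi> p) x \<partial>vol)) (at 0)"
proof -
  let ?T = "{h::real. p + h *\<^sub>R v \<in> B}"
  let ?q = "\<lambda>z. hs_inner (\<Psi> (p + fst z *\<^sub>R v)) (\<Psi> (p + fst z *\<^sub>R v)) (snd z)"
  let ?f = "\<lambda>z. (1 + ?q z) powr \<alpha>"
  let ?f' = "\<lambda>z. alpha_first \<alpha> (\<Psi> (p + fst z *\<^sub>R v)) (param_deriv v \<Psi> (p + fst z *\<^sub>R v)) (snd z)"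
  note famv = smooth_family_param_deriv[OF B fam, of v]
  \<comment> \<open>The summand 1 keeps the base of \<open>powr\<close> positive, so the density can
    be differentiated for a real exponent even where the differential vanishes.\<close>
  have pos: "1 + ?q z > 0" for z by (rule add_pos_nonneg[OF zero_less_one hs_inner_nonneg])
  then have nz: "1 + ?q z \<noteq> 0" for z by (metis less_irrefl)
  have c: "continuous_on (?T \<times> M) ?q" by (rule hs_inner_line_continuous[OF fam fam])
  have "((\<lambda>h. \<integral>x. ?f (h, x) \<partial>vol) has_real_derivative (\<integral>x. ?f' (0, x) \<partial>vol)) (at 0)"
  proof (rule has_real_derivative_integral)
    show "open ?T" by (rule open_line)
    show "0 \<in> ?T" using p by simp
    show "continuous_on (?T \<times> M) ?f"
      by (intro continuous_on_powr continuous_on_add continuous_on_const c ballI nz)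
    show "continuous_on (?T \<times> M) ?f'"
      unfolding alpha_first_def
      by (intro continuous_on_powr continuous_on_mult continuous_on_add continuous_on_const c
          hs_inner_line_continuous[OF fam famv] ballI nz)
    fix h x assume h: "h \<in> ?T" and x: "x \<in> M"
    have D: "((\<lambda>h. 1 + ?q (h, x)) has_real_derivative
        2 * hs_inner (\<Psi> (p + h *\<^sub>R v)) (param_deriv v \<Psi> (p + h *\<^sub>R v)) x) (at h)"
      using hs_inner_line_derivative[OF fam fam x, of p h v] h
      by (auto intro!: derivative_eq_intros simp: hs_inner_commute)
    show "((\<lambda>h. ?f (h, x)) has_real_derivative ?f' (h, x)) (at h)"
      using DERIV_fun_powr[OF D pos, of \<alpha>] by (simp add: alpha_first_def mult_ac)
  qed
  then show ?thesis by (simp add: alpha_energy_eq)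
qed

lemma alpha_second_variation:
  assumes p: "p \<in> B"
  shows "((\<lambda>h. \<integral>x. alpha_first \<alpha> (\<Psi> (p + h *\<^sub>R u)) (param_deriv v \<Psi> (p + h *\<^sub>R u)) x \<partial>vol) has_real_derivative
    (\<integral>x. alpha_second \<alpha> (\<Psi> p) (param_deriv u \<Psi> p) (param_deriv v \<Psi> p) (param_deriv u (param_deriv v \<Psi>) p) x \<partial>vol)) (at 0)"
proof -
  let ?T = "{h::real. p + h *\<^sub>R u \<in> B}"
  let ?F = "\<lambda>h. \<Psi> (p + h *\<^sub>R u)" and ?U = "\<lambda>h. param_deriv u \<Psi> (p + h *\<^sub>R u)"
    and ?V = "\<lambda>h. param_deriv v \<Psi> (p + h *\<^sub>R u)" and ?W = "\<lambda>h. param_deriv u (param_deriv v \<Psi>) (p + h *\<^sub>R u)"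
  let ?q = "\<lambda>z. hs_inner (?F (fst z)) (?F (fst z)) (snd z)"
  let ?f = "\<lambda>z. alpha_first \<alpha> (?F (fst z)) (?V (fst z)) (snd z)"
  let ?f' = "\<lambda>z. alpha_second \<alpha> (?F (fst z)) (?U (fst z)) (?V (fst z)) (?W (fst z)) (snd z)"
  note famu = smooth_family_param_deriv[OF B fam, of u]
  note famv = smooth_family_param_deriv[OF B fam, of v]
  note famw = smooth_family_param_deriv[OF B famv, of u]
  have pos: "1 + ?q z > 0" for z by (rule add_pos_nonneg[OF zero_less_one hs_inner_nonneg])
  then have nz: "1 + ?q z \<noteq> 0" for z by (metis less_irrefl)
  note c = hs_inner_line_continuous[OF fam fam] hs_inner_line_continuous[OF fam famv]
    hs_inner_line_continuous[OF fam famu] hs_inner_line_continuous[OF fam famw] hs_inner_line_continuous[OF famu famv]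
  have "((\<lambda>h. \<integral>x. ?f (h, x) \<partial>vol) has_real_derivative (\<integral>x. ?f' (0, x) \<partial>vol)) (at 0)"
  proof (rule has_real_derivative_integral)
    show "open ?T" by (rule open_line)
    show "0 \<in> ?T" using p by simp
    show "continuous_on (?T \<times> M) ?f"
      unfolding alpha_first_def
      by (intro continuous_on_powr continuous_on_mult continuous_on_add continuous_on_const c ballI nz)
    show "continuous_on (?T \<times> M) ?f'"
      unfolding alpha_second_def
      by (intro continuous_on_powr continuous_on_mult continuous_on_add continuous_on_const c ballI nz)
    fix h x assume h: "h \<in> ?T" and x: "x \<in> M"
    have D: "((\<lambda>h. 1 + ?q (h, x)) has_real_derivative 2 * hs_inner (?F h) (?U h) x) (at h)"
      using hs_inner_line_derivative[OF fam fam x, of p h u] h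
      by (auto intro!: derivative_eq_intros simp: hs_inner_commute)
    have D2: "((\<lambda>h. hs_inner (?F h) (?V h) x) has_real_derivative hs_inner (?F h) (?W h) x + hs_inner (?U h) (?V h) x) (at h)"
      using hs_inner_line_derivative[OF fam famv x, of p h u] h by simp
    let ?k = "(\<alpha> - 1) * (1 + ?q (h, x)) powr (\<alpha> - 2) * (2 * hs_inner (?F h) (?U h) x)"
    have D3: "((\<lambda>h. (1 + ?q (h, x)) powr (\<alpha> - 1)) has_real_derivative ?k) (at h)"
      using DERIV_fun_powr[OF D pos, of "\<alpha> - 1"] by (simp add: mult_ac)
    have "((\<lambda>h. 2 * \<alpha> * ((1 + ?q (h, x)) powr (\<alpha> - 1) * hs_inner (?F h) (?V h) x)) has_real_derivative
      2 * \<alpha> * (?k * hs_inner (?F h) (?V h) x +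
        (hs_inner (?F h) (?W h) x + hs_inner (?U h) (?V h) x) * (1 + ?q (h, x)) powr (\<alpha> - 1))) (at h)"
      by (rule DERIV_cmult[OF DERIV_mult[OF D3 D2]])
    then show "((\<lambda>h. ?f (h, x)) has_real_derivative ?f' (h, x)) (at h)"
      by (simp add: alpha_first_def alpha_second_def algebra_simps)
  qed
  then show ?thesis by simp
qed

lemma param_has_vector_derivative:
  assumes "x \<in> M" "p + h *\<^sub>R v \<in> B"
  shows "((\<lambda>h. \<Psi> (p + h *\<^sub>R v) x) has_vector_derivative param_deriv v \<Psi> (p + h *\<^sub>R v) x) (at h)"
  by (rule has_derivative_along_line[OF param_has_derivative[OF B fam assms]])

lemma param_deriv_tangent:
  assumes inN: "\<And>p x. p \<in> B \<Longrightarrow> x \<in> M \<Longrightarrow> \<Psi> p x \<in> N" and x: "x \<in> M" and p: "p \<in> B"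
  shows "param_deriv v \<Psi> p x \<in> tangent_space N (\<Psi> p x)"
proof -
  have "0 \<in> {h::real. p + h *\<^sub>R v \<in> B}" using p by simp
  then obtain \<epsilon> where \<epsilon>: "\<epsilon> > 0" "ball 0 \<epsilon> \<subseteq> {h::real. p + h *\<^sub>R v \<in> B}"
    using open_line open_contains_ball by blast
  then have b: "p + h *\<^sub>R v \<in> B" if "h \<in> {-\<epsilon><..<\<epsilon>}" for h
    using that by (auto simp: subset_iff abs_less_iff)
  obtain c where c: "c \<in> A" "x \<in> chart_dom c" using chart_at x by blast
  have "smooth_on {-\<epsilon><..<\<epsilon>} (\<lambda>h. (\<lambda>(p, y). \<Psi> p (chart_inv c y)) (p + h *\<^sub>R v, chart_map c x))"
    by (rule smooth_on_compose[OF smooth_family_chart[OF B fam c(1)]])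
      (use b c in \<open>auto intro!: smooth_intros\<close>)
  then have "smooth_on {-\<epsilon><..<\<epsilon>} (\<lambda>h. \<Psi> (p + h *\<^sub>R v) x)" by (simp add: chart_inv_map[OF c])
  moreover have "((\<lambda>h. \<Psi> (p + h *\<^sub>R v) x) has_vector_derivative param_deriv v \<Psi> p x) (at 0)"
    using param_has_vector_derivative[OF x, of p 0 v] p by simp
  ultimately show ?thesis unfolding tangent_space_def using \<epsilon>(1) b inN x
    by (intro CollectI exI[of _ "\<lambda>h. \<Psi> (p + h *\<^sub>R v) x"] exI[of _ \<epsilon>]) auto
qed

end

section \<open>Criticality in weak form and evaluation of the index form\<close>

text \<open>Variations start from \<open>\<psi>\<close> on \<open>M\<close> only, while maps are
  functions on the whole type; derivatives in charts see points of \<open>M\<close> alone.\<close>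

lemma hs_inner_cong:
  assumes "x \<in> M" "diff_at F x" "diff_at H x" "\<And>y. y \<in> M \<Longrightarrow> F y = F' y" "\<And>y. y \<in> M \<Longrightarrow> H y = H' y"
  shows "hs_inner F H x = hs_inner F' H' x"
  unfolding hs_inner_def using frame_deriv_cong[OF assms(1,2)] frame_deriv_cong[OF assms(1,3)] assms(4,5) by simp

lemma hs_inner_continuous_on:
  assumes "smooth_from A F" "smooth_from A H"
  shows "continuous_on M (hs_inner F H)"
proof -
  have "smooth_family (UNIV :: real set) (\<lambda>p. F)" "smooth_family (UNIV :: real set) (\<lambda>p. H)"
    by (rule smooth_family_const[OF open_UNIV], rule assms)+
  from continuous_on_slice[OF hs_inner_continuous[OF open_UNIV this], of 0] show ?thesis by simp
qed

lemma alpha_first_continuous: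
  assumes "smooth_from A F" "smooth_from A V"
  shows "continuous_on M (alpha_first \<alpha> F V)"
proof -
  have "1 + hs_inner F F x \<noteq> 0" for x using hs_inner_nonneg[of F x] by linarith
  then show ?thesis unfolding alpha_first_def[abs_def]
    by (intro continuous_on_powr continuous_on_mult continuous_on_add continuous_on_const
        hs_inner_continuous_on assms ballI)
qed

lemma alpha_second_continuous:
  assumes "smooth_from A F" "smooth_from A U" "smooth_from A V" "smooth_from A W"
  shows "continuous_on M (alpha_second \<alpha> F U V W)"
proof -
  have "1 + hs_inner F F x \<noteq> 0" for x using hs_inner_nonneg[of F x] by linarith
  then show ?thesis unfolding alpha_second_def[abs_def]
    by (intro continuous_on_powr continuous_on_mult continuous_on_add continuous_on_const
        hs_inner_continuous_on assms ballI)
qed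

text \<open>\<open>alpha_harmonic\<close> speaks about variations. Since every field along the map
  is the velocity of some variation, it yields a statement about all fields.\<close>

lemma alpha_harmonic_weak:
  assumes harm: "alpha_harmonic \<alpha> M A G N \<psi>" and \<xi>: "field_along M A N \<psi> \<xi>"
  shows "(\<integral>x. alpha_first \<alpha> \<psi> \<xi> x \<partial>vol) = 0"
proof -
  have \<psi>: "smooth_map_into M A N \<psi>" using harm by (simp add: alpha_harmonic_def)
  obtain \<Psi> where \<Psi>: "smooth_variation M A N \<psi> \<Psi>"
    "\<And>x. x \<in> M \<Longrightarrow> ((\<lambda>t. \<Psi> t x) has_vector_derivative \<xi> x) (at (0::real))"
    using variation_exists[OF \<psi> \<xi>] by blast
  obtain \<epsilon> where \<epsilon>: "\<epsilon> > 0" "smooth_family (ball 0 \<epsilon>) \<Psi>" and \<Psi>0: "\<And>x. x \<in> M \<Longrightarrow> \<Psi> 0 x = \<psi> x"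
    using \<Psi>(1) unfolding smooth_variation_iff by blast
  have 0: "0 \<in> ball (0::real) \<epsilon>" using \<epsilon>(1) by simp
  note dfam = smooth_family_param_deriv[OF open_ball \<epsilon>(2)]
  have v: "param_deriv 1 \<Psi> 0 x = \<xi> x" if "x \<in> M" for x
    using param_has_vector_derivative[OF open_ball \<epsilon>(2) that, of 0 0 1] \<Psi>(2)[OF that] 0
    by (simp add: vector_derivative_unique_at)
  have "((\<lambda>t. alpha_energy \<alpha> M A G (\<Psi> t)) has_real_derivative 0) (at 0)"
    using harm \<Psi>(1) by (simp add: alpha_harmonic_def)
  moreover have "((\<lambda>t. alpha_energy \<alpha> M A G (\<Psi> t)) has_real_derivative
      (\<integral>x. alpha_first \<alpha> (\<Psi> 0) (param_deriv 1 \<Psi> 0) x \<partial>vol)) (at 0)"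
    using alpha_first_variation[OF open_ball \<epsilon>(2) 0, of \<alpha> 1] by simp
  ultimately have "(\<integral>x. alpha_first \<alpha> (\<Psi> 0) (param_deriv 1 \<Psi> 0) x \<partial>vol) = 0" using DERIV_unique by blast
  moreover have "alpha_first \<alpha> (\<Psi> 0) (param_deriv 1 \<Psi> 0) x = alpha_first \<alpha> \<psi> \<xi> x" if x: "x \<in> M" for x
  proof -
    have d: "diff_at (\<Psi> 0) x" "diff_at (param_deriv 1 \<Psi> 0) x"
      using smooth_family_diff_at[OF open_ball \<epsilon>(2) 0] smooth_family_diff_at[OF open_ball dfam 0] by blast+
    show ?thesis unfolding alpha_first_def
      using hs_inner_cong[OF x d(1) d(1) \<Psi>0 \<Psi>0] hs_inner_cong[OF x d \<Psi>0 v] by simp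
  qed
  then have "(\<integral>x. alpha_first \<alpha> (\<Psi> 0) (param_deriv 1 \<Psi> 0) x \<partial>vol) = (\<integral>x. alpha_first \<alpha> \<psi> \<xi> x \<partial>vol)"
    by (intro Bochner_Integration.integral_cong) (auto simp: space_vol)
  ultimately show ?thesis by simp
qed

lemma hs_inner_add_right:
  assumes "x \<in> M" "smooth_from A F" "smooth_from A F'"
  shows "hs_inner H (\<lambda>x. F x + F' x) x = hs_inner H F x + hs_inner H F' x"
proof -
  define c where "c = chart_of x"
  have c: "c \<in> A" "x \<in> chart_dom c" using chart_of[OF assms(1)] by (auto simp: c_def)
  have "F \<circ> chart_inv c differentiable (at (chart_map c x))" "F' \<circ> chart_inv c differentiable (at (chart_map c x))"
    using smooth_from_diff_at[OF assms(2)] smooth_from_diff_at[OF assms(3)] c unfolding diff_at_def by blast+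
  from has_derivative_add[OF this[unfolded frechet_derivative_works]]
  have "(((\<lambda>x. F x + F' x) \<circ> chart_inv c) has_derivative
      (\<lambda>w. frechet_derivative (F \<circ> chart_inv c) (at (chart_map c x)) w +
        frechet_derivative (F' \<circ> chart_inv c) (at (chart_map c x)) w)) (at (chart_map c x))"
    by (simp add: o_def)
  from fun_cong[OF frechet_derivative_at[OF this]]
  have "frame_deriv (\<lambda>x. F x + F' x) x i = frame_deriv F x i + frame_deriv F' x i" for i
    unfolding frame_deriv_def c_def[symmetric] by simp
  then show ?thesis by (simp add: hs_inner_def inner_add_right sum.distrib)
qed

lemma smooth_from_along:
  fixes F :: "'e \<Rightarrow> 'b::real_normed_vector"
  assumes F: "smooth_along N F" and \<psi>: "smooth_map_into M A N \<psi>"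
  shows "smooth_from A (\<lambda>x. F (\<psi> x))"
proof (rule smooth_fromI)
  fix c assume c: "c \<in> A"
  have s: "smooth_on (chart_img c) (\<lambda>y. \<psi> (chart_inv c y))"
    using \<psi> smooth_fromD[OF _ c] unfolding smooth_map_into_def by blast
  have inN: "\<psi> (chart_inv c y) \<in> N" if "y \<in> chart_img c" for y
    using \<psi> chart_inv_in[OF c that] chart_dom_subset[OF c] unfolding smooth_map_into_def by blast
  show "smooth_on (chart_img c) (\<lambda>y. F (\<psi> (chart_inv c y)))"
  proof (rule smooth_on_locally)
    fix y assume y: "y \<in> chart_img c"
    obtain U F' where U: "open U" "\<psi> (chart_inv c y) \<in> U" "smooth_on U F'" "\<And>z. z \<in> U \<Longrightarrow> z \<in> N \<Longrightarrow> F' z = F z"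
      by (rule smooth_along_local_extension[OF F inN[OF y]]) blast
    let ?T = "chart_img c \<inter> (\<lambda>y. \<psi> (chart_inv c y)) -` U"
    have T: "open ?T"
      by (rule continuous_open_preimage[OF smooth_on_continuous_on[OF s] open_chart_img[OF c] U(1)])
    have "smooth_on ?T (\<lambda>y. F' (\<psi> (chart_inv c y)))"
      by (rule smooth_on_compose[OF U(3) smooth_on_subset[OF s] _ T]) auto
    then have "smooth_on ?T (\<lambda>y. F (\<psi> (chart_inv c y)))"
      by (rule smooth_on_cong[OF T]) (use U(4) inN in auto)
    then show "\<exists>T. open T \<and> y \<in> T \<and> smooth_on T (\<lambda>y. F (\<psi> (chart_inv c y)))"
      using T y U(2) by (intro exI[of _ ?T]) auto
  qed
qed

text \<open>The curve is the coordinate line in the direction of the frame vector. It turns frame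
  derivatives into velocities, which links them with tangent vectors and with derivatives within
  \<open>N\<close>, and it is the same curve for all maps \<open>F\<close>.\<close>

lemma frame_deriv_curve:
  fixes F :: "'a \<Rightarrow> 'b::euclidean_space"
  assumes x: "x \<in> M"
  obtains \<epsilon> k where "\<epsilon> > (0::real)" "k 0 = x" "\<And>t. t \<in> {-\<epsilon><..<\<epsilon>} \<Longrightarrow> k t \<in> M"
    "\<And>F :: 'a \<Rightarrow> 'b. smooth_from A F \<Longrightarrow> smooth_on {-\<epsilon><..<\<epsilon>} (\<lambda>t. F (k t))"
    "\<And>F :: 'a \<Rightarrow> 'b. smooth_from A F \<Longrightarrow> ((\<lambda>t. F (k t)) has_vector_derivative frame_deriv F x i) (at 0)"
proof -
  define c where "c = chart_of x"
  have c: "c \<in> A" "x \<in> chart_dom c" using chart_of[OF x] by (auto simp: c_def)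
  define y where "y = chart_map c x"
  define e where "e = frame_of x i"
  let ?l = "\<lambda>t::real. y + t *\<^sub>R e"
  have "open (?l -` chart_img c)"
    by (rule continuous_open_vimage[OF open_chart_img[OF c(1)]]) (auto intro!: continuous_intros)
  moreover have "0 \<in> ?l -` chart_img c" using c by (simp add: y_def)
  ultimately obtain \<epsilon> where \<epsilon>: "\<epsilon> > 0" "ball 0 \<epsilon> \<subseteq> ?l -` chart_img c" using open_contains_ball by blast
  then have im: "?l t \<in> chart_img c" if "t \<in> {-\<epsilon><..<\<epsilon>}" for t
    using that by (auto simp: subset_iff abs_less_iff)
  show thesis
  proof (rule that[of \<epsilon> "\<lambda>t. chart_inv c (?l t)"])
    show "\<epsilon> > 0" by (rule \<epsilon>)
    show "chart_inv c (y + 0 *\<^sub>R e) = x" by (simp add: y_def chart_inv_map[OF c])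
    show "chart_inv c (?l t) \<in> M" if "t \<in> {-\<epsilon><..<\<epsilon>}" for t
      using chart_inv_in[OF c(1) im[OF that]] chart_dom_subset[OF c(1)] by blast
    fix F :: "'a \<Rightarrow> 'b" assume F: "smooth_from A F"
    note s = smooth_fromD[OF F c(1)]
    show "smooth_on {-\<epsilon><..<\<epsilon>} (\<lambda>t. F (chart_inv c (?l t)))"
      by (rule smooth_on_compose[OF s]) (use im in \<open>auto intro!: smooth_intros\<close>)
    have "((F \<circ> chart_inv c) has_derivative frechet_derivative (F \<circ> chart_inv c) (at y)) (at (y + 0 *\<^sub>R e))"
      using smooth_on_has_derivative[OF s, of y] c(2) by (simp add: o_def y_def)
    from has_derivative_along_line[OF this]
    show "((\<lambda>t. F (chart_inv c (?l t))) has_vector_derivative frame_deriv F x i) (at 0)"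
      by (simp add: frame_deriv_def c_def[symmetric] y_def[symmetric] e_def[symmetric])
  qed
qed

lemma frame_deriv_tangent:
  assumes \<psi>: "smooth_map_into M A N \<psi>" and x: "x \<in> M"
  shows "frame_deriv \<psi> x i \<in> tangent_space N (\<psi> x)"
proof -
  have s: "smooth_from A \<psi>" and inN: "\<And>y. y \<in> M \<Longrightarrow> \<psi> y \<in> N" using \<psi> by (auto simp: smooth_map_into_def)
  obtain \<epsilon> k where k: "\<epsilon> > (0::real)" "k 0 = x" "\<And>t. t \<in> {-\<epsilon><..<\<epsilon>} \<Longrightarrow> k t \<in> M"
    "\<And>F :: 'a \<Rightarrow> 'e. smooth_from A F \<Longrightarrow> smooth_on {-\<epsilon><..<\<epsilon>} (\<lambda>t. F (k t))"
    "\<And>F :: 'a \<Rightarrow> 'e. smooth_from A F \<Longrightarrow> ((\<lambda>t. F (k t)) has_vector_derivative frame_deriv F x i) (at 0)"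
    by (rule frame_deriv_curve[OF x, where i = i and 'b = 'e]) blast
  show ?thesis unfolding tangent_space_def
    using k(1,2) k(3) k(4)[OF s] k(5)[OF s] inN
    by (intro CollectI exI[of _ "\<lambda>t. \<psi> (k t)"] exI[of _ \<epsilon>]) auto
qed

lemma frame_deriv_along:
  fixes F :: "'e \<Rightarrow> 'e"
  assumes F: "smooth_along N F" and \<psi>: "smooth_map_into M A N \<psi>" and x: "x \<in> M"
  shows "frame_deriv (\<lambda>x. F (\<psi> x)) x i = dir_deriv N F (\<psi> x) (frame_deriv \<psi> x i)"
proof -
  have s: "smooth_from A \<psi>" and inN: "\<And>y. y \<in> M \<Longrightarrow> \<psi> y \<in> N" using \<psi> by (auto simp: smooth_map_into_def)
  obtain \<epsilon> k where k: "\<epsilon> > (0::real)" "k 0 = x" "\<And>t. t \<in> {-\<epsilon><..<\<epsilon>} \<Longrightarrow> k t \<in> M"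
    "\<And>F :: 'a \<Rightarrow> 'e. smooth_from A F \<Longrightarrow> ((\<lambda>t. F (k t)) has_vector_derivative frame_deriv F x i) (at 0)"
    by (rule frame_deriv_curve[OF x, where i = i and 'b = 'e]) blast
  have "(F has_derivative dir_deriv N F (\<psi> x)) (at (\<psi> (k 0)) within N)"
    using smooth_along_has_derivative[OF F inN[OF x]] k(2) by simp
  from has_vector_derivative_compose_within[OF this k(4)[OF s] k(1)]
  have "((\<lambda>t. F (\<psi> (k t))) has_vector_derivative dir_deriv N F (\<psi> x) (frame_deriv \<psi> x i)) (at 0)"
    using inN k(3) by blast
  then show ?thesis
    using vector_derivative_unique_at[OF k(4)[OF smooth_from_along[OF F \<psi>]]] by blast
qed

text \<open>
  The tangential part of the mixed derivative of the variation drops out by the weak Euler-Lagrange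
  equation, so that the value does not depend on the variation chosen in \<open>index_form\<close>.
\<close>

lemma index_form_eq:
  assumes harm: "alpha_harmonic \<alpha> M A G N \<psi>" and \<omega>: "field_along M A N \<psi> \<omega>"
    and \<nu>: "smooth_from A \<nu>" "\<And>x. x \<in> M \<Longrightarrow> \<nu> x = dproj (\<psi> x) (\<omega> x) (\<omega> x)"
  shows "index_form \<alpha> M A G N \<psi> \<omega> \<omega> = (\<integral>x. alpha_second \<alpha> \<psi> \<omega> \<omega> \<nu> x \<partial>vol)"
proof -
  have \<psi>: "smooth_map_into M A N \<psi>" using harm by (simp add: alpha_harmonic_def)
  have s\<psi>: "smooth_from A \<psi>" and inN: "\<And>y. y \<in> M \<Longrightarrow> \<psi> y \<in> N" using \<psi> by (auto simp: smooth_map_into_def)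
  define Q where "Q \<Psi> \<longleftrightarrow> smooth_variation M A N \<psi> \<Psi> \<and>
                 (\<forall>x\<in>M. ((\<lambda>t. \<Psi> (t, 0) x) has_vector_derivative \<omega> x) (at 0) \<and>
                        ((\<lambda>s. \<Psi> (0, s) x) has_vector_derivative \<omega> x) (at 0))" for \<Psi> :: "real \<times> real \<Rightarrow> 'a \<Rightarrow> 'e"
  define \<Psi> where "\<Psi> = (SOME \<Psi>. Q \<Psi>)"
  have "\<exists>\<Psi>. Q \<Psi>" using two_parameter_variation_exists[OF \<psi> \<omega>] unfolding Q_def by metis
  then have Q: "Q \<Psi>" unfolding \<Psi>_def by (rule someI_ex)
  obtain \<epsilon> where \<epsilon>: "\<epsilon> > 0" "smooth_family (ball 0 \<epsilon>) \<Psi>" "\<And>t x. t \<in> ball 0 \<epsilon> \<Longrightarrow> x \<in> M \<Longrightarrow> \<Psi> t x \<in> N"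
    and \<Psi>0: "\<And>x. x \<in> M \<Longrightarrow> \<Psi> 0 x = \<psi> x"
    using Q unfolding Q_def smooth_variation_iff by blast
  let ?t = "(1::real, 0::real)" and ?s = "(0::real, 1::real)"
  let ?B = "ball (0::real \<times> real) \<epsilon>"
  note fam = \<epsilon>(2)
  note famt = smooth_family_param_deriv[OF open_ball fam, of ?t] and fams = smooth_family_param_deriv[OF open_ball fam, of ?s]
  note famts = smooth_family_param_deriv[OF open_ball fams, of ?t]
  have 0: "0 \<in> ?B" using \<epsilon>(1) by simp
  let ?V = "param_deriv ?s \<Psi>"
  define \<eta> where "\<eta> = param_deriv ?t ?V 0"
  have vt: "param_deriv ?t \<Psi> 0 x = \<omega> x" and vs: "?V 0 x = \<omega> x" if x: "x \<in> M" for x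
  proof -
    have "((\<lambda>h. \<Psi> (h, 0) x) has_vector_derivative param_deriv ?t \<Psi> 0 x) (at 0)"
      "((\<lambda>h. \<Psi> (0, h) x) has_vector_derivative ?V 0 x) (at 0)"
      using param_has_vector_derivative[OF open_ball fam x, of 0 0 ?t]
        param_has_vector_derivative[OF open_ball fam x, of 0 0 ?s] \<epsilon>(1) by (simp_all add: zero_prod_def)
    then show "param_deriv ?t \<Psi> 0 x = \<omega> x" "?V 0 x = \<omega> x"
      using Q x vector_derivative_unique_at unfolding Q_def by blast+
  qed
  let ?E1 = "\<lambda>h. \<integral>x. alpha_first \<alpha> (\<Psi> (0 + h *\<^sub>R ?t)) (?V (0 + h *\<^sub>R ?t)) x \<partial>vol"
  \<comment> \<open>The outer derivative at 0 sees only small \<open>h\<close>, for which the first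
    variation formula is available.\<close>
  have inner: "deriv (\<lambda>s. alpha_energy \<alpha> M A G (\<Psi> (h, s))) 0 = ?E1 h" if "h \<in> {-\<epsilon><..<\<epsilon>}" for h
  proof -
    have "h *\<^sub>R ?t \<in> ?B" using that by (simp add: norm_Pair abs_less_iff)
    from alpha_first_variation[OF open_ball fam this, of \<alpha> ?s] show ?thesis
      by (intro DERIV_imp_deriv) simp
  qed
  have "(?E1 has_real_derivative (\<integral>x. alpha_second \<alpha> (\<Psi> 0) (param_deriv ?t \<Psi> 0) (?V 0) \<eta> x \<partial>vol)) (at 0)"
    unfolding \<eta>_def by (rule alpha_second_variation[OF open_ball fam 0])
  then have "((\<lambda>h. deriv (\<lambda>s. alpha_energy \<alpha> M A G (\<Psi> (h, s))) 0) has_real_derivative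
      (\<integral>x. alpha_second \<alpha> (\<Psi> 0) (param_deriv ?t \<Psi> 0) (?V 0) \<eta> x \<partial>vol)) (at 0)"
    by (rule has_field_derivative_transform_within_open[where S = "{-\<epsilon><..<\<epsilon>}"]) (use \<epsilon>(1) inner in auto)
  then have I1: "index_form \<alpha> M A G N \<psi> \<omega> \<omega> =
      (\<integral>x. alpha_second \<alpha> (\<Psi> 0) (param_deriv ?t \<Psi> 0) (?V 0) \<eta> x \<partial>vol)"
    unfolding index_form_def Let_def Q_def[symmetric] \<Psi>_def[symmetric] by (rule DERIV_imp_deriv)
  have s\<eta>: "smooth_from A \<eta>" unfolding \<eta>_def by (rule smooth_family_smooth_from[OF famts 0])
  \<comment> \<open>The velocity \<open>?V\<close> in the second parameter is a tangent field along
    the curve obtained by moving the first parameter; its derivative at 0 is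
    \<open>\<eta> x\<close>, and \<open>normal_of_curve_derivative\<close> gives the normal
    part.\<close>
  have normal: "\<eta> x - tproj N (\<psi> x) (\<eta> x) = \<nu> x" if x: "x \<in> M" for x
  proof -
    have b: "(t, 0) \<in> ?B" if "t \<in> {-\<epsilon><..<\<epsilon>}" for t :: real using that by (simp add: norm_Pair abs_less_iff)
    have 1: "((\<lambda>t. \<Psi> (t, 0) x) has_vector_derivative \<omega> x) (at 0)" using Q x by (simp add: Q_def)
    have 2: "((\<lambda>t. ?V (t, 0) x) has_vector_derivative \<eta> x) (at 0)"
      using param_has_vector_derivative[OF open_ball fams x, of 0 0 ?t] \<epsilon>(1) by (simp add: \<eta>_def zero_prod_def)
    have z: "\<Psi> (0, 0) x = \<psi> x" "?V (0, 0) x = \<omega> x"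
      using \<Psi>0[OF x] vs[OF x] by (simp_all add: zero_prod_def)
    have "\<eta> x - tproj N (\<Psi> (0, 0) x) (\<eta> x) = dproj (\<Psi> (0, 0) x) (\<omega> x) (?V (0, 0) x)"
    proof (rule normal_of_curve_derivative[OF 1 \<epsilon>(1) _ _ 2])
      show "\<Psi> (t, 0) x \<in> N" if "t \<in> {-\<epsilon><..<\<epsilon>}" for t using \<epsilon>(3)[OF b[OF that] x] .
      show "\<omega> x \<in> tangent_space N (\<Psi> (0, 0) x)" using \<omega> x z by (simp add: field_along_def)
      show "?V (t, 0) x \<in> tangent_space N (\<Psi> (t, 0) x)" if "t \<in> {-\<epsilon><..<\<epsilon>}" for t
        by (rule param_deriv_tangent[OF open_ball fam \<epsilon>(3) x b[OF that]])
    qed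
    then show ?thesis using z \<nu>(2)[OF x] by simp
  qed
  \<comment> \<open>Written as a sum over the basis so that smoothness is visible; on
    \<open>M\<close> it is the tangential part of \<open>\<eta>\<close>.\<close>
  define \<tau> where "\<tau> x = (\<Sum>b\<in>Basis. (\<eta> x \<bullet> b) *\<^sub>R tproj N (\<psi> x) b)" for x
  have \<tau>_eq: "\<tau> x = tproj N (\<psi> x) (\<eta> x)" if "x \<in> M" for x
    unfolding \<tau>_def by (rule tproj_expand[OF inN[OF that], symmetric])
  have s\<tau>: "smooth_from A \<tau>"
    unfolding \<tau>_def[abs_def]
    by (intro smooth_from_sum smooth_from_bilinear[OF bounded_bilinear_scaleR]
        smooth_from_bilinear[OF bounded_bilinear_inner] s\<eta> smooth_from_const smooth_from_along[OF smooth_along_tproj \<psi>])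
  have \<tau>: "field_along M A N \<psi> \<tau>"
    unfolding field_along_def using s\<tau> \<tau>_eq tproj_in[OF inN] by auto
  \<comment> \<open>The last field argument of \<open>alpha_second\<close> enters through a single
    inner product whose coefficient is that of \<open>alpha_first\<close>; the tangential part thus
    contributes exactly a first variation.\<close>
  have pt: "alpha_second \<alpha> (\<Psi> 0) (param_deriv ?t \<Psi> 0) (?V 0) \<eta> x =
      alpha_second \<alpha> \<psi> \<omega> \<omega> \<nu> x + alpha_first \<alpha> \<psi> \<tau> x" if x: "x \<in> M" for x
  proof -
    have d: "diff_at (\<Psi> 0) x" "diff_at (param_deriv ?t \<Psi> 0) x" "diff_at (?V 0) x" "diff_at \<eta> x" "diff_at \<psi> x"
      using smooth_family_diff_at[OF open_ball fam 0] smooth_family_diff_at[OF open_ball famt 0]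
        smooth_family_diff_at[OF open_ball fams 0] smooth_from_diff_at[OF s\<eta>] smooth_from_diff_at[OF s\<psi>] by blast+
    have "\<eta> y = \<nu> y + \<tau> y" if "y \<in> M" for y using normal[OF that] \<tau>_eq[OF that] by (simp add: algebra_simps)
    from hs_inner_cong[OF x d(1,4) \<Psi>0 this]
    have "hs_inner (\<Psi> 0) \<eta> x = hs_inner \<psi> \<nu> x + hs_inner \<psi> \<tau> x"
      using hs_inner_add_right[OF x \<nu>(1) s\<tau>] by simp
    then show ?thesis unfolding alpha_second_def alpha_first_def
      using hs_inner_cong[OF x d(1,1) \<Psi>0 \<Psi>0] hs_inner_cong[OF x d(1,2) \<Psi>0 vt]
        hs_inner_cong[OF x d(1,3) \<Psi>0 vs] hs_inner_cong[OF x d(2,3) vt vs]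
      by (simp add: algebra_simps)
  qed
  have "smooth_from A \<omega>" using \<omega> by (simp add: field_along_def)
  then have int: "integrable vol (alpha_second \<alpha> \<psi> \<omega> \<omega> \<nu>)" "integrable vol (alpha_first \<alpha> \<psi> \<tau>)"
    using integrable_continuous[OF alpha_second_continuous] integrable_continuous[OF alpha_first_continuous]
      s\<psi> \<nu>(1) s\<tau> by blast+
  have "index_form \<alpha> M A G N \<psi> \<omega> \<omega> = (\<integral>x. alpha_second \<alpha> \<psi> \<omega> \<omega> \<nu> x + alpha_first \<alpha> \<psi> \<tau> x \<partial>vol)"
    unfolding I1 by (rule Bochner_Integration.integral_cong) (auto simp: space_vol pt)
  also have "\<dots> = (\<integral>x. alpha_second \<alpha> \<psi> \<omega> \<omega> \<nu> x \<partial>vol)"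
    using int alpha_harmonic_weak[OF harm \<tau>] by simp
  finally show ?thesis .
qed

end

context submanifold
begin

section \<open>Normal fields and the averaging argument\<close>

text \<open>Smoothness is not apparent, as all arguments of \<open>dproj\<close> move with
  \<open>y\<close>; the expression is the normal part of the derivative of the field
  \<open>tproj N y a\<close> along itself, and that is built from smooth pieces.\<close>

lemma smooth_along_normal_square:
  "smooth_along N (\<lambda>y. dproj y (tproj N y a) (tproj N y a))"
proof -
  let ?X = "\<lambda>y. tproj N y a"
  have X: "?X \<in> vector_fields N" by (rule tproj_vector_field[OF smooth_along_const])
  have V: "smooth_along N (\<lambda>y. dir_deriv N ?X y (?X y))"
    by (rule smooth_along_dir_deriv[OF smooth_along_tproj X])
  show ?thesis
    by (rule smooth_along_cong[OF smooth_along_diff[OF V smooth_along_tproj_compose[OF V]]])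
      (rule normal_of_field_derivative[OF X _ tproj_in])
qed

text \<open>The Weingarten relation, obtained by differentiating \<open>P F = 0\<close> along
  \<open>u\<close>.\<close>

lemma tangential_derivative_of_normal_field:
  assumes F: "smooth_along N F" "\<And>y. y \<in> N \<Longrightarrow> tproj N y (F y) = 0"
    and x: "x \<in> N" and u: "u \<in> tangent_space N x"
  shows "u \<bullet> dir_deriv N F x u = - (dproj x u u \<bullet> F x)"
proof -
  have "0 = dir_deriv N (\<lambda>y. tproj N y (F y)) x u"
    using dir_deriv_cong[OF smooth_along_const x u, of 0 "\<lambda>y. tproj N y (F y)"] F(2)
    by (simp add: dir_deriv_const[OF u])
  then have "dproj x u (F x) + tproj N x (dir_deriv N F x u) = 0"
    using dir_deriv_tproj[OF F(1) x u] by simp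
  then have "u \<bullet> tproj N x (dir_deriv N F x u) = - (u \<bullet> dproj x u (F x))"
    by (metis add_eq_0_iff inner_minus_right)
  then show ?thesis
    by (simp add: tproj_symmetric[OF x, symmetric] tproj_ident[OF x u] dproj_symmetric[OF x u])
qed

end

context maps_setting
begin

lemma alpha_harmonic_unstable:
  assumes \<alpha>: "\<alpha> > 1" and con: "connected M"
    and harm: "alpha_harmonic \<alpha> M A G N \<psi>" and nonconst: "\<not> \<psi> constant_on M"
    and cond: "\<And>x v. x \<in> N \<Longrightarrow> v \<in> tangent_space N x \<Longrightarrow> norm v = 1 \<Longrightarrow>
           2 * (\<alpha> - 1) * ff_max N x + ff_theta N x v < ricci N x v v"
  shows "alpha_unstable \<alpha> M A G N \<psi>"
proof
  assume stable: "alpha_stable \<alpha> M A G N \<psi>"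
  have \<psi>: "smooth_map_into M A N \<psi>" using harm by (simp add: alpha_harmonic_def)
  have s\<psi>: "smooth_from A \<psi>" and inN: "\<And>y. y \<in> M \<Longrightarrow> \<psi> y \<in> N" using \<psi> by (auto simp: smooth_map_into_def)
  define \<omega> where "\<omega> a x = tproj N (\<psi> x) a" for a x
  define \<nu> where "\<nu> a x = dproj (\<psi> x) (tproj N (\<psi> x) a) (tproj N (\<psi> x) a)" for a x
  have s\<omega>: "smooth_from A (\<omega> a)" for a
    unfolding \<omega>_def[abs_def] by (rule smooth_from_along[OF smooth_along_tproj \<psi>])
  have s\<nu>: "smooth_from A (\<nu> a)" for a
    unfolding \<nu>_def[abs_def] by (rule smooth_from_along[OF smooth_along_normal_square \<psi>])
  have \<omega>: "field_along M A N \<psi> (\<omega> a)" for a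
    unfolding field_along_def using s\<omega> tproj_in[OF inN] by (simp add: \<omega>_def)
  have cont: "continuous_on M (alpha_second \<alpha> \<psi> (\<omega> a) (\<omega> a) (\<nu> a))" for a
    by (rule alpha_second_continuous[OF s\<psi> s\<omega> s\<omega> s\<nu>])
  let ?Z = "\<lambda>x. \<Sum>a\<in>Basis. alpha_second \<alpha> \<psi> (\<omega> a) (\<omega> a) (\<nu> a) x"
  have Z: "?Z x \<le> 0" "frame_deriv \<psi> x i \<noteq> 0 \<Longrightarrow> ?Z x < 0" if x: "x \<in> M" for x i
  proof -
    let ?u = "frame_deriv \<psi> x"
    have u: "?u i \<in> tangent_space N (\<psi> x)" for i by (rule frame_deriv_tangent[OF \<psi> x])
    note y = inN[OF x]
    have h: "hs_inner \<psi> \<psi> x = (\<Sum>i\<in>UNIV. (norm (?u i))\<^sup>2)" by (simp add: hs_inner_def dot_square_norm)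
    \<comment> \<open>The full ambient derivative is taken, tangential and normal parts together, so
      both off-diagonal blocks of \<open>dproj\<close> enter the sum over \<open>a\<close>.\<close>
    have d\<omega>: "frame_deriv (\<omega> a) x i = dproj (\<psi> x) (?u i) a" for a i
      unfolding \<omega>_def[abs_def] dproj_def by (rule frame_deriv_along[OF smooth_along_tproj \<psi> x])
    \<comment> \<open>Source of the minus sign in front of the mean curvature term, which is what
      lets the Ricci curvature enter with the favourable sign.\<close>
    have d\<nu>: "?u i \<bullet> frame_deriv (\<nu> a) x i = - (dproj (\<psi> x) (?u i) (?u i) \<bullet> \<nu> a x)" for a i
      unfolding \<nu>_def[abs_def] frame_deriv_along[OF smooth_along_normal_square \<psi> x]
      by (rule tangential_derivative_of_normal_field[OF smooth_along_normal_square _ y u])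
        (simp add: tproj_dproj tproj_in)
    have "alpha_second \<alpha> \<psi> (\<omega> a) (\<omega> a) (\<nu> a) x =
      4 * \<alpha> * (\<alpha> - 1) * (1 + (\<Sum>i\<in>UNIV. (norm (?u i))\<^sup>2)) powr (\<alpha> - 2) *
        (\<Sum>i\<in>UNIV. dproj (\<psi> x) (?u i) a \<bullet> ?u i)\<^sup>2 +
      2 * \<alpha> * (1 + (\<Sum>i\<in>UNIV. (norm (?u i))\<^sup>2)) powr (\<alpha> - 1) * ((\<Sum>i\<in>UNIV. (norm (dproj (\<psi> x) (?u i) a))\<^sup>2) -
        (\<Sum>i\<in>UNIV. dproj (\<psi> x) (?u i) (?u i) \<bullet> dproj (\<psi> x) (tproj N (\<psi> x) a) (tproj N (\<psi> x) a)))" for a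
    proof -
      have 1: "hs_inner \<psi> (\<omega> a) x = (\<Sum>i\<in>UNIV. dproj (\<psi> x) (?u i) a \<bullet> ?u i)"
        by (simp add: hs_inner_def d\<omega> inner_commute)
      have 2: "hs_inner (\<omega> a) (\<omega> a) x = (\<Sum>i\<in>UNIV. (norm (dproj (\<psi> x) (?u i) a))\<^sup>2)"
        by (simp add: hs_inner_def d\<omega> dot_square_norm)
      have 3: "hs_inner \<psi> (\<nu> a) x =
          - (\<Sum>i\<in>UNIV. dproj (\<psi> x) (?u i) (?u i) \<bullet> dproj (\<psi> x) (tproj N (\<psi> x) a) (tproj N (\<psi> x) a))"
        unfolding hs_inner_def d\<nu> by (simp add: sum_negf \<nu>_def)
      show ?thesis unfolding alpha_second_def 1 2 3 h by (simp add: power2_eq_square)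
    qed
    then have eq: "?Z x = (\<Sum>a\<in>Basis.
      4 * \<alpha> * (\<alpha> - 1) * (1 + (\<Sum>i\<in>UNIV. (norm (?u i))\<^sup>2)) powr (\<alpha> - 2) *
        (\<Sum>i\<in>UNIV. dproj (\<psi> x) (?u i) a \<bullet> ?u i)\<^sup>2 +
      2 * \<alpha> * (1 + (\<Sum>i\<in>UNIV. (norm (?u i))\<^sup>2)) powr (\<alpha> - 1) * ((\<Sum>i\<in>UNIV. (norm (dproj (\<psi> x) (?u i) a))\<^sup>2) -
        (\<Sum>i\<in>UNIV. dproj (\<psi> x) (?u i) (?u i) \<bullet> dproj (\<psi> x) (tproj N (\<psi> x) a) (tproj N (\<psi> x) a))))"
      by (rule sum.cong[OF refl])
    show "?Z x \<le> 0" unfolding eq by (rule index_integrand_negative(1)[OF cond[OF y] \<alpha> y u])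
    show "?u i \<noteq> 0 \<Longrightarrow> ?Z x < 0" unfolding eq by (rule index_integrand_negative(2)[OF cond[OF y] \<alpha> y u])
  qed
  \<comment> \<open>Connectedness enters here: a non-constant map has a nonzero frame derivative
    somewhere, so the summed integrand is negative at some point.\<close>
  obtain x i where x: "x \<in> M" "frame_deriv \<psi> x i \<noteq> 0"
    using frame_deriv_zero_imp_constant[OF s\<psi> con] nonconst by blast
  have "(\<Sum>a\<in>Basis. index_form \<alpha> M A G N \<psi> (\<omega> a) (\<omega> a)) =
      (\<Sum>a\<in>Basis. \<integral>x. alpha_second \<alpha> \<psi> (\<omega> a) (\<omega> a) (\<nu> a) x \<partial>vol)"
    by (intro sum.cong refl index_form_eq[OF harm \<omega> s\<nu>]) (simp add: \<nu>_def \<omega>_def)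
  also have "\<dots> = (\<integral>x. ?Z x \<partial>vol)"
    by (rule Bochner_Integration.integral_sum[symmetric]) (rule integrable_continuous[OF cont])
  also have "\<dots> < 0"
    by (rule integral_negative[OF continuous_on_sum[OF cont] Z(1) x(1) Z(2)[OF x]])
  finally have neg: "(\<Sum>a\<in>Basis. index_form \<alpha> M A G N \<psi> (\<omega> a) (\<omega> a)) < 0" .
  have "(\<Sum>a\<in>Basis. index_form \<alpha> M A G N \<psi> (\<omega> a) (\<omega> a)) \<ge> 0"
    using stable \<omega> unfolding alpha_stable_def by (intro sum_nonneg) blast
  then show False using neg by simp
qed

end

theorem theorem10:
  fixes \<alpha> :: real
    and n :: nat
    and M :: "'a::{t2_space, second_countable_topology} set"
    and A :: "('a, 'm::finite) coord_chart set"
    and G :: "('a, 'm) coord_chart \<Rightarrow> 'a \<Rightarrow> real ^ 'm ^ 'm"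
    and N :: "'e::euclidean_space set"
    and \<psi> :: "'a \<Rightarrow> 'e"
  assumes "\<alpha> > 1"
    and "smooth_atlas M A" and "riemannian_metric A G"
    and "compact M" and "connected M" and "orientable_manifold M A"
    and "embedded_submanifold n N"
    and "alpha_harmonic \<alpha> M A G N \<psi>"
    and "\<not> \<psi> constant_on M"
    and "\<And>x v. x \<in> N \<Longrightarrow> v \<in> tangent_space N x \<Longrightarrow> norm v = 1 \<Longrightarrow>
           2 * (\<alpha> - 1) * ff_max N x + ff_theta N x v < ricci N x v v"
  shows "alpha_unstable \<alpha> M A G N \<psi>"
proof -
  interpret maps_setting M A G n N
    by unfold_locales (use assms in auto)
  show ?thesis
    by (rule alpha_harmonic_unstable[OF assms(1,5,8,9,10)])
qed

end
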